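(* Let $\xi_0,\xi_1,\ldots$ be nondegenerate i.i.d. complex-valued random variables with $\mathbb{E}\log(1+|\xi_0|)<\infty$. Let $\alpha>0$, $\beta\in\mathbb{R}$, and let $w_0,w_1,\ldots$ be a deterministic complex sequence satisfying $$\log|w_k|=-\alpha(k\log k-k)-\beta k+o(k),\qquad k\to\infty.$$ Let $\mathbf{W}(z)=\sum_{k=0}^\infty\xi_kw_kz^k$ be the corresponding random entire function, and for $n\in\mathbb{N}$ define the random measure $\mu_n$ by $\mu_n(B)=\mu_{\mathbf{W}}(e^{\beta}n^{\alpha}B)$ for Borel sets $B\subset\mathbb{C}$. Then, with probability $1$, the random measure $\frac1n\mu_n$ converges, as $n\to\infty$, to the deterministic measure having the density $$z\mapsto\frac1{2\pi\alpha}|z|^{(1/\alpha)-2}$$ with respect to Lebesgue measure on $\mathbb{C}$.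
   Context: "Nondegenerate" means not a.s. constant. The series defining $\mathbf{W}$ converges a.s. on all of $\mathbb{C}$. For an entire function $G$ not identically zero, $\mu_G=\sum_{z\in\mathbb{C}: G(z)=0}n_G(z)\,\delta(z)$, where $n_G(z)$ is the multiplicity of the zero $z$ and $\delta(z)$ is the unit mass at $z$; if $G\equiv 0$, then $\mu_G=0$. Thus $\mu_n$ counts (with multiplicity) the points $e^{-\beta}n^{-\alpha}z$, where $z$ runs over the zeros of $\mathbf{W}$. Convergence of locally finite measures on $\mathbb{C}$ is vague convergence, i.e. convergence of integrals of all continuous compactly supported functions. *)

theory Defs
  imports "HOL-Probability.Probability" "HOL-Complex_Analysis.Complex_Analysis"
    "HOL-Library.Landau_Symbols"
begin

definition random_power_series ::
    "(nat \<Rightarrow> 'a \<Rightarrow> complex) \<Rightarrow> (nat \<Rightarrow> complex) \<Rightarrow> 'a \<Rightarrow> complex \<Rightarrow> complex" where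
  "random_power_series \<xi> w \<omega> z = (\<Sum>k. \<xi> k \<omega> * w k * z ^ k)"

text \<open>For an entire \<open>G\<close> that is not identically zero, the order \<open>zorder G z\<close> at a zero \<open>z\<close> is
  the (positive) multiplicity of that zero.\<close>

definition zero_measure :: "(complex \<Rightarrow> complex) \<Rightarrow> complex measure" where
  "zero_measure G =
    (if \<forall>z. G z = 0 then null_measure borel
     else distr (point_measure {z. G z = 0} (\<lambda>z. of_nat (nat (zorder G z)))) borel (\<lambda>z. z))"

lemma sets_zero_measure: "sets (zero_measure G) = sets borel"
  by (simp add: zero_measure_def)

lemma space_zero_measure: "space (zero_measure G) = UNIV"
  by (simp add: zero_measure_def)

lemma emeasure_zero_measure:
  assumes "\<not> (\<forall>z. G z = 0)" "B \<in> sets borel"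
  shows "emeasure (zero_measure G) B =
    (\<integral>\<^sup>+z. of_nat (nat (zorder G z)) \<partial>count_space {z\<in>B. G z = 0})"
proof -
  have "emeasure (zero_measure G) B =
      emeasure (point_measure {z. G z = 0} (\<lambda>z. of_nat (nat (zorder G z)))) {z\<in>B. G z = 0}"
    using assms unfolding zero_measure_def
    by (subst if_not_P, simp, subst emeasure_distr)
       (auto simp: point_measure_def space_point_measure intro!: arg_cong2[where f=emeasure])
  also have "\<dots> = (\<integral>\<^sup>+z. of_nat (nat (zorder G z)) * indicator {z\<in>B. G z = 0} z
      \<partial>count_space {z. G z = 0})"
    unfolding point_measure_def by (subst emeasure_density) auto
  also have "\<dots> = (\<integral>\<^sup>+z. of_nat (nat (zorder G z)) \<partial>count_space {z\<in>B. G z = 0})"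
    unfolding nn_integral_count_space_indicator[of "{z. G z = 0}", simplified]
      nn_integral_count_space_indicator[of "{z\<in>B. G z = 0}", simplified]
    by (intro nn_integral_cong) (auto simp: indicator_def)
  finally show ?thesis .
qed

text \<open>The measure \<open>B \<mapsto> \<mu>\<^sub>G (e\<^sup>\<beta> n\<^sup>\<alpha> B)\<close>, written as the image of \<open>\<mu>\<^sub>G\<close> under division by
  \<open>e\<^sup>\<beta> n\<^sup>\<alpha>\<close>; see \<open>emeasure_rescaled_zero_measure\<close>. For \<open>n = 0\<close> the divisor is 0 and the
  measure has no meaning; only \<open>n > 0\<close> matters for the limit.\<close>

definition rescaled_zero_measure ::
    "real \<Rightarrow> real \<Rightarrow> (complex \<Rightarrow> complex) \<Rightarrow> nat \<Rightarrow> complex measure" where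
  "rescaled_zero_measure \<alpha> \<beta> G n =
    distr (zero_measure G) borel (\<lambda>z. z / of_real (exp \<beta> * real n powr \<alpha>))"

lemma emeasure_rescaled_zero_measure:
  assumes "n > 0" "B \<in> sets borel"
  shows "emeasure (rescaled_zero_measure \<alpha> \<beta> G n) B =
    emeasure (zero_measure G) ((\<lambda>z. of_real (exp \<beta> * real n powr \<alpha>) * z) ` B)"
proof -
  define c where "c = complex_of_real (exp \<beta> * real n powr \<alpha>)"
  have c: "c \<noteq> 0" using assms by (simp add: c_def)
  have meas: "(\<lambda>z. z / c) \<in> measurable (zero_measure G) borel"
    by (subst measurable_cong_sets[OF sets_zero_measure refl]) simp
  have "(\<lambda>z. z / c) -` B = (\<lambda>z. c * z) ` B"
  proof (intro set_eqI iffI)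
    fix z assume "z \<in> (\<lambda>z. z / c) -` B"
    then show "z \<in> (\<lambda>z. c * z) ` B" using c by (intro image_eqI[of _ _ "z / c"]) auto
  qed (use c in auto)
  then show ?thesis
    using emeasure_distr[OF meas assms(2)]
    unfolding rescaled_zero_measure_def c_def[symmetric] by (simp add: space_zero_measure)
qed

definition locally_finite_measure :: "complex measure \<Rightarrow> bool" where
  "locally_finite_measure N \<longleftrightarrow>
    sets N = sets borel \<and> (\<forall>K. compact K \<longrightarrow> emeasure N K < \<infinity>)"

text \<open>Requiring local finiteness guarantees that every integral below is of an integrable function,
  so that the value 0 the library assigns to non-integrable functions never occurs.\<close>

definition converges_vaguely :: "(nat \<Rightarrow> complex measure) \<Rightarrow> complex measure \<Rightarrow> bool" where
  "converges_vaguely N L \<longleftrightarrow>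
    (\<forall>n. locally_finite_measure (N n)) \<and> locally_finite_measure L \<and>
    (\<forall>f :: complex \<Rightarrow> real. continuous_on UNIV f \<longrightarrow> compact (closure {z. f z \<noteq> 0}) \<longrightarrow>
      (\<lambda>n. integral\<^sup>L (N n) f) \<longlonglongrightarrow> integral\<^sup>L L f)"

end

theory Submission
  imports Defs "HOL-Real_Asymp.Real_Asymp"
begin

text \<open>The idea is potential-theoretic. Put \<open>c\<^sub>n = e\<^sup>\<beta> n\<^sup>\<alpha>\<close>,
  \<open>v\<^sub>n(z) = log |W (c\<^sub>n z)| / n\<close> and \<open>u(z) = \<alpha> |z|\<^bsup>1/\<alpha>\<^esup>\<close>. Up to an additive constant, \<open>u\<close> is on each
  disk the logarithmic potential of the limit measure, and \<open>v\<^sub>n\<close> is that of \<open>\<mu>\<^sub>n / n\<close> up to a harmonic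
  function, so it suffices to show that \<open>v\<^sub>n\<close> tends to \<open>u\<close> in \<open>L\<^sup>1\<close> on disks.

  The logarithmic moment gives \<open>v\<^sub>n \<le> u + o(1)\<close> locally uniformly by the Borel-Cantelli lemma. For
  fixed \<open>a \<noteq> 0\<close>, a positive fraction of the first \<open>O(n)\<close> terms of \<open>W (c\<^sub>n a)\<close> have coefficients
  exponentially larger than \<open>e\<^bsup>n (u(a) - \<delta>)\<^esup>\<close>; symmetrisation and the Littlewood-Offord inequality then bound
  the probability of \<open>v\<^sub>n(a) < u(a) - \<delta>\<close> by \<open>O(n\<^bsup>-1/4\<^esup>)\<close>, which is summable along \<open>n = 2\<^sup>j\<close>. A lower bound
  at the centre of a small disk controls the integral of \<open>u - v\<^sub>n\<close> over it by the sub-mean value property, so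
  countably many centres suffice; homogeneity of \<open>u\<close> passes from powers of two to all \<open>n\<close>.\<close>

section \<open>Rotation invariance and circular means\<close>

text \<open>No distributional Laplacian is used. Its place is taken by the operator "area mean over
  a disk of fixed radius r minus value", which is symmetric, is defined on merely bounded measurable
  test functions, and turns \<open>ln |z - x|\<close> into an explicit integrable kernel supported
  in the disk of radius r around x. An L1 limit of logarithms thus yields limits of zero counts
  tested against \<open>kernel_smooth r f\<close>, and r is made small only at the end. That last
  step needs a bound on the number of zeros per n, which comes from the same identity with a plateau
  function. The exponent 1/4 arises because symmetrisation controls only the square of a small-ball
  probability, for which Littlewood-Offord gives the order \<open>n^(-1/2)\<close>. The rate is not
  summable over all n, hence the powers of two. Only a logarithmic moment is at hand, so
  anti-concentration cannot rely on the size of the coefficients: it uses only that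
  \<open>\<xi> 0 - \<xi> 1\<close> stays away from 0 with positive probability.\<close>

lemma lborel_complex_eq_distr_vec:
  "(lborel :: complex measure) = distr lborel borel (\<lambda>x::real^2. Complex (x$1) (x$2))"
proof (rule lborel_eqI)
  let ?\<phi> = "\<lambda>x::real^2. Complex (x$1) (x$2)"
  have m: "?\<phi> \<in> borel_measurable borel"
    by (intro borel_measurable_continuous_onI) (auto simp: Complex_eq intro!: continuous_intros)
  fix l u :: complex assume lu: "\<And>b. b \<in> Basis \<Longrightarrow> l \<bullet> b \<le> u \<bullet> b"
  let ?l = "vector [Re l, Im l] :: real^2" and ?u = "vector [Re u, Im u] :: real^2"
  have "?\<phi> -` box l u = box ?l ?u"
    by (auto simp: box_def Basis_complex_def Basis_vec_def inner_axis forall_2 inner_complex_def UNIV_2 axis_def inner_vec_def)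
  then have "emeasure (distr lborel borel ?\<phi>) (box l u) = emeasure lborel (box ?l ?u)"
    using m by (simp add: emeasure_distr)
  also have "\<dots> = (\<Prod>b\<in>Basis. (?u - ?l) \<bullet> b)"
    using lu[of 1] lu[of \<i>] by (subst emeasure_lborel_box) (auto simp: Basis_vec_def inner_axis forall_2 Basis_complex_def UNIV_2)
  also have "(\<Prod>b\<in>Basis. (?u - ?l) \<bullet> b) = (\<Prod>b\<in>Basis. (u - l) \<bullet> b)"
  proof -
    have B: "(Basis :: (real^2) set) = {axis 1 1, axis 2 1}"
      by (auto simp: Basis_vec_def UNIV_2)
    have "axis 1 1 \<noteq> (axis 2 1 :: real^2)" by (simp add: axis_eq_axis)
    then show ?thesis unfolding B
      by (simp add: Basis_complex_def inner_axis)
  qed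
  finally show "emeasure (distr lborel borel ?\<phi>) (box l u) = (\<Prod>b\<in>Basis. (u - l) \<bullet> b)" .
qed simp

text \<open>Orthogonal maps of \<open>real^2\<close> preserve Lebesgue measure; the coordinate
  isomorphism above carries this over to multiplication by a unimodular number.\<close>

lemma lborel_distr_rotation:
  fixes c :: complex
  assumes c: "norm c = 1"
  shows "distr lborel borel (\<lambda>z. c * z) = lborel"
proof -
  let ?\<phi> = "\<lambda>x::real^2. Complex (x$1) (x$2)"
  have m\<phi>: "?\<phi> \<in> borel_measurable borel"
    by (intro borel_measurable_continuous_onI) (auto simp: Complex_eq intro!: continuous_intros)
  define T where "T = (\<lambda>x::real^2. vector [Re c * x$1 - Im c * x$2, Im c * x$1 + Re c * x$2] :: real^2)"
  \<comment> \<open>\<open>S\<close> is rotation by \<open>cnj c\<close>, the inverse of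
    \<open>T\<close>: the preimage of a box under \<open>T\<close> is its image under
    \<open>S\<close>, and images are what the invariance theorem speaks of.\<close>
  define S where "S = (\<lambda>x::real^2. vector [Re c * x$1 + Im c * x$2, - Im c * x$1 + Re c * x$2] :: real^2)"
  have c2: "(Re c)\<^sup>2 + (Im c)\<^sup>2 = 1" using c by (simp add: cmod_def)
  have TS: "T (S x) = x" "S (T x) = x" for x
  proof -
    have e: "Im c * (Im c * t) + Re c * (Re c * t) = t" for t
      using c2 by (metis add.commute distrib_right mult.assoc mult_1 power2_eq_square)
    show "T (S x) = x" "S (T x) = x"
      by (simp_all add: vec_eq_iff forall_2 T_def S_def algebra_simps e)
  qed
  have orth: "orthogonal_transformation S"
  proof -
    have n: "norm (S x) = norm x" for x
    proof -
      have "(Re c * x$1 + Im c * x$2)\<^sup>2 + (- Im c * x$1 + Re c * x$2)\<^sup>2 = ((Re c)\<^sup>2 + (Im c)\<^sup>2) * ((x$1)\<^sup>2 + (x$2)\<^sup>2)"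
        by algebra
      then show ?thesis
        unfolding norm_vec_def L2_set_def by (simp add: S_def UNIV_2 c2)
    qed
    have "linear S"
      by (rule linearI) (simp_all add: S_def vec_eq_iff forall_2 algebra_simps)
    then show ?thesis unfolding orthogonal_transformation using n by blast
  qed
  have mT: "T \<in> borel_measurable borel"
  proof -
    have "linear T"
      by (rule linearI) (simp_all add: T_def vec_eq_iff forall_2 algebra_simps)
    then show ?thesis by (intro borel_measurable_continuous_onI linear_continuous_on) (simp add: linear_conv_bounded_linear)
  qed
  have T: "distr lborel borel T = lborel"
  proof (rule lborel_eqI[symmetric])
    fix l u :: "real^2" assume lu: "\<And>b. b \<in> Basis \<Longrightarrow> l \<bullet> b \<le> u \<bullet> b"
    have eq: "T -` box l u = S ` box l u"
      using TS by (metis (no_types, opaque_lifting) bijI' bij_vimage_eq_inv_image inv_equality)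
    have b: "box l u \<in> lmeasurable" by simp
    have bS: "S ` box l u \<in> sets borel"
      using eq measurable_sets_borel[OF mT, of "box l u"] by simp
    have "emeasure (distr lborel borel T) (box l u) = emeasure lborel (S ` box l u)"
      using mT eq by (simp add: emeasure_distr)
    also have "\<dots> = emeasure lebesgue (S ` box l u)" using bS by simp
    also have "\<dots> = ennreal (measure lebesgue (S ` box l u))"
      using measurable_orthogonal_image[OF orth b] by (simp add: emeasure_eq_measure2 fmeasurableD2)
    also have "\<dots> = emeasure lebesgue (box l u)"
      using measure_orthogonal_image[OF orth b] b by (simp add: emeasure_eq_measure2 fmeasurableD2)
    also have "\<dots> = emeasure lborel (box l u)" by simp
    finally show "emeasure (distr lborel borel T) (box l u) = (\<Prod>b\<in>Basis. (u - l) \<bullet> b)"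
      using lu by (simp add: emeasure_lborel_box)
  qed simp
  have "distr lborel borel (\<lambda>z. c * z) = distr (distr lborel borel ?\<phi>) borel (\<lambda>z. c * z)"
    using lborel_complex_eq_distr_vec by simp
  also have "\<dots> = distr lborel borel (\<lambda>x. c * ?\<phi> x)"
    by (subst distr_distr) (use m\<phi> in \<open>auto simp: comp_def\<close>)
  also have "(\<lambda>x. c * ?\<phi> x) = ?\<phi> \<circ> T"
    by (auto simp: fun_eq_iff complex_eq_iff T_def)
  also have "distr lborel borel (?\<phi> \<circ> T) = distr (distr lborel borel T) borel ?\<phi>"
    by (rule distr_distr[symmetric]) (use m\<phi> mT in auto)
  also have "\<dots> = lborel" by (simp add: T lborel_complex_eq_distr_vec[symmetric])
  finally show ?thesis .
qed

section \<open>Radial integrals and the logarithmic singularity\<close>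

lemma mult_abs_ln_le:
  fixes s :: real
  assumes "s \<ge> 0"
  shows "s * \<bar>ln s\<bar> \<le> 1 + s\<^sup>2"
proof (cases "s = 0")
  case False
  with assms have s: "s > 0" by simp
  show ?thesis
  proof (cases "s < 1")
    case True
    have "- ln s = ln (1 / s)" using s by (simp add: ln_div)
    also have "\<dots> \<le> 1 / s - 1" by (rule ln_le_minus_one) (use s in simp)
    finally have "s * (- ln s) \<le> s * (1 / s - 1)" using s by (intro mult_left_mono) auto
    also have "\<dots> \<le> 1" using s by (simp add: algebra_simps)
    finally have "s * (- ln s) \<le> 1" .
    moreover have "\<bar>ln s\<bar> = - ln s" using True s by simp
    ultimately have "s * \<bar>ln s\<bar> \<le> 1" by (simp only:)
    then show ?thesis using zero_le_power2[of s] by linarith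
  next
    case False
    have "s * \<bar>ln s\<bar> \<le> s * s" using False ln_le_minus_one[of s] by (intro mult_left_mono) auto
    then show ?thesis by (simp add: power2_eq_square)
  qed
qed simp

text \<open>The radial half of polar coordinates, without a Jacobian: measures on the line that are
  finite on the half-lines \<open>{s<..}\<close> are determined by them, and here each such value is
  the area of an annulus.\<close>

lemma distr_norm_ball:
  assumes R: "R > 0"
  shows "distr (density lborel (indicator (ball (0::complex) R))) borel norm =
    density lborel (\<lambda>s. ennreal (2 * pi * s) * indicator {0..<R} s)"
proof (rule measure_eqI_lessThan)
  \<comment> \<open>\<open>max 0 (min s R)\<close> clamps the radius, so that one formula covers
    negative \<open>s\<close>, \<open>s\<close> inside the disk and \<open>s\<close> beyond
    it.\<close>
  have L: "emeasure (distr (density lborel (indicator (ball (0::complex) R))) borel norm) {s<..} =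
      ennreal (pi * R\<^sup>2 - pi * (max 0 (min s R))\<^sup>2)" for s
  proof -
    have "emeasure (distr (density lborel (indicator (ball (0::complex) R))) borel norm) {s<..} =
      emeasure lborel (ball (0::complex) R \<inter> norm -` {s<..})"
    proof -
      have "norm -` {s<..} \<in> sets (borel :: complex measure)"
        using measurable_sets_borel[OF borel_measurable_norm, of "{s<..}"] by simp
      then show ?thesis by (simp add: emeasure_distr emeasure_restricted)
    qed
    also have "\<dots> = ennreal (pi * R\<^sup>2 - pi * (max 0 (min s R))\<^sup>2)"
    proof (cases "s \<ge> 0")
      case True
      then have "ball (0::complex) R \<inter> norm -` {s<..} = ball 0 R - cball 0 (min s R)"
        by (auto simp: not_le)
      moreover have "emeasure lborel (ball (0::complex) R - cball 0 (min s R)) =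
        emeasure lborel (ball (0::complex) R) - emeasure lborel (ball (0::complex) R \<inter> cball 0 (min s R))"
      proof -
        have "emeasure lborel (ball (0::complex) R \<inter> cball 0 (min s R)) \<noteq> \<infinity>"
          using emeasure_bounded_finite[of "ball (0::complex) R \<inter> cball 0 (min s R)"] by (simp add: bounded_Int)
        moreover have "ball (0::complex) R - cball 0 (min s R) = ball 0 R - (ball 0 R \<inter> cball 0 (min s R))" by blast
        ultimately show ?thesis by (simp add: emeasure_Diff)
      qed
      moreover have "emeasure lborel (ball (0::complex) R \<inter> cball 0 (min s R)) = ennreal (pi * (min s R)\<^sup>2)"
      proof (cases "s < R")
        case True2: True
        then have "ball (0::complex) R \<inter> cball 0 (min s R) = cball 0 s" by auto
        then show ?thesis using True True2 by (simp add: emeasure_cball eval_unit_ball_vol)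
      next
        case False
        then have "ball (0::complex) R \<inter> cball 0 (min s R) = ball 0 R" by auto
        then show ?thesis using R False by (simp add: emeasure_ball eval_unit_ball_vol)
      qed
      ultimately show ?thesis using True R
        by (simp add: emeasure_ball eval_unit_ball_vol ennreal_minus)
    next
      case False
      then have "ball (0::complex) R \<inter> norm -` {s<..} = ball 0 R"
        by (auto simp: not_le intro: less_le_trans[OF _ norm_ge_zero])
      then show ?thesis using False R by (simp add: emeasure_ball eval_unit_ball_vol)
    qed
    finally show ?thesis .
  qed
  show "emeasure (distr (density lborel (indicator (ball (0::complex) R))) borel norm) {s<..} < \<infinity>" for s
    by (subst L) simp
  show "emeasure (distr (density lborel (indicator (ball (0::complex) R))) borel norm) {s<..} =
    emeasure (density lborel (\<lambda>s. ennreal (2 * pi * s) * indicator {0..<R} s)) {s<..}" for s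
  proof -
    let ?m = "max 0 (min s R)"
    have "emeasure (density lborel (\<lambda>s. ennreal (2 * pi * s) * indicator {0..<R} s)) {s<..} =
      (\<integral>\<^sup>+t. ennreal (2 * pi * t) * indicator {0..<R} t * indicator {s<..} t \<partial>lborel)"
      by (simp add: emeasure_density)
    also have "\<dots> = (\<integral>\<^sup>+t. ennreal (2 * pi * t) * indicator {?m..R} t \<partial>lborel)"
    proof (rule nn_integral_cong_AE)
      show "AE t in lborel. ennreal (2 * pi * t) * indicator {0..<R} t * indicator {s<..} t = ennreal (2 * pi * t) * indicator {?m..R} t"
        using AE_lborel_singleton[of s] AE_lborel_singleton[of R] AE_lborel_singleton[of 0]
        by eventually_elim (auto simp: indicator_def)
    qed
    also have "\<dots> = ennreal (pi * R\<^sup>2 - pi * ?m\<^sup>2)"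
      by (subst nn_integral_FTC_Icc[where F = "\<lambda>t. pi * t\<^sup>2"])
         (use R in \<open>auto intro!: derivative_eq_intros\<close>)
    finally show ?thesis unfolding L by simp
  qed
qed simp_all

lemma integral_radial:
  assumes R: "R > 0" and [measurable]: "g \<in> borel_measurable borel"
  shows "(LINT x:ball (0::complex) R|lborel. g (norm x)) = (LINT s:{0..<R}|lborel. 2 * pi * s * g s)"
    and "set_integrable lborel (ball (0::complex) R) (\<lambda>x. g (norm x)) \<longleftrightarrow>
      set_integrable lborel {0..<R} (\<lambda>s. 2 * pi * s * g s)"
proof -
  have d: "density lborel (\<lambda>s. ennreal (2 * pi * s) * indicator {0..<R} s) =
      density lborel (\<lambda>s. ennreal (2 * pi * s * indicator {0..<R} s))"
    by (intro arg_cong2[where f = density] ext) (auto simp: indicator_def)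
  have d2: "density lborel (indicator (ball (0::complex) R)) = density lborel (\<lambda>x. ennreal (indicator (ball (0::complex) R) x))"
    by (intro arg_cong2[where f = density] ext) (auto simp: indicator_def)
  have "(LINT x:ball (0::complex) R|lborel. g (norm x)) =
      integral\<^sup>L (distr (density lborel (indicator (ball (0::complex) R))) borel norm) g"
    unfolding d2 by (subst integral_distr, simp, simp, subst integral_density) (auto simp: set_lebesgue_integral_def intro!: borel_measurable_indicator)
  also have "\<dots> = (LINT s:{0..<R}|lborel. 2 * pi * s * g s)"
    unfolding distr_norm_ball[OF R] d
    by (subst integral_density) (auto simp: set_lebesgue_integral_def ac_simps indicator_def intro!: AE_I2 Bochner_Integration.integral_cong)
  finally show "(LINT x:ball (0::complex) R|lborel. g (norm x)) = (LINT s:{0..<R}|lborel. 2 * pi * s * g s)" .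
  have "set_integrable lborel (ball (0::complex) R) (\<lambda>x. g (norm x)) \<longleftrightarrow>
      integrable (distr (density lborel (indicator (ball (0::complex) R))) borel norm) g"
    unfolding d2 by (subst integrable_distr_eq, simp, simp, subst integrable_density) (auto simp: set_integrable_def intro!: borel_measurable_indicator)
  also have "\<dots> \<longleftrightarrow> set_integrable lborel {0..<R} (\<lambda>s. 2 * pi * s * g s)"
    unfolding distr_norm_ball[OF R] d
    by (subst integrable_density) (auto simp: set_integrable_def ac_simps indicator_def intro!: AE_I2 Bochner_Integration.integrable_cong)
  finally show "set_integrable lborel (ball (0::complex) R) (\<lambda>x. g (norm x)) \<longleftrightarrow>
      set_integrable lborel {0..<R} (\<lambda>s. 2 * pi * s * g s)" .
qed

lemma set_integrable_lborel_bounded: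
  fixes g :: "'a::euclidean_space \<Rightarrow> real"
  assumes [measurable]: "S \<in> sets borel" "g \<in> borel_measurable borel" and S: "bounded S"
    and B: "\<And>s. s \<in> S \<Longrightarrow> \<bar>g s\<bar> \<le> B"
  shows "set_integrable lborel S g"
proof (rule set_integrable_bound[of lborel S "\<lambda>_. B"])
  show "set_integrable lborel S (\<lambda>_. B)"
    unfolding set_integrable_def using emeasure_bounded_finite[OF S]
    by (intro integrable_scaleR_left) (simp_all add: integrable_indicator_iff)
  show "set_borel_measurable lborel S g" unfolding set_borel_measurable_def by measurable
  show "AE x in lborel. x \<in> S \<longrightarrow> norm (g x) \<le> norm B"
    using B by (auto intro!: AE_I2 order_trans[OF _ abs_ge_self])
qed

text \<open>In the radial integral the area factor \<open>2 * pi * s\<close> cancels the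
  singularity: \<open>s * ln s\<close> stays bounded near 0.\<close>

lemma set_integrable_ln_norm_0:
  "set_integrable lborel (ball (0::complex) R) (\<lambda>x. ln (norm x))"
proof (cases "R > 0")
  case True
  show ?thesis
  proof (subst integral_radial(2)[OF True])
    show "set_integrable lborel {0..<R} (\<lambda>s. 2 * pi * s * ln s)"
    proof (rule set_integrable_lborel_bounded)
      fix s assume s: "s \<in> {0..<R}"
      have "\<bar>2 * pi * s * ln s\<bar> = 2 * pi * (s * \<bar>ln s\<bar>)" using s by (simp add: abs_mult)
      also have "\<dots> \<le> 2 * pi * (1 + s\<^sup>2)" using s by (intro mult_left_mono mult_abs_ln_le) auto
      also have "\<dots> \<le> 2 * pi * (1 + R\<^sup>2)" using s by (intro mult_left_mono add_left_mono power_mono) auto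
      finally show "\<bar>2 * pi * s * ln s\<bar> \<le> 2 * pi * (1 + R\<^sup>2)" .
    qed auto
  qed simp
next
  case False
  then show ?thesis by (simp add: ball_empty set_integrable_def)
qed

lemma set_integrable_translate:
  fixes F :: "'a::euclidean_space \<Rightarrow> real"
  assumes [measurable]: "F \<in> borel_measurable borel" "A \<in> sets borel"
  shows "set_integrable lborel ((+) c -` A) (\<lambda>x. F (c + x)) \<longleftrightarrow> set_integrable lborel A F"
    and "(LINT x:((+) c -` A)|lborel. F (c + x)) = (LINT x:A|lborel. F x)"
proof -
  have *: "indicator ((+) c -` A) x = (indicator A (c + x) :: real)" for x by (simp add: indicator_def)
  have "set_integrable lborel ((+) c -` A) (\<lambda>x. F (c + x)) \<longleftrightarrow>
      integrable (distr lborel borel ((+) c)) (\<lambda>x. indicator A x *\<^sub>R F x)"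
    unfolding set_integrable_def by (subst integrable_distr_eq) (auto simp: *)
  then show "set_integrable lborel ((+) c -` A) (\<lambda>x. F (c + x)) \<longleftrightarrow> set_integrable lborel A F"
    by (simp add: lborel_distr_plus set_integrable_def)
  have "(LINT x:((+) c -` A)|lborel. F (c + x)) =
      (LINT x|distr lborel borel ((+) c). indicator A x *\<^sub>R F x)"
    unfolding set_lebesgue_integral_def by (subst integral_distr) (auto simp: *)
  then show "(LINT x:((+) c -` A)|lborel. F (c + x)) = (LINT x:A|lborel. F x)"
    by (simp add: lborel_distr_plus set_lebesgue_integral_def)
qed

lemma set_integrable_ln_norm:
  "set_integrable lborel (ball (a::complex) R) (\<lambda>x. ln (norm (y + x)))"
proof -
  let ?R = "R + norm (y + a)"
  have "set_integrable lborel ((+) y -` ball 0 ?R) (\<lambda>x. ln (norm (y + x)))"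
    by (subst set_integrable_translate) (auto intro: set_integrable_ln_norm_0)
  moreover have "ball a R \<subseteq> (+) y -` ball 0 ?R"
  proof
    fix x assume "x \<in> ball a R"
    then have "norm (x - a) < R" by (simp add: dist_norm norm_minus_commute)
    moreover have "norm (y + x) \<le> norm (x - a) + norm (y + a)"
      using norm_triangle_ineq[of "x - a" "y + a"] by (simp add: algebra_simps)
    ultimately show "x \<in> (+) y -` ball 0 ?R" by simp
  qed
  ultimately show ?thesis by (intro set_integrable_subset[of lborel _ _ "ball a R"]) auto
qed

section \<open>Means over circles\<close>

definition circle_measure :: "real measure" where
  "circle_measure = restrict_space lborel {0..1}"

lemma prob_space_circle_measure: "prob_space circle_measure"
  unfolding circle_measure_def by (rule prob_space_restrict_space) auto

lemma sets_circle_measure [measurable_cong]: "sets circle_measure = sets (restrict_space borel {0..1})"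
  by (simp add: circle_measure_def sets_restrict_space)

lemma borel_measurable_circle_measure:
  "f \<in> borel_measurable borel \<Longrightarrow> f \<in> borel_measurable circle_measure"
  by (simp add: circle_measure_def measurable_restrict_space1)

abbreviation unit_circle :: "real \<Rightarrow> complex" where
  "unit_circle t \<equiv> cis (2 * pi * t)"

lemma measurable_unit_circle [measurable]: "(\<lambda>t. unit_circle t) \<in> borel_measurable circle_measure"
  by (intro borel_measurable_circle_measure borel_measurable_continuous_onI continuous_intros)

text \<open>Cauchy's integral formula at the centre: on the unit circle the derivative of the path
  cancels the denominator up to the factor \<open>2 * pi * \<i>\<close>.\<close>

lemma unit_circle_mean_holomorphic:
  assumes f: "f holomorphic_on ball 0 R" and R: "R > 1"
  shows "(LINT t|circle_measure. Re (f (unit_circle t))) = Re (f 0)"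
proof -
  have "((\<lambda>u. f u/(u-0)) has_contour_integral (2 * of_real pi * \<i> * f 0)) (circlepath 0 1)"
    by (rule Cauchy_integral_circlepath_simple) (use f R in \<open>auto intro: holomorphic_on_subset\<close>)
  then have "((\<lambda>t. f (circlepath 0 1 t) / circlepath 0 1 t * vector_derivative (circlepath 0 1) (at t within {0..1}))
      has_integral (2 * of_real pi * \<i> * f 0)) {0..1}"
    by (simp add: has_contour_integral_def)
  then have "((\<lambda>t. 2 * of_real pi * \<i> * f (unit_circle t)) has_integral (2 * of_real pi * \<i> * f 0)) {0..1}"
  proof (rule has_integral_eq[rotated])
    fix t :: real assume t: "t \<in> {0..1}"
    have e: "vector_derivative (circlepath 0 1) (at t within {0..1}) = 2 * of_real pi * \<i> * unit_circle t"
      using t by (subst vector_derivative_circlepath01) (auto simp: cis_conv_exp mult_ac)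
    have p: "circlepath 0 1 t = unit_circle t" by (simp add: circlepath cis_conv_exp mult_ac)
    show "f (circlepath 0 1 t) / circlepath 0 1 t * vector_derivative (circlepath 0 1) (at t within {0..1}) =
      2 * of_real pi * \<i> * f (unit_circle t)"
      unfolding e p by simp
  qed
  from has_integral_mult_right[OF this, of "1 / (2 * of_real pi * \<i>)"]
  have "((\<lambda>t. f (unit_circle t)) has_integral f 0) {0..1}" by simp
  from has_integral_linear[OF this bounded_linear_Re]
  have 1: "((\<lambda>t. Re (f (unit_circle t))) has_integral Re (f 0)) {0..1}" by (simp add: comp_def)
  have "continuous_on {0..1} (\<lambda>t. Re (f (unit_circle t)))"
  proof (intro continuous_intros)
    show "continuous_on {0..1} (\<lambda>t. f (unit_circle t))"
      by (rule continuous_on_compose2[OF holomorphic_on_imp_continuous_on[OF f]])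
         (use R in \<open>auto intro!: continuous_intros\<close>)
  qed
  then have "set_integrable lborel {0..1} (\<lambda>t. Re (f (unit_circle t)))"
    by (rule borel_integrable_atLeastAtMost')
  then have "(LINT t:{0..1}|lborel. Re (f (unit_circle t))) = integral {0..1} (\<lambda>t. Re (f (unit_circle t)))"
    by (rule set_borel_integral_eq_integral)
  also have "\<dots> = Re (f 0)" using 1 by (rule integral_unique)
  finally show ?thesis
    by (simp add: circle_measure_def integral_restrict_space set_lebesgue_integral_def)
qed

lemma circle_mean_holomorphic:
  assumes f: "f holomorphic_on ball a R" and c: "norm c < R"
  shows "(LINT t|circle_measure. Re (f (a + c * unit_circle t))) = Re (f a)"
proof (cases "c = 0")
  case True
  interpret prob_space circle_measure by (rule prob_space_circle_measure)
  show ?thesis using True by (simp add: prob_space)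
next
  case False
  have "(\<lambda>w. f (a + c * w)) holomorphic_on ball 0 (R / norm c)"
  proof (rule holomorphic_on_compose_gen[of "\<lambda>w. a + c * w" _ f "ball a R", unfolded comp_def])
    show "(\<lambda>w. a + c * w) ` ball 0 (R / norm c) \<subseteq> ball a R"
      using False by (auto simp: dist_norm norm_mult field_simps)
  qed (use f in \<open>auto intro!: holomorphic_intros\<close>)
  from unit_circle_mean_holomorphic[OF this] show ?thesis using False c by simp
qed

text \<open>For \<open>norm c < norm y\<close> the closed disk of radius \<open>norm c\<close>
  avoids the singularity \<open>- y\<close>, and \<open>ln |y + w|\<close> is the real part of a
  holomorphic function there, so the mean is the value at the centre. The other case is reduced to
  this one by a reflection. Equality of the norms concerns only a null set in the later use.\<close>

lemma circle_mean_ln_norm: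
  assumes "norm c \<noteq> norm y"
  shows "(LINT t|circle_measure. ln (norm (y + c * unit_circle t))) = ln (max (norm c) (norm y))"
proof -
  have *: "(LINT t|circle_measure. ln (norm (y + c * unit_circle t))) = ln (norm y)"
    if less: "norm c < norm y" for c y
  proof -
    have y: "y \<noteq> 0" using less by auto
    \<comment> \<open>On this disk \<open>1 + w / y\<close> has positive real part, so the principal
      branch \<open>Ln\<close> is holomorphic along it.\<close>
    have D: "1 + w / y \<notin> \<real>\<^sub>\<le>\<^sub>0" if "w \<in> ball 0 (norm y)" for w
    proof -
      have "norm (w / y) < 1" using that y by (simp add: norm_divide)
      then have "\<bar>Re (w / y)\<bar> < 1" using abs_Re_le_cmod[of "w / y"] by linarith
      then have "Re (1 + w / y) > 0" by auto
      then show ?thesis by (auto simp: complex_nonpos_Reals_iff)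
    qed
    have "(\<lambda>w. Ln (1 + w / y) + of_real (ln (norm y))) holomorphic_on ball 0 (norm y)"
      using D y by (intro holomorphic_intros) auto
    from circle_mean_holomorphic[OF this less]
    have "(LINT t|circle_measure. Re (Ln (1 + (c * unit_circle t) / y)) + ln (norm y)) = ln (norm y)" by simp
    moreover have "Re (Ln (1 + (c * unit_circle t) / y)) + ln (norm y) = ln (norm (y + c * unit_circle t))" for t
    proof -
      have n: "1 + (c * unit_circle t) / y \<noteq> 0"
        using D[of "c * unit_circle t"] less by (auto simp: norm_mult)
      have "y + c * unit_circle t = (1 + (c * unit_circle t) / y) * y" using y by (simp add: field_simps)
      then show ?thesis using n y by (simp add: norm_mult ln_mult del: of_real_mult)
    qed
    ultimately show ?thesis by simp
  qed
  show ?thesis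
  proof (cases "norm c < norm y")
    case True
    then show ?thesis using *[OF True] by (simp add: max_def)
  next
    case False
    then have less: "norm (cnj y) < norm (cnj c)" using assms by simp
    \<comment> \<open>Conjugating and then multiplying by \<open>unit_circle t\<close> exchanges the
      roles of \<open>c\<close> and \<open>y\<close> without changing the modulus.\<close>
    have "norm (cnj c + cnj y * unit_circle t) = norm (y + c * unit_circle t)" for t
    proof -
      have "norm (y + c * unit_circle t) = norm (cnj (y + c * unit_circle t))" by (simp only: complex_mod_cnj)
      also have "\<dots> = norm (unit_circle t * cnj (y + c * unit_circle t))" by (simp add: norm_mult del: complex_mod_cnj)
      also have "unit_circle t * cnj (y + c * unit_circle t) = cnj y * unit_circle t + cnj c * (unit_circle t * cnj (unit_circle t))"
        by (simp add: algebra_simps)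
      also have "unit_circle t * cnj (unit_circle t) = 1" by (simp add: cis_mult cis_cnj)
      finally show ?thesis by (simp add: add.commute)
    qed
    then show ?thesis using *[OF less] False by (simp add: max_def)
  qed
qed

text \<open>Averaging over rotations, which preserve Lebesgue measure, replaces polar coordinates.\<close>

lemma integral_rotation_average:
  fixes F :: "complex \<Rightarrow> real"
  assumes F: "integrable lborel F"
  shows "integrable lborel (\<lambda>x. LINT t|circle_measure. F (x * unit_circle t))"
    and "(\<integral>x. (LINT t|circle_measure. F (x * unit_circle t)) \<partial>lborel) = (\<integral>x. F x \<partial>lborel)"
proof -
  have [measurable]: "F \<in> borel_measurable borel" using F by auto
  interpret C: prob_space circle_measure by (rule prob_space_circle_measure)
  interpret P: pair_sigma_finite circle_measure "lborel :: complex measure" ..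
  have rot: "integrable lborel (\<lambda>x. G (x * unit_circle t)) \<and> (\<integral>x. G (x * unit_circle t) \<partial>lborel) = (\<integral>x. G x \<partial>lborel)"
    if "integrable lborel G" for G :: "complex \<Rightarrow> real" and t
  proof -
    have [measurable]: "G \<in> borel_measurable borel" using that by auto
    have "integrable (distr lborel borel (\<lambda>z. unit_circle t * z)) G"
      "integral\<^sup>L (distr lborel borel (\<lambda>z. unit_circle t * z)) G = integral\<^sup>L lborel G"
      using that by (simp_all add: lborel_distr_rotation)
    then show ?thesis
      by (subst (asm) integrable_distr_eq, simp, simp, subst (asm) integral_distr) (simp_all add: mult.commute)
  qed
  have m: "(\<lambda>(t, x). F (x * unit_circle t)) \<in> borel_measurable (circle_measure \<Otimes>\<^sub>M lborel)" by measurable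
  have int: "integrable (circle_measure \<Otimes>\<^sub>M lborel) (\<lambda>(t, x). F (x * unit_circle t))"
  proof (rule P.Fubini_integrable[OF m])
    show "integrable circle_measure (\<lambda>t. \<integral>x. norm (case (t, x) of (t, x) \<Rightarrow> F (x * unit_circle t)) \<partial>lborel)"
      using rot[OF integrable_norm[OF F]] by simp
    show "AE t in circle_measure. integrable lborel (\<lambda>x. case (t, x) of (t, x) \<Rightarrow> F (x * unit_circle t))"
      using rot[OF F] by simp
  qed
  show "integrable lborel (\<lambda>x. LINT t|circle_measure. F (x * unit_circle t))"
    using P.integrable_snd[OF int] by simp
  have "(\<integral>x. (LINT t|circle_measure. F (x * unit_circle t)) \<partial>lborel) =
      (LINT t|circle_measure. (\<integral>x. F (x * unit_circle t) \<partial>lborel))"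
    by (rule P.Fubini_integral[OF int])
  also have "\<dots> = (\<integral>x. F x \<partial>lborel)" using rot[OF F] by (simp add: C.prob_space)
  finally show "(\<integral>x. (LINT t|circle_measure. F (x * unit_circle t)) \<partial>lborel) = (\<integral>x. F x \<partial>lborel)" .
qed

lemma AE_norm_neq: "AE x in lborel. norm (x::complex) \<noteq> norm (y::complex)"
proof -
  have "sphere (0::complex) (norm y) \<in> null_sets lborel"
  proof -
    have "sphere (0::complex) (norm y) \<in> null_sets lebesgue"
      using negligible_sphere by (simp add: negligible_iff_null_sets)
    moreover have "sphere (0::complex) (norm y) \<in> sets lborel" by simp
    ultimately show ?thesis by (auto simp: null_sets_def)
  qed
  then have "AE x in lborel. x \<notin> sphere (0::complex) (norm y)" by (rule AE_not_in)
  then show ?thesis by eventually_elim (auto simp: dist_norm)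
qed

lemma norm_mult_unit_circle [simp]: "norm (x * unit_circle t) = norm x"
  by (simp add: norm_mult)

section \<open>Area means and the kernel of Jensen's formula\<close>

lemma area_mean_holomorphic:
  assumes f: "f holomorphic_on ball a R" and r: "0 < r" "r < R"
  shows "set_integrable lborel (ball 0 r) (\<lambda>x. Re (f (a + x)))"
    and "(LINT x:ball 0 r|lborel. Re (f (a + x))) = pi * r\<^sup>2 * Re (f a)"
proof -
  have c: "continuous_on (cball 0 r) (\<lambda>x. Re (f (a + x)))"
    by (intro continuous_intros continuous_on_compose2[OF holomorphic_on_imp_continuous_on[OF f]])
       (use r in \<open>auto simp: dist_norm\<close>)
  have "set_integrable lborel (cball 0 r) (\<lambda>x. Re (f (a + x)))"
    unfolding set_integrable_def by (rule borel_integrable_compact[OF _ c]) simp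
  then show i: "set_integrable lborel (ball 0 r) (\<lambda>x. Re (f (a + x)))"
    by (rule set_integrable_subset) auto
  let ?F = "\<lambda>x. indicator (ball 0 r) x *\<^sub>R Re (f (a + x))"
  have "(LINT x:ball 0 r|lborel. Re (f (a + x))) = (\<integral>x. (LINT t|circle_measure. ?F (x * unit_circle t)) \<partial>lborel)"
    using integral_rotation_average(2)[of ?F] i unfolding set_integrable_def set_lebesgue_integral_def by simp
  also have "(\<lambda>x. LINT t|circle_measure. ?F (x * unit_circle t)) = (\<lambda>x. indicator (ball 0 r) x * Re (f a))"
  proof
    fix x :: complex
    have "indicator (ball 0 r) (x * unit_circle t) = (indicator (ball 0 r) x :: real)" for t
      by (simp add: indicator_def)
    then show "(LINT t|circle_measure. ?F (x * unit_circle t)) = indicator (ball 0 r) x * Re (f a)"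
      using circle_mean_holomorphic[OF f, of x] r by (auto simp: indicator_def)
  qed
  also have "(\<integral>x. indicator (ball (0::complex) r) x * Re (f a) \<partial>lborel) = measure lborel (ball (0::complex) r) * Re (f a)"
    by simp
  also have "measure lborel (ball (0::complex) r) = pi * r\<^sup>2"
    using r by (simp add: measure_def emeasure_ball eval_unit_ball_vol)
  finally show "(LINT x:ball 0 r|lborel. Re (f (a + x))) = pi * r\<^sup>2 * Re (f a)" .
qed

text \<open>Shared by both potentials: with the indicator of a disk as weight it evaluates the
  Jensen kernel, with the limit density it evaluates the potential of the limit measure. Averaging
  over rotations leaves the weight unchanged and replaces the logarithm by its circle mean.\<close>

lemma radial_weight_ln_mean:
  assumes [measurable]: "q \<in> borel_measurable borel"
    and i: "integrable lborel (\<lambda>x. q (norm x) * ln (norm (y + x)))"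
  shows "integrable lborel (\<lambda>x::complex. q (norm x) * ln (max (norm x) (norm y)))"
    and "(\<integral>x. q (norm x) * ln (norm (y + x)) \<partial>lborel) = (LINT x::complex|lborel. q (norm x) * ln (max (norm x) (norm (y::complex))))"
proof -
  have AE: "AE x::complex in lborel. (LINT t|circle_measure. q (norm (x * unit_circle t)) * ln (norm (y + x * unit_circle t))) =
      q (norm x) * ln (max (norm x) (norm y))"
    using AE_norm_neq[of y] by eventually_elim (simp add: circle_mean_ln_norm)
  have mm: "(\<lambda>x::complex. q (norm x) * ln (max (norm x) (norm y))) \<in> borel_measurable lborel"
    by measurable
  show "integrable lborel (\<lambda>x::complex. q (norm x) * ln (max (norm x) (norm y)))"
    using integrable_cong_AE[THEN iffD1, OF _ _ AE integral_rotation_average(1)[OF i]] mm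
     integral_rotation_average(1)[OF i] by auto
  show "(\<integral>x. q (norm x) * ln (norm (y + x)) \<partial>lborel) = (LINT x::complex|lborel. q (norm x) * ln (max (norm x) (norm y)))"
    unfolding integral_rotation_average(2)[OF i, symmetric]
    by (rule integral_cong_AE[OF _ mm AE]) (use integral_rotation_average(1)[OF i] in auto)
qed


text \<open>The contribution of a zero at displacement \<open>y\<close> in an area form of Jensen's
  formula; for \<open>0 < |y| < r\<close> it equals
  \<open>ln (r / |y|) - 1/2 + |y|^2 / (2 * r^2)\<close>. At \<open>y = 0\<close> the convention
  \<open>ln 0 = 0\<close> yields a meaningless finite value, which is excluded or ignored as a null
  set.\<close>

definition jensen_kernel :: "real \<Rightarrow> complex \<Rightarrow> real" where
  "jensen_kernel r y = (LINT s:ball 0 r|lborel. ln (norm (y + s))) / (pi * r\<^sup>2) - ln (norm y)"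

lemma measure_ball_complex: "r \<ge> 0 \<Longrightarrow> measure lborel (ball (a::complex) r) = pi * r\<^sup>2"
  by (simp add: measure_def emeasure_ball eval_unit_ball_vol)

text \<open>For nonzero \<open>y\<close> the new integrand is nonnegative and vanishes where
  \<open>norm x \<le> norm y\<close>; sign, support and size of the kernel are read off from this
  form.\<close>

lemma jensen_kernel_alt:
  assumes r: "r > 0"
  shows "set_integrable lborel (ball (0::complex) r) (\<lambda>x. ln (max (norm x) (norm (y::complex))) - ln (norm y))"
    and "jensen_kernel r y = (LINT x:ball (0::complex) r|lborel. ln (max (norm x) (norm y)) - ln (norm y)) / (pi * r\<^sup>2)"
proof -
  have ind: "indicator (ball (0::complex) r) x = (indicator {..<r} (norm x) :: real)" for x
    by (simp add: indicator_def)
  have i: "integrable lborel (\<lambda>x. indicator {..<r} (norm x) * ln (norm (y + x)))"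
    using set_integrable_ln_norm[of 0 r y] by (simp add: set_integrable_def ind)
  have i1: "set_integrable lborel (ball (0::complex) r) (\<lambda>x. ln (max (norm x) (norm y)))"
    using radial_weight_ln_mean(1)[OF _ i] by (simp add: set_integrable_def ind)
  have i2: "set_integrable lborel (ball (0::complex) r) (\<lambda>x. ln (norm y))"
    by (rule set_integrable_lborel_bounded[where B = "\<bar>ln (norm y)\<bar>"]) auto
  show "set_integrable lborel (ball (0::complex) r) (\<lambda>x. ln (max (norm x) (norm y)) - ln (norm y))"
    by (rule set_integral_diff(1)[OF i1 i2])
  have "(LINT x:ball (0::complex) r|lborel. ln (max (norm x) (norm y)) - ln (norm y)) =
      (LINT x:ball (0::complex) r|lborel. ln (max (norm x) (norm y))) - (LINT x:ball (0::complex) r|lborel. ln (norm y))"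
    by (rule set_integral_diff(2)[OF i1 i2])
  also have "(LINT x:ball (0::complex) r|lborel. ln (norm y)) = pi * r\<^sup>2 * ln (norm y)"
    using r by (simp add: set_lebesgue_integral_def measure_ball_complex)
  also have "(LINT x:ball (0::complex) r|lborel. ln (max (norm x) (norm y))) = (LINT x:ball 0 r|lborel. ln (norm (y + x)))"
    using radial_weight_ln_mean(2)[OF _ i] by (simp add: set_lebesgue_integral_def ind)
  finally show "jensen_kernel r y = (LINT x:ball (0::complex) r|lborel. ln (max (norm x) (norm y)) - ln (norm y)) / (pi * r\<^sup>2)"
    using r by (simp add: jensen_kernel_def field_simps)
qed

lemma jensen_kernel_nonneg:
  assumes "r > 0" "y \<noteq> 0"
  shows "jensen_kernel r y \<ge> 0"
  unfolding jensen_kernel_alt(2)[OF assms(1)] set_lebesgue_integral_def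
proof (intro divide_nonneg_nonneg Bochner_Integration.integral_nonneg)
  show "0 \<le> indicator (ball 0 r) x *\<^sub>R (ln (max (norm x) (norm y)) - ln (norm y))" for x :: complex
    using ln_mono[of "norm y" "max (norm x) (norm y)"] assms by simp
qed (use assms in auto)

lemma jensen_kernel_eq_0:
  assumes "r > 0" "norm y \<ge> r"
  shows "jensen_kernel r y = 0"
proof -
  have "indicator (ball (0::complex) r) x *\<^sub>R (ln (max (norm x) (norm y)) - ln (norm y)) = 0" for x
    using assms by (auto simp: indicator_def max_def)
  then show ?thesis unfolding jensen_kernel_alt(2)[OF assms(1)] set_lebesgue_integral_def
    by (simp only: Bochner_Integration.integral_zero div_0)
qed

lemma jensen_kernel_le:
  assumes r: "r > 0" and y: "y \<noteq> 0" "norm y < r"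
  shows "jensen_kernel r y \<le> ln r - ln (norm y)"
proof -
  have "(LINT x:ball (0::complex) r|lborel. ln (max (norm x) (norm y)) - ln (norm y)) \<le> (LINT x:ball (0::complex) r|lborel. ln r - ln (norm y))"
  proof (rule set_integral_mono[OF jensen_kernel_alt(1)[OF r]])
    show "set_integrable lborel (ball (0::complex) r) (\<lambda>x. ln r - ln (norm y))"
      by (rule set_integrable_lborel_bounded[where B = "\<bar>ln r - ln (norm y)\<bar>"]) auto
    fix x :: complex assume "x \<in> ball 0 r"
    then show "ln (max (norm x) (norm y)) - ln (norm y) \<le> ln r - ln (norm y)"
      using y by (intro diff_right_mono ln_mono) (auto simp: less_max_iff_disj)
  qed
  also have "\<dots> = pi * r\<^sup>2 * (ln r - ln (norm y))"
    using r by (simp add: set_lebesgue_integral_def measure_ball_complex)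
  finally show ?thesis unfolding jensen_kernel_alt(2)[OF r] using r by (simp add: field_simps)
qed

text \<open>The annulus \<open>r/2 \<le> |x| < r\<close> fills three quarters of the disk, and there
  \<open>|x| / |y| \<ge> 2\<close>. The purpose is to make the total mass of the kernel positive, so
  that it can be divided by.\<close>

lemma jensen_kernel_ge:
  assumes r: "r > 0" and y: "y \<noteq> 0" "norm y < r / 4"
  shows "jensen_kernel r y \<ge> 3 / 4 * ln 2"
proof -
  let ?A = "ball (0::complex) r - ball 0 (r/2)"
  have sA: "?A \<subseteq> ball 0 r" by auto
  have mA: "measure lborel ?A = 3 / 4 * pi * r\<^sup>2"
  proof -
    have "measure lborel ?A = measure lborel (ball (0::complex) r) - measure lborel (ball (0::complex) (r/2))"
      using r by (intro measure_Diff) (auto simp: emeasure_lborel_ball_finite[THEN less_imp_neq] emeasure_ball)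
    then show ?thesis using r by (simp add: measure_ball_complex power2_eq_square field_simps)
  qed
  have fA: "emeasure lborel ?A < \<infinity>"
    using le_less_trans[OF emeasure_mono[OF sA] emeasure_lborel_ball_finite] by simp
  have "3 / 4 * pi * r\<^sup>2 * ln 2 = (LINT x:?A|lborel. ln (2::real))"
    using fA by (simp add: set_lebesgue_integral_def mA)
  also have "\<dots> \<le> (LINT x:?A|lborel. ln (max (norm x) (norm y)) - ln (norm y))"
  proof (rule set_integral_mono)
    show "set_integrable lborel ?A (\<lambda>x. ln (2::real))"
      by (rule set_integrable_lborel_bounded[where B = "ln 2"]) (auto intro: bounded_subset[OF _ sA])
    show "set_integrable lborel ?A (\<lambda>x. ln (max (norm x) (norm y)) - ln (norm y))"
      by (rule set_integrable_subset[OF jensen_kernel_alt(1)[OF r]]) auto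
    fix x assume x: "x \<in> ?A"
    have "ln 2 = ln (r / 2) - ln (r / 4)" using r ln_realpow[of "2::real" 2] by (simp add: ln_div)
    also have "\<dots> \<le> ln (max (norm x) (norm y)) - ln (norm y)"
      using x y r by (intro diff_mono ln_mono) (auto simp: not_less le_max_iff_disj)
    finally show "ln 2 \<le> ln (max (norm x) (norm y)) - ln (norm y)" .
  qed
  also have "\<dots> \<le> (LINT x:ball (0::complex) r|lborel. ln (max (norm x) (norm y)) - ln (norm y))"
    unfolding set_lebesgue_integral_def
  proof (rule integral_mono)
    show "integrable lborel (\<lambda>x. indicator ?A x *\<^sub>R (ln (max (norm x) (norm y)) - ln (norm y)))"
      using set_integrable_subset[OF jensen_kernel_alt(1)[OF r] _ sA] by (simp add: set_integrable_def)
    show "integrable lborel (\<lambda>x. indicator (ball (0::complex) r) x *\<^sub>R (ln (max (norm x) (norm y)) - ln (norm y)))"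
      using jensen_kernel_alt(1)[OF r] by (simp add: set_integrable_def)
    fix x :: complex
    have "ln (norm y) \<le> ln (max (norm x) (norm y))" using y by (intro ln_mono) auto
    then show "indicator ?A x *\<^sub>R (ln (max (norm x) (norm y)) - ln (norm y)) \<le>
      indicator (ball 0 r) x *\<^sub>R (ln (max (norm x) (norm y)) - ln (norm y))"
      by (auto simp: indicator_def)
  qed
  finally show ?thesis unfolding jensen_kernel_alt(2)[OF r] using r by (simp add: field_simps)
qed

lemma borel_measurable_jensen_kernel [measurable]: "jensen_kernel r \<in> borel_measurable borel"
proof -
  have "(\<lambda>y. LINT s:ball 0 r|lborel. ln (norm (y + s))) \<in> borel_measurable (borel :: complex measure)"
    unfolding set_lebesgue_integral_def
  proof (rule lborel.borel_measurable_lebesgue_integral)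
    have "(\<lambda>p. indicator (ball 0 r) (snd p) * ln (norm (fst p + snd p))) \<in> borel_measurable (borel \<Otimes>\<^sub>M (borel :: complex measure))"
      by (intro borel_measurable_times borel_measurable_ln borel_measurable_norm borel_measurable_add
          measurable_compose[OF measurable_snd borel_measurable_indicator] measurable_compose[OF _ borel_measurable_norm]) auto
    then show "(\<lambda>(y, s). indicator (ball 0 r) s *\<^sub>R ln (norm (y + s))) \<in> borel_measurable (borel \<Otimes>\<^sub>M (lborel :: complex measure))"
      by (subst measurable_cong_sets[OF sets_pair_measure_cong[OF refl sets_lborel] refl]) (simp add: case_prod_beta)
  qed
  then show ?thesis unfolding jensen_kernel_def[abs_def] by measurable
qed

lemma integrable_jensen_kernel:
  assumes r: "r > 0"
  shows "integrable lborel (jensen_kernel r)"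
proof (rule Bochner_Integration.integrable_bound)
  have i2: "set_integrable lborel (ball (0::complex) r) (\<lambda>y. ln r)"
    by (rule set_integrable_lborel_bounded[where B = "\<bar>ln r\<bar>"]) auto
  show "integrable lborel (\<lambda>y. indicator (ball 0 r) y *\<^sub>R (ln r - ln (norm (y::complex))))"
    using set_integral_diff(1)[OF i2 set_integrable_ln_norm_0[of r]] by (simp add: set_integrable_def)
  show "AE y in lborel. norm (jensen_kernel r y) \<le> norm (indicator (ball 0 r) y *\<^sub>R (ln r - ln (norm y)))"
    using AE_lborel_singleton[of 0]
  proof eventually_elim
    case (elim y)
    then show ?case
      using jensen_kernel_nonneg[OF r, of y] jensen_kernel_le[OF r, of y] jensen_kernel_eq_0[OF r, of y]
      by (cases "norm y < r") auto
  qed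
qed simp

lemma integral_jensen_kernel_pos:
  assumes r: "r > 0"
  shows "(\<integral>y. jensen_kernel r y \<partial>lborel) > 0"
proof -
  have "0 < 3 / 4 * ln 2 * (pi * (r/4)\<^sup>2)" using r by simp
  also have "\<dots> = (\<integral>y. indicator (ball (0::complex) (r/4)) y * (3 / 4 * ln 2) \<partial>lborel)"
    using measure_ball_complex[of "r/4" 0] r by simp
  also have "\<dots> \<le> (\<integral>y. jensen_kernel r y \<partial>lborel)"
  proof (rule integral_mono_AE)
    show "integrable lborel (\<lambda>y. indicator (ball (0::complex) (r/4)) y * (3 / 4 * ln 2 :: real))"
      by (intro integrable_mult_left) (use emeasure_lborel_ball_finite[of "0::complex" "r/4"] in \<open>simp add: integrable_indicator_iff\<close>)
    show "AE y in lborel. indicator (ball (0::complex) (r/4)) y * (3 / 4 * ln 2) \<le> jensen_kernel r y"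
      using AE_lborel_singleton[of 0]
      by eventually_elim (use jensen_kernel_ge[OF r] jensen_kernel_nonneg[OF r] in \<open>auto simp: indicator_def\<close>)
  qed (rule integrable_jensen_kernel[OF r])
  finally show ?thesis .
qed

section \<open>Smearing and the duality with zeros\<close>

lemma integral_lborel_translate:
  fixes F :: "'a::euclidean_space \<Rightarrow> real"
  assumes [measurable]: "F \<in> borel_measurable borel"
  shows "integrable lborel (\<lambda>x. F (c + x)) \<longleftrightarrow> integrable lborel F"
    and "(\<integral>x. F (c + x) \<partial>lborel) = (\<integral>x. F x \<partial>lborel)"
  using set_integrable_translate[of F UNIV c] by (simp_all add: set_integrable_def set_lebesgue_integral_def)

text \<open>A finite-difference Laplacian, for smooth \<open>f\<close> and small \<open>r\<close>
  close to \<open>r^2 / 8\<close> times the Laplacian of \<open>f\<close>. It needs no derivatives,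
  so bounded measurable test functions are admissible.\<close>

definition smear :: "real \<Rightarrow> (complex \<Rightarrow> real) \<Rightarrow> complex \<Rightarrow> real" where
  "smear r f y = (LINT s:ball 0 r|lborel. f (y - s)) / (pi * r\<^sup>2) - f y"

definition locally_integrable :: "(complex \<Rightarrow> real) \<Rightarrow> bool" where
  "locally_integrable v \<longleftrightarrow> v \<in> borel_measurable borel \<and> (\<forall>R. set_integrable lborel (ball 0 R) v)"

lemma locally_integrable_mult_bounded:
  assumes v: "locally_integrable v" and [measurable]: "g \<in> borel_measurable borel"
    and C: "\<And>x. \<bar>g x\<bar> \<le> C" and \<rho>: "\<And>x. norm x \<ge> \<rho> \<Longrightarrow> g x = 0"
  shows "integrable lborel (\<lambda>x. v x * g x)"
proof (rule Bochner_Integration.integrable_bound)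
  have [measurable]: "v \<in> borel_measurable borel" using v by (simp add: locally_integrable_def)
  show "integrable lborel (\<lambda>x. C * (indicator (ball 0 \<rho>) x *\<^sub>R v x))"
    using v by (intro integrable_mult_right) (simp add: locally_integrable_def set_integrable_def)
  show "(\<lambda>x. v x * g x) \<in> borel_measurable lborel" by measurable
  show "AE x in lborel. norm (v x * g x) \<le> norm (C * (indicator (ball 0 \<rho>) x *\<^sub>R v x))"
  proof (rule AE_I2)
    fix x
    have "\<bar>v x\<bar> * \<bar>g x\<bar> \<le> \<bar>v x\<bar> * \<bar>C\<bar>" using C[of x] by (intro mult_left_mono) auto
    then show "norm (v x * g x) \<le> norm (C * (indicator (ball 0 \<rho>) x *\<^sub>R v x))"
      using \<rho>[of x] by (auto simp: indicator_def abs_mult mult.commute)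
  qed
qed

text \<open>Symmetry of the operator "disk mean minus value": Fubini and the substitution
  \<open>y = a + s\<close> for each fixed \<open>s\<close> move it from the test function to
  \<open>v\<close>. When \<open>v\<close> is a logarithm, the right-hand side can be computed by
  Jensen's formula.\<close>

lemma integral_smear:
  fixes f v :: "complex \<Rightarrow> real"
  assumes v: "locally_integrable v" and f[measurable]: "f \<in> borel_measurable borel"
    and C: "\<And>x. \<bar>f x\<bar> \<le> C" and \<rho>: "\<And>x. norm x \<ge> \<rho> \<Longrightarrow> f x = 0" and r: "r > 0"
  shows "(\<integral>y. v y * smear r f y \<partial>lborel) =
    (\<integral>a. f a * ((LINT s:ball 0 r|lborel. v (a + s)) / (pi * r\<^sup>2) - v a) \<partial>lborel)"
proof -
  have [measurable]: "v \<in> borel_measurable borel" using v by (simp add: locally_integrable_def)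
  define I where "I s = (indicator {..<r} (norm (s::complex)) :: real)" for s
  have I: "indicator (ball 0 r) s = I s" for s by (simp add: I_def indicator_def)
  have [measurable]: "I \<in> borel_measurable borel" unfolding I_def[abs_def] by measurable
  define K where "K s y = I s * (v y * f (y - s))" for s y
  define K' where "K' s a = I s * (v (a + s) * f a)" for s a
  have mK: "(\<lambda>(s, y). K s y) \<in> borel_measurable (lborel \<Otimes>\<^sub>M lborel)"
    unfolding K_def by measurable
  have mK': "(\<lambda>(s, y). K' s y) \<in> borel_measurable (lborel \<Otimes>\<^sub>M lborel)"
    unfolding K'_def by measurable
  have iv: "integrable lborel (\<lambda>y. indicator (ball 0 (\<rho> + r)) y *\<^sub>R v y)"
    using v by (simp add: locally_integrable_def set_integrable_def)
  \<comment> \<open>\<open>f (y - s)\<close> vanishes unless \<open>norm (y - s) < \<rho>\<close>,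
    so for \<open>norm s < r\<close> only \<open>norm y < \<rho> + r\<close> matters, and local
    integrability of \<open>v\<close> dominates \<open>K\<close>.\<close>
  have Kb: "norm (K s y) \<le> I s * (C * norm (indicator (ball 0 (\<rho> + r)) y *\<^sub>R v y))" for s y
  proof (cases "norm s < r \<and> norm (y - s) < \<rho>")
    case True
    then have "norm y < \<rho> + r" using norm_triangle_ineq[of "y - s" s] by simp
    moreover have "\<bar>v y\<bar> * \<bar>f (y - s)\<bar> \<le> \<bar>v y\<bar> * C" using C by (intro mult_left_mono) auto
    ultimately show ?thesis by (simp add: K_def I_def abs_mult indicator_def mult.commute)
  next
    case False
    have "0 \<le> C" using C[of 0] by simp
    then show ?thesis using False \<rho>[of "y - s"] by (auto simp: K_def I_def)
  qed
  have Ki: "integrable lborel (K s)" for s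
  proof (rule Bochner_Integration.integrable_bound)
    show "integrable lborel (\<lambda>y. I s * (C * norm (indicator (ball 0 (\<rho> + r)) y *\<^sub>R v y)))"
      by (intro integrable_mult_right integrable_norm iv)
    show "AE y in lborel. norm (K s y) \<le> norm (I s * (C * norm (indicator (ball 0 (\<rho> + r)) y *\<^sub>R v y)))"
      unfolding real_norm_def[of "I s * _"] by (intro AE_I2 order_trans[OF Kb abs_ge_self])
  qed (unfold K_def, measurable)
  have Iint: "integrable lborel I"
  proof -
    have "integrable lborel (indicator (ball (0::complex) r) :: complex \<Rightarrow> real)"
      using emeasure_lborel_ball_finite[of "0::complex" r] by (simp add: integrable_indicator_iff)
    then show ?thesis by (simp add: I[abs_def])
  qed
  have Kn: "integrable lborel (\<lambda>s. \<integral>y. norm (K s y) \<partial>lborel)"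
  proof (rule Bochner_Integration.integrable_bound)
    let ?N = "C * (\<integral>y. norm (indicator (ball 0 (\<rho> + r)) y *\<^sub>R v y) \<partial>lborel)"
    show "integrable lborel (\<lambda>s. I s * ?N)" by (intro integrable_mult_left Iint)
    show "(\<lambda>s. \<integral>y. norm (K s y) \<partial>lborel) \<in> borel_measurable lborel"
      by (rule lborel.borel_measurable_lebesgue_integral) (use mK in measurable)
    show "AE s in lborel. norm (\<integral>y. norm (K s y) \<partial>lborel) \<le> norm (I s * ?N)"
    proof (rule AE_I2)
      fix s
      have "(\<integral>y. norm (K s y) \<partial>lborel) \<le> (\<integral>y. I s * (C * norm (indicator (ball 0 (\<rho> + r)) y *\<^sub>R v y)) \<partial>lborel)"
        using Kb by (intro integral_mono integrable_norm Ki integrable_mult_right iv) auto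
      also have "\<dots> = I s * ?N" by simp
      finally show "norm (\<integral>y. norm (K s y) \<partial>lborel) \<le> norm (I s * ?N)" by simp
    qed
  qed
  have intK: "integrable (lborel \<Otimes>\<^sub>M lborel) (\<lambda>(s, y). K s y)"
    by (rule lborel_pair.Fubini_integrable[OF mK]) (use Kn Ki in auto)
  have tr: "K' s = (\<lambda>a. K s (s + a))" for s by (auto simp: K'_def K_def add.commute)
  have mKs: "K s \<in> borel_measurable borel" for s unfolding K_def[abs_def] by measurable
  have K'i: "integrable lborel (K' s)" for s
    unfolding tr using Ki mKs by (simp add: integral_lborel_translate)
  have K'n: "(\<integral>a. norm (K' s a) \<partial>lborel) = (\<integral>y. norm (K s y) \<partial>lborel)" for s
    unfolding tr by (rule integral_lborel_translate(2)[of "\<lambda>y. norm (K s y)"]) (use mKs in measurable)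
  have intK': "integrable (lborel \<Otimes>\<^sub>M lborel) (\<lambda>(s, y). K' s y)"
    by (rule lborel_pair.Fubini_integrable[OF mK']) (use Kn K'i in \<open>auto simp: K'n[simplified]\<close>)
  have "(\<integral>y. (\<integral>s. K s y \<partial>lborel) \<partial>lborel) = (\<integral>s. (\<integral>y. K s y \<partial>lborel) \<partial>lborel)"
    by (rule lborel_pair.Fubini_integral[OF intK])
  also have "\<dots> = (\<integral>s. (\<integral>a. K' s a \<partial>lborel) \<partial>lborel)"
    unfolding tr using integral_lborel_translate(2)[OF mKs] by simp
  also have "\<dots> = (\<integral>a. (\<integral>s. K' s a \<partial>lborel) \<partial>lborel)"
    by (rule lborel_pair.Fubini_integral[OF intK', symmetric])
  finally have main: "(\<integral>y. (\<integral>s. K s y \<partial>lborel) \<partial>lborel) = (\<integral>a. (\<integral>s. K' s a \<partial>lborel) \<partial>lborel)" .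
  have vf: "integrable lborel (\<lambda>y. v y * f y)"
    by (rule locally_integrable_mult_bounded[OF v f C \<rho>])
  have sK: "(\<integral>s. K s y \<partial>lborel) = v y * (LINT s:ball 0 r|lborel. f (y - s))" for y
    unfolding set_lebesgue_integral_def I K_def
    by (subst Bochner_Integration.integral_mult_right_zero[symmetric]) (simp add: mult.left_commute)
  have sK': "(\<integral>s. K' s a \<partial>lborel) = f a * (LINT s:ball 0 r|lborel. v (a + s))" for a
    unfolding set_lebesgue_integral_def I K'_def
    by (subst Bochner_Integration.integral_mult_right_zero[symmetric]) (simp add: ac_simps)
  have iK: "integrable lborel (\<lambda>y. \<integral>s. K s y \<partial>lborel)" "integrable lborel (\<lambda>y. \<integral>s. K' s y \<partial>lborel)"
    using lborel_pair.integrable_snd[OF intK] lborel_pair.integrable_snd[OF intK'] by auto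
  have "(\<integral>y. v y * smear r f y \<partial>lborel) = (\<integral>y. (\<integral>s. K s y \<partial>lborel) / (pi * r\<^sup>2) - v y * f y \<partial>lborel)"
    unfolding smear_def sK by (simp add: algebra_simps)
  also have "\<dots> = (\<integral>y. (\<integral>s. K s y \<partial>lborel) \<partial>lborel) / (pi * r\<^sup>2) - (\<integral>y. v y * f y \<partial>lborel)"
    using iK vf by (subst Bochner_Integration.integral_diff) auto
  also have "\<dots> = (\<integral>a. (\<integral>s. K' s a \<partial>lborel) / (pi * r\<^sup>2) - v a * f a \<partial>lborel)"
    unfolding main using iK vf by (subst Bochner_Integration.integral_diff) auto
  also have "\<dots> = (\<integral>a. f a * ((LINT s:ball 0 r|lborel. v (a + s)) / (pi * r\<^sup>2) - v a) \<partial>lborel)"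
    unfolding sK' by (simp add: algebra_simps)
  finally show ?thesis .
qed

lemma smear_bounded_support:
  assumes [measurable]: "f \<in> borel_measurable borel"
    and C: "\<And>x. \<bar>f x\<bar> \<le> C" and \<rho>: "\<And>x. norm x \<ge> \<rho> \<Longrightarrow> f x = 0" and r: "r > 0"
  shows "smear r f \<in> borel_measurable borel" "\<bar>smear r f y\<bar> \<le> 2 * C" "norm y \<ge> \<rho> + r \<Longrightarrow> smear r f y = 0"
proof -
  have ind: "indicator (ball 0 r) s = (indicator {..<r} (norm s) :: real)" for s :: complex
    by (simp add: indicator_def)
  have "(\<lambda>y. LINT s:ball 0 r|lborel. f (y - s)) \<in> borel_measurable lborel"
    unfolding set_lebesgue_integral_def ind
    by (rule lborel.borel_measurable_lebesgue_integral) measurable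
  then have [measurable]: "(\<lambda>y. LINT s:ball 0 r|lborel. f (y - s)) \<in> borel_measurable borel" by simp
  show "smear r f \<in> borel_measurable borel" unfolding smear_def[abs_def] by measurable
  have "\<bar>LINT s:ball 0 r|lborel. f (y - s)\<bar> \<le> (LINT s:ball (0::complex) r|lborel. C)"
    unfolding set_lebesgue_integral_def
  proof (rule order_trans[OF integral_abs_bound integral_mono])
    have 1: "set_integrable lborel (ball 0 r) (\<lambda>s. f (y - s))"
      by (rule set_integrable_lborel_bounded[where B = C]) (use C in auto)
    have 2: "set_integrable lborel (ball (0::complex) r) (\<lambda>s. C)"
      by (rule set_integrable_lborel_bounded[where B = "\<bar>C\<bar>"]) auto
    show "integrable lborel (\<lambda>s. \<bar>indicator (ball 0 r) s *\<^sub>R f (y - s)\<bar>)"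
      "integrable lborel (\<lambda>s. indicator (ball (0::complex) r) s *\<^sub>R C)"
      using 1 2 by (auto simp: set_integrable_def)
    show "\<bar>indicator (ball 0 r) s *\<^sub>R f (y - s)\<bar> \<le> indicator (ball 0 r) s *\<^sub>R C" for s
      using C by (simp add: indicator_def)
  qed
  also have "\<dots> = pi * r\<^sup>2 * C" using r by (simp add: set_lebesgue_integral_def measure_ball_complex)
  finally have "\<bar>(LINT s:ball 0 r|lborel. f (y - s)) / (pi * r\<^sup>2)\<bar> \<le> C"
    using r by (simp add: abs_divide pos_divide_le_eq ac_simps)
  then show "\<bar>smear r f y\<bar> \<le> 2 * C" using C[of y] unfolding smear_def by linarith
  show "smear r f y = 0" if y: "norm y \<ge> \<rho> + r"
  proof -
    have "indicator (ball 0 r) s *\<^sub>R f (y - s) = 0" for s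
      using \<rho>[of "y - s"] y norm_triangle_ineq[of "y - s" s] by (cases "norm s < r") auto
    then have "(LINT s:ball 0 r|lborel. f (y - s)) = 0"
      unfolding set_lebesgue_integral_def by (simp only: Bochner_Integration.integral_zero)
    moreover have "f y = 0" using y r by (intro \<rho>) auto
    ultimately show ?thesis by (simp add: smear_def)
  qed
qed

lemma ln_norm_factored:
  assumes "finite S" "\<And>x. x \<in> S \<Longrightarrow> z \<noteq> x"
  shows "ln (norm (exp w * (\<Prod>x\<in>S. (z - x) ^ m x))) = Re w + (\<Sum>x\<in>S. real (m x) * ln (norm (z - x)))"
proof -
  have "ln (norm (\<Prod>x\<in>S. (z - x) ^ m x)) = (\<Sum>x\<in>S. real (m x) * ln (norm (z - x)))"
    using assms
  proof (induction S rule: finite_induct)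
    case (insert x S)
    have "ln (norm (\<Prod>x\<in>insert x S. (z - x) ^ m x)) = ln (norm (z - x) ^ m x * norm (\<Prod>x\<in>S. (z - x) ^ m x))"
      using insert.hyps by (simp add: norm_mult norm_power)
    also have "\<dots> = real (m x) * ln (norm (z - x)) + ln (norm (\<Prod>x\<in>S. (z - x) ^ m x))"
      using insert.prems insert.hyps by (subst ln_mult_pos) (auto simp: ln_realpow)
    finally show ?case using insert by simp
  qed simp
  moreover have "norm (\<Prod>x\<in>S. (z - x) ^ m x) > 0" using assms by auto
  ultimately show ?thesis by (simp add: norm_mult ln_mult_pos norm_exp_eq_Re del: zero_less_norm_iff)
qed

text \<open>The polynomial built from the zeros in the disk has the same zeros with the same orders
  as \<open>W\<close> there; the quotient is free of zeros on a convex set and hence has a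
  logarithm.\<close>

lemma holomorphic_factor_zeros_ball:
  fixes W :: "complex \<Rightarrow> complex" and R :: real
  assumes W: "W holomorphic_on UNIV" and nz: "\<not> (\<forall>z. W z = 0)"
  defines "S \<equiv> {z \<in> ball 0 R. W z = 0}"
  obtains H where "finite S" "H holomorphic_on ball 0 R"
    "\<And>z. z \<in> ball 0 R \<Longrightarrow> W z = exp (H z) * (\<Prod>x\<in>S. (z - x) ^ nat (zorder W x))"
proof -
  have fin: "finite S"
  proof (cases "W constant_on UNIV")
    case True
    then have "S = {}" using nz by (auto simp: constant_on_def S_def)
    then show ?thesis by simp
  next
    case False
    have "finite {z \<in> cball 0 R. W z = 0}"
      by (rule holomorphic_compact_finite_zeros[OF W]) (use False in auto)
    then show ?thesis by (rule finite_subset[rotated]) (auto simp: S_def)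
  qed
  define P where "P z = (\<Prod>x\<in>S. (z - x) ^ nat (zorder W x))" for z
  have pos: "if W z = 0 then zorder W z > 0 else zorder W z = 0" for z
    using zorder_exist_zero[OF W open_UNIV connected_UNIV UNIV_I[of z]] nz by auto
  have P0: "P z = 0 \<longleftrightarrow> W z = 0" if "z \<in> ball 0 R" for z
  proof
    assume "P z = 0"
    then obtain x where "x \<in> S" "(z - x) ^ nat (zorder W x) = 0" unfolding P_def using fin by auto
    then show "W z = 0" by (simp add: S_def)
  next
    assume "W z = 0"
    then have "z \<in> S" "(z - z) ^ nat (zorder W z) = 0" using that pos[of z] by (simp_all add: S_def)
    then show "P z = 0" unfolding P_def using fin by (intro prod_zero) blast+
  qed
  have zo: "zorder P z = zorder W z" if z: "z \<in> ball 0 R" for z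
  proof (cases "W z = 0")
    case True
    then have zS: "z \<in> S" using z by (simp add: S_def)
    show ?thesis
    proof (rule zorder_eqI[of UNIV z "\<lambda>w. \<Prod>x\<in>S - {z}. (w - x) ^ nat (zorder W x)"])
      show "(\<Prod>x\<in>S - {z}. (z - x) ^ nat (zorder W x)) \<noteq> 0" using fin by (auto simp: prod_zero_iff)
      fix w
      have "P w = (w - z) ^ nat (zorder W z) * (\<Prod>x\<in>S - {z}. (w - x) ^ nat (zorder W x))"
        unfolding P_def by (rule prod.remove[OF fin zS])
      moreover have "(w - z) powi zorder W z = (w - z) ^ nat (zorder W z)"
        using pos[of z] True by (simp add: power_int_def)
      ultimately show "P w = (\<Prod>x\<in>S - {z}. (w - x) ^ nat (zorder W x)) * (w - z) powi zorder W z" by simp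
    qed (auto intro!: holomorphic_intros)
  next
    case False
    have "P analytic_on {z}" unfolding P_def by (intro analytic_intros)
    then have "zorder P z = 0" using P0[OF z] False by (intro zorder_eq_0I) auto
    then show ?thesis using pos[of z] False by simp
  qed
  obtain h where h: "h holomorphic_on ball 0 R" "\<And>z. z \<in> ball 0 R \<Longrightarrow> h z \<noteq> 0" "\<And>z. z \<in> ball 0 R \<Longrightarrow> W z = h z * P z"
  proof (rule holomorphic_zorder_factorization[of W "ball 0 R" P])
    show "W holomorphic_on ball 0 R" using W by (rule holomorphic_on_subset) auto
    show "P holomorphic_on ball 0 R" unfolding P_def by (intro holomorphic_intros)
    show "P z = 0 \<longleftrightarrow> W z = 0" "zorder P z = zorder W z" if "z \<in> ball 0 R" for z
      using P0[OF that] zo[OF that] by blast+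
  qed (blast intro: that | simp)+
  have "\<exists>H. H holomorphic_on ball 0 R \<and> (\<forall>z\<in>ball 0 R. h z = exp (H z))"
  proof (cases "R > 0")
    case True
    then have "(0::complex) \<in> ball 0 R" by simp
    then obtain H where "H holomorphic_on ball 0 R" "\<And>z. z \<in> ball 0 R \<Longrightarrow> exp (H z) = h z"
      using holomorphic_logarithm_exists[OF convex_ball open_ball h(1,2)] by blast
    then show ?thesis by metis
  next
    case False
    then have e: "ball (0::complex) R = {}" by simp
    show ?thesis unfolding e by (intro exI[of _ "\<lambda>_. 0"]) simp
  qed
  then obtain H where "H holomorphic_on ball 0 R" "\<And>z. z \<in> ball 0 R \<Longrightarrow> h z = exp (H z)" by blast
  then show thesis using that fin h unfolding P_def by simp
qed

text \<open>Jensen's formula with area means: the real part of \<open>H\<close> reproduces its value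
  at the centre and drops out of the difference, and each root contributes one kernel. The centre
  must not be a root, since \<open>ln 0 = 0\<close> would falsify the value there.\<close>

lemma ln_norm_ball_mean:
  assumes S: "finite S" and H: "H holomorphic_on ball 0 R"
    and G: "\<And>z. z \<in> ball 0 R \<Longrightarrow> G z = exp (H z) * (\<Prod>x\<in>S. (z - x) ^ m x)"
    and mG: "G \<in> borel_measurable borel"
    and r: "0 < r" "norm a + r < R" and a: "a \<notin> S"
  shows "set_integrable lborel (ball 0 r) (\<lambda>s. ln (norm (G (a + s))))"
    and "(LINT s:ball 0 r|lborel. ln (norm (G (a + s)))) / (pi * r\<^sup>2) - ln (norm (G a)) =
      (\<Sum>x\<in>S. real (m x) * jensen_kernel r (a - x))"
proof -
  have sub: "ball a (R - norm a) \<subseteq> ball 0 R"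
  proof
    fix x assume "x \<in> ball a (R - norm a)"
    then show "x \<in> ball 0 R" using norm_triangle_ineq2[of x a] by (simp add: dist_norm norm_minus_commute)
  qed
  have H': "H holomorphic_on ball a (R - norm a)" using H sub by (rule holomorphic_on_subset)
  have rR: "r < R - norm a" using r by simp
  let ?F = "\<lambda>s. Re (H (a + s)) + (\<Sum>x\<in>S. real (m x) * ln (norm ((a - x) + s)))"
  have AE: "AE s\<in>ball 0 r in lborel. ?F s = ln (norm (G (a + s)))"
  proof -
    have "AE s in lborel. s \<notin> (\<lambda>x. x - a) ` S"
      using finite_imp_null_set_lborel[of "(\<lambda>x. x - a) ` S"] S by (intro AE_not_in) auto
    then show ?thesis
    proof eventually_elim
      case (elim s)
      show ?case
      proof
        assume s: "s \<in> ball 0 r"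
        then have "a + s \<in> ball 0 R" using r norm_triangle_ineq[of a s] by simp
        moreover have "a + s \<noteq> x" if "x \<in> S" for x using elim that by (auto simp: image_iff algebra_simps)
        ultimately show "?F s = ln (norm (G (a + s)))"
          using G ln_norm_factored[OF S, of "a + s" "H (a + s)" m] by (simp add: algebra_simps)
      qed
    qed
  qed
  have i: "set_integrable lborel (ball 0 r) (\<lambda>s. \<Sum>x\<in>S. real (m x) * ln (norm ((a - x) + s)))"
    using set_integrable_ln_norm unfolding set_integrable_def
    by (simp add: sum_distrib_left mult.left_commute[of "indicator _ _"])
  have iF: "set_integrable lborel (ball 0 r) ?F"
    using area_mean_holomorphic(1)[OF H' r(1) rR] i by (rule set_integral_add)
  have AE': "AE s in lborel. indicator (ball 0 r) s *\<^sub>R ?F s = indicator (ball 0 r) s *\<^sub>R ln (norm (G (a + s)))"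
    using AE by eventually_elim auto
  have mF: "(\<lambda>s. indicator (ball 0 r) s *\<^sub>R ?F s) \<in> borel_measurable lborel"
    using iF by (simp add: set_integrable_def)
  have mG': "(\<lambda>s. indicator (ball 0 r) s *\<^sub>R ln (norm (G (a + s)))) \<in> borel_measurable lborel"
  proof -
    have "(\<lambda>s. G (a + s)) \<in> borel_measurable borel" by (rule measurable_compose[OF _ mG]) measurable
    then have "(\<lambda>s. ln (norm (G (a + s)))) \<in> borel_measurable borel" by measurable
    then show ?thesis by (intro borel_measurable_scaleR borel_measurable_indicator) auto
  qed
  show "set_integrable lborel (ball 0 r) (\<lambda>s. ln (norm (G (a + s))))"
    using integrable_cong_AE[OF mF mG' AE'] iF by (simp add: set_integrable_def)
  have "(LINT s:ball 0 r|lborel. ln (norm (G (a + s)))) = (LINT s:ball 0 r|lborel. ?F s)"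
    unfolding set_lebesgue_integral_def by (rule integral_cong_AE[OF mF mG' AE', symmetric])
  also have "\<dots> = pi * r\<^sup>2 * Re (H a) + (\<Sum>x\<in>S. real (m x) * (LINT s:ball 0 r|lborel. ln (norm ((a - x) + s))))"
  proof -
    have "(LINT s:ball 0 r|lborel. \<Sum>x\<in>S. real (m x) * ln (norm ((a - x) + s))) =
      (\<Sum>x\<in>S. real (m x) * (LINT s:ball 0 r|lborel. ln (norm ((a - x) + s))))"
      using set_integrable_ln_norm[of 0 r] unfolding set_lebesgue_integral_def set_integrable_def
      by (simp add: sum_distrib_left mult.left_commute[of "indicator _ _"] Bochner_Integration.integral_sum)
    then show ?thesis
      using area_mean_holomorphic[OF H' r(1) rR] i by (subst set_integral_add) auto
  qed
  finally have 1: "(LINT s:ball 0 r|lborel. ln (norm (G (a + s)))) / (pi * r\<^sup>2) =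
     Re (H a) + (\<Sum>x\<in>S. real (m x) * ((LINT s:ball 0 r|lborel. ln (norm ((a - x) + s))) / (pi * r\<^sup>2)))"
    using r by (simp add: add_divide_distrib sum_divide_distrib)
  have "a \<in> ball 0 R" using r by simp
  then have 2: "ln (norm (G a)) = Re (H a) + (\<Sum>x\<in>S. real (m x) * ln (norm (a - x)))"
    using G ln_norm_factored[OF S, of a "H a" m] a by auto
  show "(LINT s:ball 0 r|lborel. ln (norm (G (a + s)))) / (pi * r\<^sup>2) - ln (norm (G a)) =
      (\<Sum>x\<in>S. real (m x) * jensen_kernel r (a - x))"
    unfolding 1 2 jensen_kernel_def by (simp add: right_diff_distrib sum_subtractf)
qed

text \<open>Convolution with the normalised kernel is an approximate identity as \<open>r \<rightarrow> 0\<close>.\<close>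

definition kernel_smooth :: "real \<Rightarrow> (complex \<Rightarrow> real) \<Rightarrow> complex \<Rightarrow> real" where
  "kernel_smooth r f x = (LINT a|lborel. f a * jensen_kernel r (a - x))"

lemma jensen_kernel_translate:
  assumes "r > 0"
  shows "integrable lborel (\<lambda>a. jensen_kernel r (a - x))"
    and "(LINT a|lborel. jensen_kernel r (a - x)) = (LINT a|lborel. jensen_kernel r a)"
  using integral_lborel_translate[of "jensen_kernel r" "- x"] integrable_jensen_kernel[OF assms] by simp_all

lemma AE_jensen_kernel_nonneg:
  assumes "r > 0"
  shows "AE a in lborel. 0 \<le> jensen_kernel r (a - x)"
  using AE_lborel_singleton[of x] by eventually_elim (use jensen_kernel_nonneg[OF assms] in auto)

lemma integrable_mult_jensen_kernel:
  assumes r: "r > 0" and [measurable]: "f \<in> borel_measurable borel" and C: "\<And>x. \<bar>f x\<bar> \<le> C"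
  shows "integrable lborel (\<lambda>a. f a * jensen_kernel r (a - x))"
proof (rule Bochner_Integration.integrable_bound)
  show "integrable lborel (\<lambda>a. C * jensen_kernel r (a - x))"
    using jensen_kernel_translate(1)[OF r] by simp
  show "AE a in lborel. norm (f a * jensen_kernel r (a - x)) \<le> norm (C * jensen_kernel r (a - x))"
    using C by (auto intro!: AE_I2 simp: abs_mult mult_right_mono order_trans[OF C abs_ge_self])
qed measurable

text \<open>The kernel is nonnegative almost everywhere and supported in the disk of radius
  \<open>r\<close>. It is not normalised here, so \<open>f x\<close> is compared after
  multiplication by the total mass.\<close>

lemma kernel_smooth_approx:
  assumes r: "r > 0" and f: "f \<in> borel_measurable borel" and C: "\<And>x. \<bar>f x\<bar> \<le> C"
    and e: "\<And>a. norm (a - x) < r \<Longrightarrow> \<bar>f a - f x\<bar> \<le> e"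
  shows "\<bar>kernel_smooth r f x - f x * (LINT a|lborel. jensen_kernel r a)\<bar> \<le> e * (LINT a|lborel. jensen_kernel r a)"
proof -
  note i = integrable_mult_jensen_kernel[OF r f C] jensen_kernel_translate[OF r]
  have "kernel_smooth r f x - f x * (LINT a|lborel. jensen_kernel r a) = (LINT a|lborel. f a * jensen_kernel r (a - x) - f x * jensen_kernel r (a - x))"
    unfolding kernel_smooth_def using i by (subst Bochner_Integration.integral_diff) auto
  also have "\<bar>\<dots>\<bar> \<le> (LINT a|lborel. e * jensen_kernel r (a - x))"
  proof (rule order_trans[OF integral_abs_bound integral_mono_AE])
    show "AE a in lborel. \<bar>f a * jensen_kernel r (a - x) - f x * jensen_kernel r (a - x)\<bar> \<le> e * jensen_kernel r (a - x)"
      using AE_jensen_kernel_nonneg[OF r, of x]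
    proof eventually_elim
      case (elim a)
      show ?case
      proof (cases "norm (a - x) < r")
        case True
        then show ?thesis using elim e[OF True]
          by (simp add: left_diff_distrib[symmetric] abs_mult mult_right_mono)
      next
        case False
        then show ?thesis using jensen_kernel_eq_0[OF r] by simp
      qed
    qed
  qed (use i in auto)
  also have "\<dots> = e * (LINT a|lborel. jensen_kernel r a)" using i by simp
  finally show ?thesis .
qed

lemma kernel_smooth_eq_0:
  assumes r: "r > 0" and \<rho>: "\<And>x. norm x \<ge> \<rho> \<Longrightarrow> f x = 0" and x: "norm x \<ge> \<rho> + r"
  shows "kernel_smooth r f x = 0"
proof -
  have "f a * jensen_kernel r (a - x) = 0" for a
  proof (cases "norm a < \<rho>")
    case True
    then have "norm (a - x) \<ge> r" using x norm_triangle_ineq2[of x a] by (simp add: norm_minus_commute)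
    then show ?thesis using jensen_kernel_eq_0[OF r] by simp
  next
    case False
    then show ?thesis using \<rho> by simp
  qed
  then show ?thesis unfolding kernel_smooth_def by (simp only: Bochner_Integration.integral_zero)
qed

lemma kernel_smooth_nonneg:
  assumes r: "r > 0" and "\<And>x. f x \<ge> 0"
  shows "kernel_smooth r f x \<ge> 0"
  unfolding kernel_smooth_def
  by (rule integral_nonneg_AE) (use AE_jensen_kernel_nonneg[OF r, of x] assms in \<open>auto elim!: eventually_mono\<close>)

lemma factored_scale:
  assumes W: "\<And>z. z \<in> ball 0 (c * R) \<Longrightarrow> W z = exp (H z) * (\<Prod>x\<in>S. (z - x) ^ m x)"
    and H: "H holomorphic_on ball 0 (c * R)" and c: "c > 0" and S: "finite S"
  obtains H' where "H' holomorphic_on ball 0 R"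
    "\<And>z. z \<in> ball 0 R \<Longrightarrow> W (of_real c * z) = exp (H' z) * (\<Prod>x\<in>(\<lambda>x. x / of_real c) ` S. (z - x) ^ m (of_real c * x))"
proof -
  \<comment> \<open>Each linear factor of \<open>W (c * z)\<close> yields a factor \<open>c\<close>;
    the power \<open>c ^ N\<close> so produced, with \<open>N\<close> the number of roots counted
    with multiplicity, is absorbed into the exponent.\<close>
  define N where "N = (\<Sum>x\<in>S. m x)"
  have inB: "of_real c * z \<in> ball 0 (c * R)" if "z \<in> ball 0 R" for z :: complex
    using that c by (simp add: norm_mult)
  have inj: "inj_on (\<lambda>x. x / of_real c :: complex) S" using c by (auto simp: inj_on_def)
  show thesis
  proof (rule that[of "\<lambda>z. H (of_real c * z) + of_real (real N * ln c)"])
    have "(H \<circ> (\<lambda>z. of_real c * z)) holomorphic_on ball 0 R"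
      by (rule holomorphic_on_compose_gen[OF _ H]) (use inB in \<open>auto intro!: holomorphic_intros\<close>)
    then show "(\<lambda>z. H (of_real c * z) + of_real (real N * ln c)) holomorphic_on ball 0 R"
      by (intro holomorphic_intros) (simp add: comp_def)
    fix z :: complex assume z: "z \<in> ball 0 R"
    have "exp (of_real (real N * ln c) :: complex) = of_real (c ^ N)"
      using c by (simp add: exp_of_real exp_of_nat_mult del: of_real_mult)
    moreover have "(\<Prod>x\<in>S. (of_real c * z - x) ^ m x) = of_real (c ^ N) * (\<Prod>x\<in>S. (z - x / of_real c) ^ m x)"
    proof -
      have "(of_real c * z - x) ^ m x = of_real c ^ m x * (z - x / of_real c) ^ m x" for x
        using c by (simp add: power_mult_distrib[symmetric] right_diff_distrib)
      then show ?thesis by (simp add: prod.distrib N_def power_sum)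
    qed
    moreover have "(\<Prod>x\<in>(\<lambda>x. x / of_real c) ` S. (z - x) ^ m (of_real c * x)) = (\<Prod>x\<in>S. (z - x / of_real c) ^ m x)"
      using c by (subst prod.reindex[OF inj]) simp
    ultimately show "W (of_real c * z) = exp (H (of_real c * z) + of_real (real N * ln c)) *
        (\<Prod>x\<in>(\<lambda>x. x / of_real c) ` S. (z - x) ^ m (of_real c * x))"
      using W[OF inB[OF z]] by (simp add: exp_add mult.assoc)
  qed
qed

lemma entire_scale_factor:
  fixes W :: "complex \<Rightarrow> complex" and R c :: real
  assumes W: "W holomorphic_on UNIV" and nz: "\<not> (\<forall>z. W z = 0)" and c: "c > 0"
  obtains H where "finite {z \<in> ball 0 R. W (of_real c * z) = 0}" "H holomorphic_on ball 0 R"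
    "\<And>z. z \<in> ball 0 R \<Longrightarrow> W (of_real c * z) =
        exp (H z) * (\<Prod>x\<in>{z \<in> ball 0 R. W (of_real c * z) = 0}. (z - x) ^ nat (zorder W (of_real c * x)))"
proof -
  obtain H where H: "finite {z \<in> ball 0 (c * R). W z = 0}" "H holomorphic_on ball 0 (c * R)"
    "\<And>z. z \<in> ball 0 (c * R) \<Longrightarrow> W z = exp (H z) * (\<Prod>x\<in>{z \<in> ball 0 (c * R). W z = 0}. (z - x) ^ nat (zorder W x))"
    using holomorphic_factor_zeros_ball[OF W nz, of "c * R"] by blast
  have im: "(\<lambda>x. x / of_real c) ` {z \<in> ball 0 (c * R). W z = 0} = {z \<in> ball 0 R. W (of_real c * z) = 0}"
  proof (intro set_eqI iffI)
    fix z assume "z \<in> {z \<in> ball 0 R. W (of_real c * z) = 0}"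
    then show "z \<in> (\<lambda>x. x / of_real c) ` {z \<in> ball 0 (c * R). W z = 0}"
      using c by (intro image_eqI[of _ _ "of_real c * z"]) (auto simp: norm_mult)
  qed (use c in \<open>auto simp: norm_divide field_simps\<close>)
  obtain H' where "H' holomorphic_on ball 0 R"
    "\<And>z. z \<in> ball 0 R \<Longrightarrow> W (of_real c * z) = exp (H' z) * (\<Prod>x\<in>(\<lambda>x. x / of_real c) ` {z \<in> ball 0 (c * R). W z = 0}. (z - x) ^ nat (zorder W (of_real c * x)))"
    using factored_scale[OF H(3) H(2) c H(1)] by blast
  then show thesis using that finite_imageI[OF H(1), of "\<lambda>x. x / of_real c"] unfolding im by blast
qed

section \<open>Jensen's formula for a rescaled entire function\<close>

context
  fixes W :: "complex \<Rightarrow> complex" and c :: real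
  assumes W: "W holomorphic_on UNIV" and nz: "\<not> (\<forall>z. W z = 0)" and c: "c > 0"
begin

lemma borel_measurable_entire_scale: "(\<lambda>z. W (of_real c * z)) \<in> borel_measurable borel"
  by (intro borel_measurable_continuous_onI continuous_on_compose2[OF holomorphic_on_imp_continuous_on[OF W]] continuous_intros) auto

lemma finite_zeros_scale: "finite {z \<in> ball 0 R. W (of_real c * z) = 0}"
  using entire_scale_factor[OF W nz c, of R] by blast

lemma entire_scale_mean:
  assumes r: "0 < r" "norm a + r < R" and a: "W (of_real c * a) \<noteq> 0"
  shows "set_integrable lborel (ball 0 r) (\<lambda>s. ln (norm (W (of_real c * (a + s)))))"
    and "(LINT s:ball 0 r|lborel. ln (norm (W (of_real c * (a + s))))) / (pi * r\<^sup>2) - ln (norm (W (of_real c * a))) =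
      (\<Sum>x\<in>{z \<in> ball 0 R. W (of_real c * z) = 0}. real (nat (zorder W (of_real c * x))) * jensen_kernel r (a - x))"
proof -
  obtain H where H: "finite {z \<in> ball 0 R. W (of_real c * z) = 0}" "H holomorphic_on ball 0 R"
    "\<And>z. z \<in> ball 0 R \<Longrightarrow> W (of_real c * z) =
        exp (H z) * (\<Prod>x\<in>{z \<in> ball 0 R. W (of_real c * z) = 0}. (z - x) ^ nat (zorder W (of_real c * x)))"
    using entire_scale_factor[OF W nz c] by blast
  have a': "a \<notin> {z \<in> ball 0 R. W (of_real c * z) = 0}" using a by simp
  show "set_integrable lborel (ball 0 r) (\<lambda>s. ln (norm (W (of_real c * (a + s)))))"
    by (rule ln_norm_ball_mean(1)[OF H borel_measurable_entire_scale r a'])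
  show "(LINT s:ball 0 r|lborel. ln (norm (W (of_real c * (a + s))))) / (pi * r\<^sup>2) - ln (norm (W (of_real c * a))) =
      (\<Sum>x\<in>{z \<in> ball 0 R. W (of_real c * z) = 0}. real (nat (zorder W (of_real c * x))) * jensen_kernel r (a - x))"
    by (rule ln_norm_ball_mean(2)[OF H borel_measurable_entire_scale r a'])
qed

text \<open>Subharmonicity of \<open>ln |W|\<close>, with the defect written as a sum of nonnegative
  kernels. Under the convention \<open>ln 0 = 0\<close> the inequality can fail at a zero, so that
  case is excluded.\<close>

lemma entire_scale_submean:
  assumes r: "0 < r" and a: "W (of_real c * a) \<noteq> 0"
  shows "pi * r\<^sup>2 * ln (norm (W (of_real c * a))) \<le> (LINT s:ball 0 r|lborel. ln (norm (W (of_real c * (a + s)))))"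
proof -
  have "0 \<le> (\<Sum>x\<in>{z \<in> ball 0 (norm a + r + 1). W (of_real c * z) = 0}. real (nat (zorder W (of_real c * x))) * jensen_kernel r (a - x))"
    using a by (intro sum_nonneg mult_nonneg_nonneg jensen_kernel_nonneg r) auto
  also have "\<dots> = (LINT s:ball 0 r|lborel. ln (norm (W (of_real c * (a + s))))) / (pi * r\<^sup>2) - ln (norm (W (of_real c * a)))"
    by (rule entire_scale_mean(2)[symmetric]) (use r a in auto)
  finally show ?thesis using r by (simp add: field_simps)
qed

lemma AE_entire_scale_nonzero: "AE z in lborel. W (of_real c * z) \<noteq> 0"
proof -
  have "{z. W (of_real c * z) = 0} = (\<Union>n::nat. {z \<in> ball 0 (real n). W (of_real c * z) = 0})"
    by (auto simp: reals_Archimedean2)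
  then have "countable {z. W (of_real c * z) = 0}"
    using finite_zeros_scale by (simp add: countable_finite)
  then have "{z. W (of_real c * z) = 0} \<in> null_sets lborel" by (rule countable_imp_null_set_lborel)
  from AE_not_in[OF this] show ?thesis by simp
qed

lemma locally_integrable_entire_scale: "locally_integrable (\<lambda>z. ln (norm (W (of_real c * z))))"
  unfolding locally_integrable_def
proof (intro conjI allI)
  show m: "(\<lambda>z. ln (norm (W (of_real c * z)))) \<in> borel_measurable borel"
    using borel_measurable_entire_scale by measurable
  fix R :: real
  \<comment> \<open>The mean formula is available only around a point where the function does not
    vanish; a disk about such a point that covers \<open>ball 0 R\<close> suffices.\<close>
  obtain a where a: "W (of_real c * a) \<noteq> 0"
    using nz c by (metis nonzero_mult_div_cancel_left of_real_eq_0_iff order_less_irrefl times_divide_eq_right)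
  let ?r = "\<bar>R\<bar> + norm a + 1"
  have "?r > 0" using norm_ge_zero[of a] by linarith
  then have "set_integrable lborel (ball 0 ?r) (\<lambda>s. ln (norm (W (of_real c * (a + s)))))"
    by (rule entire_scale_mean(1)[of ?r a "norm a + ?r + 1"]) (use a in auto)
  moreover have "ball 0 ?r = (+) a -` ball a ?r" by (auto simp: dist_norm)
  ultimately have i: "set_integrable lborel (ball a ?r) (\<lambda>s. ln (norm (W (of_real c * s))))"
    using set_integrable_translate(1)[OF m, of "ball a ?r" a] by simp
  have sub: "ball 0 R \<subseteq> ball a ?r"
  proof
    fix x :: complex assume "x \<in> ball 0 R"
    then show "x \<in> ball a ?r" using norm_triangle_ineq4[of a x] by (simp add: dist_norm)
  qed
  show "set_integrable lborel (ball 0 R) (\<lambda>z. ln (norm (W (of_real c * z))))"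
    by (rule set_integrable_subset[OF i _ sub]) simp
qed

text \<open>The duality used later: symmetry moves the operator to the logarithm, and Jensen's
  formula turns it into kernels at the zeros. Since \<open>\<rho> + r < R\<close>, zeros outside
  \<open>ball 0 R\<close> would have weight 0.\<close>

lemma integral_smear_entire:
  assumes f[measurable]: "f \<in> borel_measurable borel"
    and C: "\<And>x. \<bar>f x\<bar> \<le> C" and \<rho>: "\<And>x. norm x \<ge> \<rho> \<Longrightarrow> f x = 0" and r: "r > 0" and R: "\<rho> + r < R"
  shows "(LINT y|lborel. ln (norm (W (of_real c * y))) * smear r f y) =
    (\<Sum>x\<in>{z \<in> ball 0 R. W (of_real c * z) = 0}. real (nat (zorder W (of_real c * x))) * kernel_smooth r f x)"
proof -
  let ?Z = "{z \<in> ball 0 R. W (of_real c * z) = 0}"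
  let ?v = "\<lambda>y. ln (norm (W (of_real c * y)))"
  have "(LINT y|lborel. ?v y * smear r f y) = (LINT a|lborel. f a * ((LINT s:ball 0 r|lborel. ?v (a + s)) / (pi * r\<^sup>2) - ?v a))"
    by (rule integral_smear[OF locally_integrable_entire_scale f C \<rho> r])
  also have "\<dots> = (LINT a|lborel. (\<Sum>x\<in>?Z. real (nat (zorder W (of_real c * x))) * (f a * jensen_kernel r (a - x))))"
  proof (rule integral_cong_AE)
    show "AE a in lborel. f a * ((LINT s:ball 0 r|lborel. ?v (a + s)) / (pi * r\<^sup>2) - ?v a) =
        (\<Sum>x\<in>?Z. real (nat (zorder W (of_real c * x))) * (f a * jensen_kernel r (a - x)))"
      using AE_entire_scale_nonzero
    proof eventually_elim
      case (elim a)
      show ?case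
      proof (cases "norm a < \<rho>")
        case True
        then show ?thesis using entire_scale_mean(2)[OF r, of a R] elim R
          by (simp add: sum_distrib_left mult.left_commute)
      qed (use \<rho> in simp)
    qed
    have m: "?v \<in> borel_measurable borel" using locally_integrable_entire_scale by (simp add: locally_integrable_def)
    have ind: "indicator (ball 0 r) s = (indicator {..<r} (norm s) :: real)" for s :: complex
      by (simp add: indicator_def)
    have "(\<lambda>a. LINT s:ball 0 r|lborel. ?v (a + s)) \<in> borel_measurable lborel"
      unfolding set_lebesgue_integral_def ind
      by (rule lborel.borel_measurable_lebesgue_integral) (use m in measurable)
    then show "(\<lambda>a. f a * ((LINT s:ball 0 r|lborel. ?v (a + s)) / (pi * r\<^sup>2) - ?v a)) \<in> borel_measurable lborel"
      using m by simp
  qed measurable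
  also have "\<dots> = (\<Sum>x\<in>?Z. real (nat (zorder W (of_real c * x))) * kernel_smooth r f x)"
    unfolding kernel_smooth_def using integrable_mult_jensen_kernel[OF r f C]
    by (subst Bochner_Integration.integral_sum) auto
  finally show ?thesis .
qed

end

section \<open>Anti-concentration\<close>

text \<open>Induction on the ground set by deleting one point. Averaging over the deleted point
  works because \<open>(n + 1) / binom(n + 1, |A|)\<close> equals the sum of
  \<open>1 / binom(n, |A|)\<close> over the \<open>n + 1 - |A|\<close> points outside
  \<open>A\<close>.\<close>

lemma lym_inequality:
  assumes "finite X" "F \<subseteq> Pow X" and anti: "\<And>A B. A \<in> F \<Longrightarrow> B \<in> F \<Longrightarrow> A \<subseteq> B \<Longrightarrow> A = B"
  shows "(\<Sum>A\<in>F. 1 / real (card X choose card A)) \<le> 1"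
  using assms
proof (induction "card X" arbitrary: X F)
  case 0
  then have "F \<subseteq> {{}}" by auto
  then have "F = {} \<or> F = {{}}" by auto
  then show ?case by auto
next
  case (Suc n)
  have finF: "finite F" using Suc.prems by (meson finite_Pow_iff finite_subset)
  show ?case
  \<comment> \<open>If the whole set belongs to the antichain, nothing else does; otherwise every
    member omits a point and is counted in the average.\<close>
  proof (cases "X \<in> F")
    case True
    then have "F = {X}" using Suc.prems(2) Suc.prems(3)[OF _ True] by blast
    then show ?thesis by simp
  next
    case False
    define Fx where "Fx x = {A\<in>F. x \<notin> A}" for x
    have IH: "(\<Sum>A\<in>Fx x. 1 / real (n choose card A)) \<le> 1" if x: "x \<in> X" for x
    proof -
      have "n = card (X - {x})" using Suc.hyps(2) x Suc.prems(1) by simp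
      moreover have "Fx x \<subseteq> Pow (X - {x})" using Suc.prems(2) by (auto simp: Fx_def)
      moreover have "A = B" if "A \<in> Fx x" "B \<in> Fx x" "A \<subseteq> B" for A B
        using that Suc.prems(3) by (auto simp: Fx_def)
      ultimately show ?thesis using Suc.hyps(1)[of "X - {x}" "Fx x"] Suc.prems(1) by auto
    qed
    have each: "(\<Sum>x\<in>X - A. 1 / real (n choose card A)) = real (Suc n) / real (card X choose card A)" if A: "A \<in> F" for A
    proof -
      have AX: "A \<subseteq> X" "A \<noteq> X" using A Suc.prems(2) False by auto
      then have "finite A" "card A < card X" using Suc.prems(1) finite_subset psubset_card_mono by blast+
      then have c: "card A \<le> n" using Suc.hyps(2) by simp
      have "card (X - A) = Suc n - card A" using AX Suc.prems(1) Suc.hyps(2) \<open>finite A\<close> by (simp add: card_Diff_subset)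
      moreover have "(Suc n - card A) * (Suc n choose card A) = Suc n * (n choose card A)"
        using binomial_absorb_comp[of "Suc n" "card A"] by simp
      then have "real (Suc n - card A) * real (Suc n choose card A) = real (Suc n) * real (n choose card A)"
        by (metis of_nat_mult)
      moreover have "real (n choose card A) > 0" "real (Suc n choose card A) > 0" using c by auto
      ultimately show ?thesis by (simp add: Suc.hyps(2)[symmetric] frac_eq_eq)
    qed
    have "real (Suc n) * (\<Sum>A\<in>F. 1 / real (card X choose card A)) = (\<Sum>A\<in>F. \<Sum>x\<in>X - A. 1 / real (n choose card A))"
      using each by (simp add: sum_distrib_left)
    also have "\<dots> = (\<Sum>A\<in>F. \<Sum>x\<in>{x\<in>X. x \<notin> A}. 1 / real (n choose card A))"
      by (intro sum.cong) auto
    also have "\<dots> = (\<Sum>x\<in>X. \<Sum>A\<in>Fx x. 1 / real (n choose card A))"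
      unfolding Fx_def by (rule sum.swap_restrict[OF finF Suc.prems(1)])
    also have "\<dots> \<le> (\<Sum>x\<in>X. 1)" using IH by (rule sum_mono)
    also have "\<dots> = real (Suc n)" using Suc.hyps(2) by simp
    finally show ?thesis by simp
  qed
qed

lemma sperner_bound:
  assumes "finite X" "F \<subseteq> Pow X" and "\<And>A B. A \<in> F \<Longrightarrow> B \<in> F \<Longrightarrow> A \<subseteq> B \<Longrightarrow> A = B"
  shows "card F \<le> card X choose (card X div 2)"
proof -
  have "real (card F) / real (card X choose (card X div 2)) = (\<Sum>A\<in>F. 1 / real (card X choose (card X div 2)))"
    by simp
  also have "\<dots> \<le> (\<Sum>A\<in>F. 1 / real (card X choose card A))"
  proof (rule sum_mono)
    fix A assume "A \<in> F"
    then have "card A \<le> card X" using assms by (auto intro: card_mono)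
    then show "1 / real (card X choose (card X div 2)) \<le> 1 / real (card X choose card A)"
      using binomial_maximum[of "card X" "card A"] by (intro divide_left_mono) auto
  qed
  also have "\<dots> \<le> 1" by (rule lym_inequality[OF assms])
  finally show ?thesis by (simp add: divide_le_eq split: if_splits)
qed

text \<open>The squared form goes through induction because
  \<open>(2 * m + 1) * (2 * m + 3) \<le> 4 * (m + 1)^2\<close>.\<close>

lemma central_binomial_even_bound: "real ((2 * m) choose m) * sqrt (2 * real m + 1) \<le> 4 ^ m"
proof -
  have "(real ((2 * m) choose m))\<^sup>2 * (2 * real m + 1) \<le> (4 ^ m)\<^sup>2"
  proof (induction m)
    case (Suc m)
    define b where "b = (2 * m) choose m"
    define c where "c = (2 * Suc m) choose (Suc m)"
    define d where "d = Suc (2 * m) choose m"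
    have "Suc m * c = (2 * Suc m) * d"
      using Suc_times_binomial[of m "Suc (2 * m)"] by (simp add: c_def d_def)
    moreover have "Suc m * d = Suc (2 * m) * b"
      using binomial_absorb_comp[of "Suc (2 * m)" m] by (simp add: Suc_diff_le d_def b_def)
    ultimately have "Suc m * (Suc m * c) = Suc m * (2 * (Suc (2 * m) * b))"
      by (metis mult.assoc mult.left_commute)
    then have "Suc m * c = 2 * (Suc (2 * m) * b)" by (metis mult_cancel1 nat.distinct(1))
    then have "real (Suc m * c) = real (2 * (Suc (2 * m) * b))" by (rule arg_cong)
    then have eq: "real c * (real m + 1) = real b * (2 * (2 * real m + 1))" by (simp add: algebra_simps)
    have IH: "(real b)\<^sup>2 * (2 * real m + 1) \<le> (4 ^ m)\<^sup>2" using Suc.IH by (simp add: b_def)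
    have "(real m + 1)\<^sup>2 * ((real c)\<^sup>2 * (2 * real (Suc m) + 1)) = (real c * (real m + 1))\<^sup>2 * (2 * real m + 3)"
      by (simp add: power2_eq_square algebra_simps)
    also have "\<dots> = (real b)\<^sup>2 * (2 * real m + 1) * (4 * ((2 * real m + 1) * (2 * real m + 3)))"
      unfolding eq by (simp add: power2_eq_square algebra_simps)
    also have "\<dots> \<le> (4 ^ m)\<^sup>2 * (16 * (real m + 1)\<^sup>2)"
      by (rule mult_mono[OF IH]) (auto simp: power2_eq_square algebra_simps)
    also have "\<dots> = (real m + 1)\<^sup>2 * (4 ^ Suc m)\<^sup>2" by (simp add: power2_eq_square)
    finally have "(real c)\<^sup>2 * (2 * real (Suc m) + 1) \<le> (4 ^ Suc m)\<^sup>2"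
      by (rule mult_left_le_imp_le) simp
    then show ?case by (simp only: c_def)
  qed simp
  then have "sqrt ((real ((2 * m) choose m))\<^sup>2 * (2 * real m + 1)) \<le> sqrt ((4 ^ m)\<^sup>2)"
    by (rule real_sqrt_le_mono)
  then show ?thesis by (simp add: real_sqrt_mult)
qed

lemma central_binomial_bound:
  assumes "n > 0"
  shows "real (n choose (n div 2)) \<le> 2 ^ n / sqrt (real n)"
proof (cases "even n")
  case True
  then obtain m where n: "n = 2 * m" by blast
  have "real (n choose (n div 2)) * sqrt (real n) \<le> real (n choose (n div 2)) * sqrt (2 * real m + 1)"
    by (intro mult_left_mono) (auto simp: n)
  also have "\<dots> \<le> 2 ^ n" using central_binomial_even_bound[of m] by (simp add: n power_mult)
  finally show ?thesis using assms by (simp add: pos_le_divide_eq)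
next
  case False
  then obtain m where n: "n = 2 * m + 1" by (blast elim: oddE)
  \<comment> \<open>An odd row is reduced to the next even row: its two equal middle entries add up
    to the central entry below.\<close>
  have "2 * (n choose m) = (2 * Suc m) choose (Suc m)"
  proof -
    have "(2 * Suc m) choose (Suc m) = (Suc (2 * m) choose m) + (Suc (2 * m) choose Suc m)" by simp
    moreover have "Suc (2 * m) choose Suc m = Suc (2 * m) choose m"
      using binomial_symmetric[of m "Suc (2 * m)"] by (simp add: Suc_diff_le)
    ultimately show ?thesis by (simp add: n)
  qed
  then have "2 * real (n choose m) = real ((2 * Suc m) choose (Suc m))" by (metis of_nat_mult of_nat_numeral)
  then have "2 * (real (n choose m) * sqrt (real n)) \<le> real ((2 * Suc m) choose (Suc m)) * sqrt (2 * real (Suc m) + 1)"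
    unfolding mult.assoc[symmetric] by (intro mult_mono) (auto simp: n)
  also have "\<dots> \<le> 4 ^ Suc m" by (rule central_binomial_even_bound)
  also have "\<dots> = 2 * 2 ^ n" by (simp add: n power_mult)
  finally show ?thesis using assms by (simp add: pos_le_divide_eq n)
qed

text \<open>Erdos' argument: after normalising signs the favourable sign patterns form an antichain.\<close>

lemma littlewood_offord_real:
  fixes b :: "'a \<Rightarrow> real"
  assumes I: "finite I" and J: "J \<subseteq> I" "J \<noteq> {}" and B: "\<And>k. k \<in> J \<Longrightarrow> \<bar>b k\<bar> > L"
  shows "real (card {A \<in> Pow I. \<bar>\<Sum>k\<in>I. (if k \<in> A then - b k else b k)\<bar> \<le> L}) \<le> 2 ^ card I / sqrt (real (card J))"
proof -
  define s where "s A = (\<Sum>k\<in>I. (if k \<in> A then - b k else b k))" for A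
  define P where "P = {A \<in> Pow I. \<bar>s A\<bar> \<le> L}"
  define N where "N = {k\<in>J. b k > 0}"
  have finJ: "finite J" using I J finite_subset by blast
  have finP: "finite P" using I by (simp add: P_def)
  \<comment> \<open>The signs outside \<open>J\<close> are frozen as \<open>D\<close>. Sperner's
    theorem is applied to the remaining freedom on \<open>J\<close>, and there are
    \<open>2 ^ (card I - card J)\<close> choices of \<open>D\<close>.\<close>
  have *: "card {A \<in> P. A - J = D} \<le> card J choose (card J div 2)" for D
  proof -
    \<comment> \<open>\<open>?\<phi> A\<close> consists of the indices in \<open>J\<close> whose
      signed term equals \<open>\<bar>b k\<bar>\<close>, so enlarging it increases the sum.\<close>
    let ?\<phi> = "\<lambda>A. (J \<inter> A - N) \<union> (N - A)"
    have rec: "A = D \<union> (?\<phi> A - N) \<union> (N - ?\<phi> A)" if "A - J = D" for A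
      using that by (auto simp: N_def)
    have inj: "inj_on ?\<phi> {A \<in> P. A - J = D}"
    proof (rule inj_onI)
      fix A B assume "A \<in> {A \<in> P. A - J = D}" "B \<in> {A \<in> P. A - J = D}" "?\<phi> A = ?\<phi> B"
      then show "A = B" using rec[of A] rec[of B] by simp
    qed
    have "card (?\<phi> ` {A \<in> P. A - J = D}) \<le> card J choose (card J div 2)"
    proof (rule sperner_bound[OF finJ])
      show "?\<phi> ` {A \<in> P. A - J = D} \<subseteq> Pow J" by (auto simp: N_def)
      fix X Y assume "X \<in> ?\<phi> ` {A \<in> P. A - J = D}" "Y \<in> ?\<phi> ` {A \<in> P. A - J = D}" and XY: "X \<subseteq> Y"
      then obtain A B where A: "A \<in> P" "A - J = D" "X = ?\<phi> A" and B': "B \<in> P" "B - J = D" "Y = ?\<phi> B" by auto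
      show "X = Y"
      proof (rule ccontr)
        assume "X \<noteq> Y"
        then obtain k where k: "k \<in> Y" "k \<notin> X" using XY by auto
        then have kJ: "k \<in> J" using B' by (auto simp: N_def)
        have mem: "(j \<in> A \<longleftrightarrow> j \<in> B) \<or> (j \<in> J \<and> j \<in> Y \<and> j \<notin> X)" for j
          using A(2,3) B'(2,3) XY by (auto simp: N_def)
        have val: "(if j \<in> B then - b j else b j) - (if j \<in> A then - b j else b j) = (if j \<in> Y \<and> j \<notin> X then 2 * \<bar>b j\<bar> else 0)"
          if "j \<in> I" for j
        proof (cases "j \<in> J")
          case True
          then show ?thesis using A(3) B'(3) XY by (auto simp: N_def)
        next
          case False
          then show ?thesis using mem[of j] A(3) B'(3) by (auto simp: N_def)
        qed
        have "s B - s A = (\<Sum>j\<in>I. if j \<in> Y \<and> j \<notin> X then 2 * \<bar>b j\<bar> else 0)"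
          unfolding s_def sum_subtractf[symmetric] using val by (intro sum.cong) auto
        also have "\<dots> \<ge> (\<Sum>j\<in>{k}. if j \<in> Y \<and> j \<notin> X then 2 * \<bar>b j\<bar> else 0)"
          using kJ J by (intro sum_mono2 I) auto
        \<comment> \<open>A single additional index raises the sum by more than
          \<open>2 * L\<close>, the width of the window: two patterns in the window are never
          strictly nested.\<close>
        finally have "s B - s A \<ge> 2 * \<bar>b k\<bar>" using k by simp
        then have "s B - s A > 2 * L" using B[OF kJ] by linarith
        moreover have "\<bar>s A\<bar> \<le> L" "\<bar>s B\<bar> \<le> L" using A(1) B'(1) by (auto simp: P_def)
        ultimately show False by linarith
      qed
    qed
    then show ?thesis by (simp add: card_image[OF inj])
  qed
  have "P = (\<Union>D\<in>Pow (I - J). {A \<in> P. A - J = D})" by (auto simp: P_def)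
  then have "card P \<le> (\<Sum>D\<in>Pow (I - J). card {A \<in> P. A - J = D})"
    using card_UN_le[of "Pow (I - J)" "\<lambda>D. {A \<in> P. A - J = D}"] I by simp
  also have "\<dots> \<le> (\<Sum>D\<in>Pow (I - J). card J choose (card J div 2))" by (rule sum_mono[OF *])
  also have "\<dots> = 2 ^ (card I - card J) * (card J choose (card J div 2))"
    using I J finJ by (simp add: card_Pow card_Diff_subset)
  finally have "real (card P) \<le> 2 ^ (card I - card J) * real (card J choose (card J div 2))"
    by (metis of_nat_le_iff of_nat_mult of_nat_numeral of_nat_power)
  also have "\<dots> \<le> 2 ^ (card I - card J) * (2 ^ card J / sqrt (real (card J)))"
    using J finJ by (intro mult_left_mono central_binomial_bound) (auto simp: card_gt_0_iff)
  also have "\<dots> = 2 ^ card I / sqrt (real (card J))"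
    using card_mono[OF I J(1)] by (simp add: power_add[symmetric])
  finally show ?thesis by (simp add: P_def s_def)
qed

text \<open>If \<open>norm (b k) > 2 * L\<close>, the real or the imaginary part exceeds
  \<open>L\<close> in modulus. One of the two alternatives holds for at least half of
  \<open>J\<close>; applying the real inequality to that part costs the factor
  \<open>sqrt 2\<close>.\<close>

lemma littlewood_offord_complex:
  fixes b :: "'a \<Rightarrow> complex"
  assumes I: "finite I" and J: "J \<subseteq> I" "J \<noteq> {}" and B: "\<And>k. k \<in> J \<Longrightarrow> norm (b k) > 2 * L" and L: "L \<ge> 0"
  shows "real (card {A \<in> Pow I. norm (\<Sum>k\<in>I. (if k \<in> A then - b k else b k)) \<le> L}) \<le> 2 ^ card I * sqrt 2 / sqrt (real (card J))"
proof -
  define J1 where "J1 = {k\<in>J. \<bar>Re (b k)\<bar> > L}"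
  define J2 where "J2 = {k\<in>J. \<bar>Im (b k)\<bar> > L}"
  have finJ: "finite J" using I J finite_subset by blast
  have "J = J1 \<union> J2"
  proof
    show "J \<subseteq> J1 \<union> J2"
    proof
      fix k assume k: "k \<in> J"
      have "2 * L < \<bar>Re (b k)\<bar> + \<bar>Im (b k)\<bar>" using B[OF k] cmod_le[of "b k"] by linarith
      then show "k \<in> J1 \<union> J2" using k by (auto simp: J1_def J2_def)
    qed
  qed (auto simp: J1_def J2_def)
  then have cJ: "card J \<le> card J1 + card J2" by (simp add: card_Un_le)
  have fin: "finite {A \<in> Pow I. Q A}" for Q using I by simp
  have *: "real (card {A \<in> Pow I. norm (\<Sum>k\<in>I. (if k \<in> A then - b k else b k)) \<le> L}) \<le> 2 ^ card I * sqrt 2 / sqrt (real (card J))"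
    if K: "K \<subseteq> I" "card J \<le> 2 * card K" "\<And>k. k \<in> K \<Longrightarrow> \<bar>h (b k)\<bar> > L"
     and h: "linear h" "\<And>z. \<bar>h z\<bar> \<le> norm z" for K and h :: "complex \<Rightarrow> real"
  proof -
    have cJ0: "card J > 0" using J finJ by (simp add: card_gt_0_iff)
    have Kne: "K \<noteq> {}" using K cJ0 by auto
    have hs: "h (\<Sum>k\<in>I. (if k \<in> A then - b k else b k)) = (\<Sum>k\<in>I. (if k \<in> A then - h (b k) else h (b k)))" for A
      by (simp add: linear_sum[OF h(1)] if_distrib linear_neg[OF h(1)] cong: if_cong)
    have "card {A \<in> Pow I. norm (\<Sum>k\<in>I. (if k \<in> A then - b k else b k)) \<le> L} \<le>
       card {A \<in> Pow I. \<bar>\<Sum>k\<in>I. (if k \<in> A then - h (b k) else h (b k))\<bar> \<le> L}"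
      using h(2) by (intro card_mono fin Collect_mono) (auto simp: hs[symmetric] intro: order_trans)
    then have "real (card {A \<in> Pow I. norm (\<Sum>k\<in>I. (if k \<in> A then - b k else b k)) \<le> L}) \<le>
       real (card {A \<in> Pow I. \<bar>\<Sum>k\<in>I. (if k \<in> A then - h (b k) else h (b k))\<bar> \<le> L})" by simp
    also have "\<dots> \<le> 2 ^ card I / sqrt (real (card K))"
      by (rule littlewood_offord_real[OF I K(1) Kne K(3)])
    also have "\<dots> \<le> 2 ^ card I / (sqrt (real (card J)) / sqrt 2)"
    proof (rule divide_left_mono)
      have "real (card J) \<le> 2 * real (card K)" using K(2) by linarith
      then have "sqrt (real (card J)) \<le> sqrt (2 * real (card K))" by (rule real_sqrt_le_mono)
      then show "sqrt (real (card J)) / sqrt 2 \<le> sqrt (real (card K))" by (simp add: real_sqrt_mult field_simps)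
      show "0 < sqrt (real (card K)) * (sqrt (real (card J)) / sqrt 2)"
        using K(2) cJ0 by auto
    qed simp
    finally show ?thesis by simp
  qed
  show ?thesis
  proof (cases "card J \<le> 2 * card J1")
    case True
    show ?thesis
      by (rule *[of J1 Re]) (use True J in \<open>auto simp: J1_def abs_Re_le_cmod linear_conv_bounded_linear bounded_linear_Re\<close>)
  next
    case False
    show ?thesis
      by (rule *[of J2 Im]) (use False cJ J in \<open>auto simp: J2_def abs_Im_le_cmod linear_conv_bounded_linear bounded_linear_Im\<close>)
  qed
qed

section \<open>Symmetrisation of i.i.d. sums by exchanging pairs\<close>

locale iid_sequence = prob_space +
  fixes \<xi> :: "nat \<Rightarrow> 'a \<Rightarrow> complex"
  assumes indep: "indep_vars (\<lambda>_. borel) \<xi> UNIV"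
    and ident: "\<And>k. distr M borel (\<xi> k) = distr M borel (\<xi> 0)"
begin

lemma rv [measurable]: "\<xi> k \<in> borel_measurable M"
  using indep by (auto simp: indep_vars_def)

text \<open>Strong exchangeability, through the product form of the joint law. The injections used
  later are the exchange of pairs, the even and the odd indices, and a shift.\<close>

lemma law_reindex:
  fixes f :: "nat \<Rightarrow> nat"
  assumes f: "inj f"
  shows "distr M (PiM UNIV (\<lambda>_. borel)) (\<lambda>\<omega> k. \<xi> (f k) \<omega>) = PiM UNIV (\<lambda>_. distr M borel (\<xi> 0))"
proof -
  let ?D = "distr M borel (\<xi> 0)"
  have pD: "prob_space ?D" by (rule prob_space_distr) simp
  have s: "sets (PiM UNIV (\<lambda>_. borel :: complex measure)) = sets (PiM UNIV (\<lambda>_::nat. ?D))"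
    by (intro sets_PiM_cong) auto
  have e: "(\<lambda>k. distr M borel (\<xi> k)) = (\<lambda>_. ?D)" by (rule ext) (rule ident)
  have base: "distr M (PiM UNIV (\<lambda>_. borel)) (\<lambda>\<omega> k. \<xi> k \<omega>) = PiM UNIV (\<lambda>_::nat. ?D)"
    using indep e by (subst (asm) indep_vars_iff_distr_eq_PiM) (auto simp: restrict_def)
  have "distr M (PiM UNIV (\<lambda>_. borel)) (\<lambda>\<omega> k. \<xi> (f k) \<omega>) =
     distr (distr M (PiM UNIV (\<lambda>_. borel)) (\<lambda>\<omega> k. \<xi> k \<omega>)) (PiM UNIV (\<lambda>_. borel)) (\<lambda>\<omega> n. \<omega> (f n))"
    by (subst distr_distr) (auto simp: comp_def intro!: measurable_PiM_single')
  also have "\<dots> = distr (PiM UNIV (\<lambda>_. ?D)) (PiM UNIV (\<lambda>_. ?D)) (\<lambda>\<omega> n. \<omega> (f n))"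
    unfolding base by (rule distr_cong) (auto simp: s)
  also have "\<dots> = PiM UNIV (\<lambda>_. ?D)"
    using distr_PiM_reindex[of UNIV "\<lambda>_. ?D" f UNIV] pD f by (simp add: restrict_def)
  finally show ?thesis .
qed

lemma prob_reindex:
  fixes f :: "nat \<Rightarrow> nat"
  assumes f: "inj f" and [measurable]: "Measurable.pred (PiM UNIV (\<lambda>_. borel)) Q"
  shows "prob {\<omega>\<in>space M. Q (\<lambda>k. \<xi> (f k) \<omega>)} = prob {\<omega>\<in>space M. Q (\<lambda>k. \<xi> k \<omega>)}"
proof -
  have *: "prob {\<omega>\<in>space M. Q (\<lambda>k. \<xi> (g k) \<omega>)} = measure (PiM UNIV (\<lambda>_. distr M borel (\<xi> 0))) {x. Q x}"
    if g: "inj g" for g :: "nat \<Rightarrow> nat"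
  proof -
    have "{x. Q x} \<in> sets (PiM UNIV (\<lambda>_. borel))"
      using assms(2) by (simp add: pred_def space_PiM PiE_UNIV_domain)
    then have "measure (distr M (PiM UNIV (\<lambda>_. borel)) (\<lambda>\<omega> k. \<xi> (g k) \<omega>)) {x. Q x} =
        prob ((\<lambda>\<omega> k. \<xi> (g k) \<omega>) -` {x. Q x} \<inter> space M)"
      by (intro measure_distr) (auto intro!: measurable_PiM_single')
    then show ?thesis unfolding law_reindex[OF g] by (simp add: vimage_def Int_def conj_commute)
  qed
  show ?thesis using *[OF f] *[of "\<lambda>k. k"] by simp
qed

text \<open>Exchanging the two members of pair \<open>k\<close> flips the sign of
  \<open>\<xi> (2 * k) - \<xi> (2 * k + 1)\<close>. Random signs are thus obtained from the sequence
  itself, without enlarging the probability space.\<close>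

definition swap_pairs :: "nat set \<Rightarrow> nat \<Rightarrow> nat" where
  "swap_pairs A j = (if j div 2 \<in> A then (if even j then j + 1 else j - 1) else j)"

lemma swap_pairs_even_odd:
  "swap_pairs A (2 * k) = (if k \<in> A then 2 * k + 1 else 2 * k)"
  "swap_pairs A (2 * k + 1) = (if k \<in> A then 2 * k else 2 * k + 1)"
  by (auto simp: swap_pairs_def)

lemma inj_swap_pairs: "inj (swap_pairs A)"
proof (rule inj_on_inverseI[where g = "swap_pairs A"])
  fix j :: nat
  obtain k where "j = 2 * k \<or> j = 2 * k + 1" by (meson evenE oddE)
  then show "swap_pairs A (swap_pairs A j) = j" using swap_pairs_even_odd[of A k] by auto
qed

text \<open>The probability is the same for every sign pattern, hence equals the average over all
  patterns. Inside the expectation the differences are fixed and Littlewood-Offord bounds the number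
  of bad patterns, provided at least \<open>m\<close> differences have modulus
  \<open>\<delta>\<close> or more; the exceptional event is paid for separately.\<close>

lemma symmetrized_small_ball:
  assumes I: "finite I" and L: "L \<ge> 0" "\<delta> > 0" and a: "\<And>k. k \<in> I \<Longrightarrow> norm (a k) * \<delta> > 2 * L" and m: "m > 0"
  shows "prob {\<omega>\<in>space M. norm (\<Sum>k\<in>I. (\<xi> (2*k) \<omega> - \<xi> (2*k+1) \<omega>) * a k) \<le> L} \<le>
    sqrt 2 / sqrt m + prob {\<omega>\<in>space M. real (card {k\<in>I. norm (\<xi> (2*k) \<omega> - \<xi> (2*k+1) \<omega>) \<ge> \<delta>}) < m}"
proof -
  define d where "d \<omega> k = (\<xi> (2*k) \<omega> - \<xi> (2*k+1) \<omega>) * a k" for \<omega> k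
  define S where "S A \<omega> = (\<Sum>k\<in>I. if k \<in> A then - d \<omega> k else d \<omega> k)" for A \<omega>
  define N where "N \<omega> = real (card {k\<in>I. norm (\<xi> (2*k) \<omega> - \<xi> (2*k+1) \<omega>) \<ge> \<delta>})" for \<omega>
  define p where "p = prob {\<omega>\<in>space M. norm (\<Sum>k\<in>I. d \<omega> k) \<le> L}"
  have [measurable]: "S A \<in> borel_measurable M" for A
    unfolding S_def[abs_def] d_def by measurable
  have N_eq: "N \<omega> = (\<Sum>k\<in>I. if norm (\<xi> (2*k) \<omega> - \<xi> (2*k+1) \<omega>) \<ge> \<delta> then 1 else 0)" for \<omega>
    unfolding N_def using I by (simp add: sum.If_cases Int_def)
  have [measurable]: "N \<in> borel_measurable M" unfolding N_eq[abs_def] by measurable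
  have iN: "integrable M (indicator {\<omega>\<in>space M. N \<omega> < m} :: 'a \<Rightarrow> real)"
    by (rule integrable_real_indicator) (auto simp: less_top[symmetric])
  have iS: "integrable M (indicator {\<omega>\<in>space M. norm (S A \<omega>) \<le> L} :: 'a \<Rightarrow> real)" for A
    by (rule integrable_real_indicator) (auto simp: less_top[symmetric])
  have pA: "p = prob {\<omega>\<in>space M. norm (S A \<omega>) \<le> L}" for A
  proof -
    let ?Q = "\<lambda>x. norm (\<Sum>k\<in>I. (x (2*k) - x (2*k+1)) * a k) \<le> L"
    have "Measurable.pred (PiM UNIV (\<lambda>_. borel :: complex measure)) ?Q" by measurable
    from prob_reindex[OF inj_swap_pairs[of A] this]
    have "prob {\<omega>\<in>space M. ?Q (\<lambda>k. \<xi> (swap_pairs A k) \<omega>)} = p"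
      by (simp add: p_def d_def)
    moreover have "(\<Sum>k\<in>I. (\<xi> (swap_pairs A (2*k)) \<omega> - \<xi> (swap_pairs A (2*k+1)) \<omega>) * a k) = S A \<omega>" for \<omega>
      unfolding S_def d_def swap_pairs_even_odd by (intro sum.cong) (auto simp: algebra_simps)
    ultimately show ?thesis by simp
  qed
  have "2 ^ card I * p = (\<Sum>A\<in>Pow I. prob {\<omega>\<in>space M. norm (S A \<omega>) \<le> L})"
    using pA I by (simp add: card_Pow)
  also have "\<dots> = (\<Sum>A\<in>Pow I. expectation (indicator {\<omega>\<in>space M. norm (S A \<omega>) \<le> L}))"
    by simp
  also have "\<dots> = expectation (\<lambda>\<omega>. \<Sum>A\<in>Pow I. indicator {\<omega>\<in>space M. norm (S A \<omega>) \<le> L} \<omega>)"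
    by (rule Bochner_Integration.integral_sum[symmetric]) (rule iS)
  also have "\<dots> \<le> expectation (\<lambda>\<omega>. 2 ^ card I * (sqrt 2 / sqrt m) + 2 ^ card I * indicator {\<omega>\<in>space M. N \<omega> < m} \<omega>)"
  proof (rule integral_mono)
    fix \<omega> assume \<omega>: "\<omega> \<in> space M"
    have "(\<Sum>A\<in>Pow I. indicator {\<omega>\<in>space M. norm (S A \<omega>) \<le> L} \<omega>) = real (card {A\<in>Pow I. norm (S A \<omega>) \<le> L})"
      using I \<omega> by (simp add: indicator_def sum.If_cases Int_def of_bool_def)
    also have "\<dots> \<le> 2 ^ card I * (sqrt 2 / sqrt m) + 2 ^ card I * indicator {\<omega>\<in>space M. N \<omega> < m} \<omega>"
    proof (cases "N \<omega> < m")
      case True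
      have "card {A\<in>Pow I. norm (S A \<omega>) \<le> L} \<le> card (Pow I)" using I by (intro card_mono) auto
      then have "real (card {A\<in>Pow I. norm (S A \<omega>) \<le> L}) \<le> 2 ^ card I"
        using card_Pow[OF I] by (metis of_nat_le_iff of_nat_numeral of_nat_power)
      moreover have "0 \<le> 2 ^ card I * (sqrt 2 / sqrt m)" using m by simp
      moreover have i1: "indicator {\<omega>\<in>space M. N \<omega> < m} \<omega> = (1::real)" using True \<omega> by simp
      ultimately show ?thesis unfolding i1 by linarith
    next
      case False
      let ?J = "{k\<in>I. norm (\<xi> (2*k) \<omega> - \<xi> (2*k+1) \<omega>) \<ge> \<delta>}"
      have J: "real (card ?J) \<ge> m" using False by (simp add: N_def)
      have "real (card {A\<in>Pow I. norm (S A \<omega>) \<le> L}) \<le> 2 ^ card I * sqrt 2 / sqrt (real (card ?J))"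
        unfolding S_def
      proof (rule littlewood_offord_complex[OF I])
        show "?J \<noteq> {}" using J m by (metis card.empty not_less of_nat_0)
        fix k assume k: "k \<in> ?J"
        have "2 * L < norm (a k) * \<delta>" using a k by simp
        also have "\<dots> \<le> norm (a k) * norm (\<xi> (2*k) \<omega> - \<xi> (2*k+1) \<omega>)" using k by (intro mult_left_mono) auto
        finally show "2 * L < norm (d \<omega> k)" by (simp add: d_def norm_mult mult.commute)
      qed (use L in auto)
      also have "\<dots> \<le> 2 ^ card I * sqrt 2 / sqrt m" using J m by (intro divide_left_mono) auto
      finally show ?thesis using False by simp
    qed
    finally show "(\<Sum>A\<in>Pow I. indicator {\<omega>\<in>space M. norm (S A \<omega>) \<le> L} \<omega>) \<le>
      2 ^ card I * (sqrt 2 / sqrt m) + 2 ^ card I * indicator {\<omega>\<in>space M. N \<omega> < m} \<omega>" .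
  qed (auto intro!: Bochner_Integration.integrable_sum Bochner_Integration.integrable_add integrable_mult_right iN iS)
  also have "\<dots> = 2 ^ card I * (sqrt 2 / sqrt m + prob {\<omega>\<in>space M. N \<omega> < m})"
    using iN by (subst Bochner_Integration.integral_add) (auto simp: prob_space distrib_left)
  finally have "p \<le> sqrt 2 / sqrt m + prob {\<omega>\<in>space M. N \<omega> < m}" by simp
  then show ?thesis unfolding p_def N_def d_def .
qed

text \<open>The even and the odd subsequence are independent copies. If both sums lie within
  \<open>L\<close> of \<open>- x\<close>, their difference has modulus at most \<open>2 * L\<close>;
  the unknown shift disappears at the price of squaring the probability.\<close>

lemma small_ball_symmetrize:
  assumes I: "finite I"
  shows "(prob {\<omega>\<in>space M. norm (x + (\<Sum>k\<in>I. \<xi> k \<omega> * a k)) \<le> L})\<^sup>2 \<le>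
    prob {\<omega>\<in>space M. norm (\<Sum>k\<in>I. (\<xi> (2*k) \<omega> - \<xi> (2*k+1) \<omega>) * a k) \<le> 2 * L}"
proof -
  let ?Q = "\<lambda>y. norm (x + (\<Sum>k\<in>I. y k * a k)) \<le> L"
  have Q: "Measurable.pred (PiM UNIV (\<lambda>_. borel :: complex measure)) ?Q" by measurable
  let ?E = "{\<omega>\<in>space M. ?Q (\<lambda>k. \<xi> (2 * k) \<omega>)}" and ?O = "{\<omega>\<in>space M. ?Q (\<lambda>k. \<xi> (2 * k + 1) \<omega>)}"
  have E: "prob ?E = prob {\<omega>\<in>space M. ?Q (\<lambda>k. \<xi> k \<omega>)}"
    by (rule prob_reindex[OF _ Q]) (auto simp: inj_def)
  have O: "prob ?O = prob {\<omega>\<in>space M. ?Q (\<lambda>k. \<xi> k \<omega>)}"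
    by (rule prob_reindex[OF _ Q]) (auto simp: inj_def)
  let ?A = "(\<lambda>k. 2 * k) ` I" and ?B = "(\<lambda>k. 2 * k + 1) ` I"
  have ind: "indep_var (PiM ?A (\<lambda>_. borel)) (\<lambda>\<omega>. restrict (\<lambda>i. \<xi> i \<omega>) ?A) (PiM ?B (\<lambda>_. borel)) (\<lambda>\<omega>. restrict (\<lambda>i. \<xi> i \<omega>) ?B)"
    by (rule indep_var_restrict[OF indep]) (auto, presburger)
  have "indep_var borel ((\<lambda>y. x + (\<Sum>k\<in>I. y (2 * k) * a k)) \<circ> (\<lambda>\<omega>. restrict (\<lambda>i. \<xi> i \<omega>) ?A))
      borel ((\<lambda>y. x + (\<Sum>k\<in>I. y (2 * k + 1) * a k)) \<circ> (\<lambda>\<omega>. restrict (\<lambda>i. \<xi> i \<omega>) ?B))"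
    by (rule indep_var_compose[OF ind])
       (auto intro!: borel_measurable_add borel_measurable_sum borel_measurable_times measurable_component_singleton)
  also have "(\<lambda>y. x + (\<Sum>k\<in>I. y (2 * k) * a k)) \<circ> (\<lambda>\<omega>. restrict (\<lambda>i. \<xi> i \<omega>) ?A) = (\<lambda>\<omega>. x + (\<Sum>k\<in>I. \<xi> (2 * k) \<omega> * a k))"
    by (auto simp: fun_eq_iff intro!: sum.cong)
  also have "(\<lambda>y. x + (\<Sum>k\<in>I. y (2 * k + 1) * a k)) \<circ> (\<lambda>\<omega>. restrict (\<lambda>i. \<xi> i \<omega>) ?B) = (\<lambda>\<omega>. x + (\<Sum>k\<in>I. \<xi> (2 * k + 1) \<omega> * a k))"
    by (auto simp: fun_eq_iff intro!: sum.cong)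
  finally have ind2: "indep_var borel (\<lambda>\<omega>. x + (\<Sum>k\<in>I. \<xi> (2 * k) \<omega> * a k)) borel (\<lambda>\<omega>. x + (\<Sum>k\<in>I. \<xi> (2 * k + 1) \<omega> * a k))" .
  have "prob ?E * prob ?O = prob ((\<lambda>\<omega>. (x + (\<Sum>k\<in>I. \<xi> (2 * k) \<omega> * a k), x + (\<Sum>k\<in>I. \<xi> (2 * k + 1) \<omega> * a k))) -` (cball 0 L \<times> cball 0 L) \<inter> space M)"
    using indep_varD[OF ind2, of "cball 0 L" "cball 0 L"] by (simp add: vimage_def Int_def conj_commute)
  also have "\<dots> \<le> prob {\<omega>\<in>space M. norm (\<Sum>k\<in>I. (\<xi> (2*k) \<omega> - \<xi> (2*k+1) \<omega>) * a k) \<le> 2 * L}"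
  proof (rule finite_measure_mono)
    show "(\<lambda>\<omega>. (x + (\<Sum>k\<in>I. \<xi> (2 * k) \<omega> * a k), x + (\<Sum>k\<in>I. \<xi> (2 * k + 1) \<omega> * a k))) -` (cball 0 L \<times> cball 0 L) \<inter> space M
      \<subseteq> {\<omega>\<in>space M. norm (\<Sum>k\<in>I. (\<xi> (2*k) \<omega> - \<xi> (2*k+1) \<omega>) * a k) \<le> 2 * L}"
    proof clarsimp
      fix \<omega> assume "norm (x + (\<Sum>k\<in>I. \<xi> (2 * k) \<omega> * a k)) \<le> L" "norm (x + (\<Sum>k\<in>I. \<xi> (Suc (2 * k)) \<omega> * a k)) \<le> L"
      note le = this
      have eq: "(\<Sum>k\<in>I. (\<xi> (2*k) \<omega> - \<xi> (Suc (2*k)) \<omega>) * a k) =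
        (x + (\<Sum>k\<in>I. \<xi> (2 * k) \<omega> * a k)) - (x + (\<Sum>k\<in>I. \<xi> (Suc (2 * k)) \<omega> * a k))"
        by (simp add: left_diff_distrib sum_subtractf)
      show "norm (\<Sum>k\<in>I. (\<xi> (2*k) \<omega> - \<xi> (Suc (2*k)) \<omega>) * a k) \<le> 2 * L"
        unfolding eq using le norm_triangle_ineq4[of "x + (\<Sum>k\<in>I. \<xi> (2 * k) \<omega> * a k)" "x + (\<Sum>k\<in>I. \<xi> (Suc (2 * k)) \<omega> * a k)"] by linarith
    qed
  qed measurable
  finally show ?thesis unfolding E O by (simp add: power2_eq_square)
qed

end

section \<open>Small-ball bounds for nondegenerate coefficients\<close>

context iid_sequence
begin

definition gap_prob :: "real \<Rightarrow> real" where
  "gap_prob \<delta> = prob {\<omega>\<in>space M. norm (\<xi> 0 \<omega> - \<xi> 1 \<omega>) \<ge> \<delta>}"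

lemma gap_prob_pair: "prob {\<omega>\<in>space M. norm (\<xi> (2*k) \<omega> - \<xi> (2*k+1) \<omega>) \<ge> \<delta>} = gap_prob \<delta>"
proof -
  have "Measurable.pred (PiM UNIV (\<lambda>_. borel :: complex measure)) (\<lambda>x::nat \<Rightarrow> complex. norm (x 0 - x 1) \<ge> \<delta>)"
    by measurable
  from prob_reindex[OF _ this, of "\<lambda>j. 2 * k + j"] show ?thesis
    by (simp add: gap_prob_def inj_def)
qed

text \<open>If no gap had positive probability, two independent copies would agree almost surely; by
  Fubini some fixed point would then almost surely equal one of them, and the law would be a point
  mass.\<close>

lemma nondegenerate_gap:
  assumes nd: "\<not> (\<exists>c. AE \<omega> in M. \<xi> 0 \<omega> = c)"
  obtains \<delta> where "\<delta> > 0" "gap_prob \<delta> > 0"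
proof (rule ccontr)
  note found = that
  assume "\<not> thesis"
  then have "\<not> gap_prob \<delta> > 0" if "\<delta> > 0" for \<delta> using found that by blast
  then have z: "gap_prob \<delta> = 0" if "\<delta> > 0" for \<delta>
    using that measure_nonneg[of M "{\<omega>\<in>space M. norm (\<xi> 0 \<omega> - \<xi> 1 \<omega>) \<ge> \<delta>}"]
    unfolding gap_prob_def by (simp add: order.antisym not_less)
  have "AE \<omega> in M. \<forall>n::nat. \<not> norm (\<xi> 0 \<omega> - \<xi> 1 \<omega>) \<ge> 1 / (real n + 1)"
  proof (subst AE_all_countable, rule allI)
    fix n :: nat
    show "AE \<omega> in M. \<not> norm (\<xi> 0 \<omega> - \<xi> 1 \<omega>) \<ge> 1 / (real n + 1)"
      using z[of "1 / (real n + 1)"] unfolding gap_prob_def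
      by (simp add: prob_Collect_eq_0)
  qed
  then have AEeq: "AE \<omega> in M. \<xi> 0 \<omega> = \<xi> 1 \<omega>"
  proof eventually_elim
    case (elim \<omega>)
    show ?case
    proof (rule ccontr)
      assume "\<xi> 0 \<omega> \<noteq> \<xi> 1 \<omega>"
      then have "norm (\<xi> 0 \<omega> - \<xi> 1 \<omega>) > 0" by simp
      then obtain n :: nat where "1 / (real n + 1) < norm (\<xi> 0 \<omega> - \<xi> 1 \<omega>)"
        using nat_approx_posE by (metis of_nat_Suc add.commute)
      then show False using elim by (meson less_imp_le)
    qed
  qed
  let ?D = "distr M borel (\<xi> 0)"
  interpret D: prob_space ?D by (rule prob_space_distr) simp
  interpret DD: pair_prob_space ?D ?D ..
  have ind: "indep_var borel (\<xi> 0) borel (\<xi> 1)"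
  proof -
    have "indep_vars (\<lambda>_. borel) (\<lambda>b. \<xi> (case_bool 0 1 b)) UNIV"
    proof -
      have "indep_vars (\<lambda>_. borel) (\<lambda>b. (\<lambda>y. y (case_bool 0 1 b)) \<circ> (\<lambda>\<omega>. restrict (\<lambda>i. \<xi> i \<omega>) {case_bool 0 1 b})) (UNIV :: bool set)"
        by (rule indep_vars_compose[OF indep_vars_restrict[OF indep]])
           (auto simp: disjoint_family_on_def split: bool.splits intro!: measurable_component_singleton)
      then show ?thesis by (simp add: comp_def)
    qed
    moreover have "(\<lambda>b. \<xi> (case_bool 0 1 b)) = case_bool (\<xi> 0) (\<xi> 1)" "(\<lambda>_. borel) = case_bool borel (borel :: complex measure)"
      by (auto simp: fun_eq_iff split: bool.splits)
    ultimately show ?thesis unfolding indep_var_def by simp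
  qed
  have "distr M (borel \<Otimes>\<^sub>M borel) (\<lambda>\<omega>. (\<xi> 0 \<omega>, \<xi> 1 \<omega>)) = ?D \<Otimes>\<^sub>M ?D"
    using ind ident[of 1] unfolding indep_var_distribution_eq by simp
  moreover have "AE p in distr M (borel \<Otimes>\<^sub>M borel) (\<lambda>\<omega>. (\<xi> 0 \<omega>, \<xi> 1 \<omega>)). fst p = snd p"
    using AEeq by (subst AE_distr_iff) auto
  ultimately have "AE p in ?D \<Otimes>\<^sub>M ?D. fst p = snd p" by (simp only:)
  then have "AE x in ?D. AE y in ?D. x = y"
    using DD.AE_pair[of "\<lambda>p. fst p = snd p"] by simp
  then obtain x where "AE y in ?D. x = y"
    using eventually_happens'[OF D.ae_filter_bot] by blast
  then have "AE \<omega> in M. x = \<xi> 0 \<omega>" by (subst (asm) AE_distr_iff) auto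
  then have "AE \<omega> in M. \<xi> 0 \<omega> = x" by eventually_elim simp
  then show False using nd by blast
qed

text \<open>The pairs are disjoint, so the indicators are independent with mean
  \<open>gap_prob \<delta>\<close>. Hoeffding's inequality is applied at half of the expected
  number.\<close>

lemma few_gaps_prob:
  assumes I: "finite I" "I \<noteq> {}"
  shows "prob {\<omega>\<in>space M. real (card {k\<in>I. norm (\<xi> (2*k) \<omega> - \<xi> (2*k+1) \<omega>) \<ge> \<delta>}) < real (card I) * gap_prob \<delta> / 2}
    \<le> exp (- (real (card I) * (gap_prob \<delta>)\<^sup>2 / 2))"
proof -
  define X where "X k \<omega> = (if norm (\<xi> (2*k) \<omega> - \<xi> (2*k+1) \<omega>) \<ge> \<delta> then 1 else 0 :: real)" for k \<omega>
  have indX: "indep_vars (\<lambda>_. borel) X I"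
  proof -
    have "indep_vars (\<lambda>j. PiM {2*j, 2*j+1} (\<lambda>_. borel)) (\<lambda>j \<omega>. restrict (\<lambda>i. \<xi> i \<omega>) {2*j, 2*j+1}) I"
      by (rule indep_vars_restrict[OF indep]) (auto simp: disjoint_family_on_def)
    from indep_vars_compose2[OF this, of "\<lambda>j y. if norm (y (2*j) - y (2*j+1)) \<ge> \<delta> then 1 else 0 :: real" "\<lambda>_. borel"]
    have "indep_vars (\<lambda>_. borel) (\<lambda>j \<omega>. if norm (restrict (\<lambda>i. \<xi> i \<omega>) {2*j, 2*j+1} (2*j) - restrict (\<lambda>i. \<xi> i \<omega>) {2*j, 2*j+1} (2*j+1)) \<ge> \<delta> then 1 else 0 :: real) I"
      by measurable
    then show ?thesis by (simp add: X_def[abs_def])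
  qed
  interpret H: Hoeffding_ineq M I X "\<lambda>_. 0" "\<lambda>_. 1" "\<Sum>i\<in>I. expectation (X i)"
    by unfold_locales (use I indX in \<open>auto simp: X_def\<close>)
  have EX: "expectation (X k) = gap_prob \<delta>" for k
  proof -
    have "expectation (X k) = expectation (indicator {\<omega>\<in>space M. norm (\<xi> (2*k) \<omega> - \<xi> (2*k+1) \<omega>) \<ge> \<delta>})"
      by (intro Bochner_Integration.integral_cong) (auto simp: X_def indicator_def)
    then show ?thesis using gap_prob_pair[where k = k and \<delta> = \<delta>] by simp
  qed
  have p0: "gap_prob \<delta> \<ge> 0" by (simp add: gap_prob_def)
  have N: "real (card {k\<in>I. norm (\<xi> (2*k) \<omega> - \<xi> (2*k+1) \<omega>) \<ge> \<delta>}) = (\<Sum>k\<in>I. X k \<omega>)" for \<omega>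
    using I by (simp add: X_def sum.If_cases Int_def)
  have c: "card I > 0" using I by (simp add: card_gt_0_iff)
  have "prob {\<omega>\<in>space M. (\<Sum>k\<in>I. X k \<omega>) < real (card I) * gap_prob \<delta> / 2} \<le>
    prob {\<omega>\<in>space M. (\<Sum>k\<in>I. X k \<omega>) \<le> (\<Sum>i\<in>I. expectation (X i)) - real (card I) * gap_prob \<delta> / 2}"
    by (rule finite_measure_mono) (auto simp: EX intro!: borel_measurable_sum)
  also have "\<dots> \<le> exp (-2 * (real (card I) * gap_prob \<delta> / 2)\<^sup>2 / (\<Sum>i\<in>I. (1 - 0)\<^sup>2))"
    by (rule H.Hoeffding_ineq_le) (use p0 c in auto)
  also have "-2 * (real (card I) * gap_prob \<delta> / 2)\<^sup>2 / (\<Sum>i\<in>I. (1 - 0)\<^sup>2) = - (real (card I) * (gap_prob \<delta>)\<^sup>2 / 2)"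
    using c by (simp add: power2_eq_square field_simps)
  finally show ?thesis unfolding N .
qed

text \<open>Symmetrisation doubles the radius to \<open>2 * L\<close> and the anti-concentration
  step asks for twice that, whence \<open>4 * L\<close>. Half of the expected number of gaps is
  taken as \<open>m\<close>; each of the two error terms is then brought to the form
  \<open>2 / p / sqrt n\<close>.\<close>

lemma small_ball_finite_sum:
  assumes p: "gap_prob \<delta> > 0" and \<delta>: "\<delta> > 0" and I: "finite I" "I \<noteq> {}" and L: "L \<ge> 0"
    and a: "\<And>k. k \<in> I \<Longrightarrow> norm (a k) * \<delta> > 4 * L"
  shows "(prob {\<omega>\<in>space M. norm (x + (\<Sum>k\<in>I. \<xi> k \<omega> * a k)) \<le> L})\<^sup>2 \<le> 4 / gap_prob \<delta> / sqrt (real (card I))"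
proof -
  let ?p = "gap_prob \<delta>" and ?n = "real (card I)"
  have c: "?n > 0" using I by (simp add: card_gt_0_iff)
  have p1: "?p \<le> 1" by (simp add: gap_prob_def)
  have "(prob {\<omega>\<in>space M. norm (x + (\<Sum>k\<in>I. \<xi> k \<omega> * a k)) \<le> L})\<^sup>2 \<le>
    prob {\<omega>\<in>space M. norm (\<Sum>k\<in>I. (\<xi> (2*k) \<omega> - \<xi> (2*k+1) \<omega>) * a k) \<le> 2 * L}"
    by (rule small_ball_symmetrize[OF I(1)])
  also have "\<dots> \<le> sqrt 2 / sqrt (?n * ?p / 2) +
     prob {\<omega>\<in>space M. real (card {k\<in>I. norm (\<xi> (2*k) \<omega> - \<xi> (2*k+1) \<omega>) \<ge> \<delta>}) < ?n * ?p / 2}"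
    by (rule symmetrized_small_ball[OF I(1)]) (use L \<delta> a c p in auto)
  also have "\<dots> \<le> sqrt 2 / sqrt (?n * ?p / 2) + exp (- (?n * ?p\<^sup>2 / 2))"
    by (intro add_left_mono few_gaps_prob I)
  also have "sqrt 2 / sqrt (?n * ?p / 2) = 2 / sqrt ?p / sqrt ?n"
    using p c by (simp add: real_sqrt_mult real_sqrt_divide field_simps)
  also have "2 / sqrt ?p / sqrt ?n \<le> 2 / ?p / sqrt ?n"
  proof -
    have "?p\<^sup>2 \<le> ?p" using p p1 by (simp add: power2_eq_square mult_left_le)
    then have "?p \<le> sqrt ?p" by (rule real_le_rsqrt)
    then show ?thesis using p c by (intro divide_right_mono divide_left_mono) auto
  qed
  \<comment> \<open>The exponential is weakened through
    \<open>sqrt y \<le> 1 + y \<le> exp y\<close> only to match the other error term.\<close>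
  also have "exp (- (?n * ?p\<^sup>2 / 2)) \<le> 2 / ?p / sqrt ?n"
  proof -
    let ?y = "?n * ?p\<^sup>2 / 2"
    have y: "?y > 0" using p c by simp
    have "sqrt ?y \<le> 1 + ?y"
    proof (rule real_le_lsqrt)
      show "?y \<le> (1 + ?y)\<^sup>2" using y zero_le_power2[of ?y] by (simp add: power2_sum)
    qed (use y in auto)
    also have "\<dots> \<le> exp ?y" by (rule exp_ge_add_one_self)
    finally have "exp (- ?y) \<le> 1 / sqrt ?y" using y by (simp add: exp_minus field_simps)
    also have "\<dots> = sqrt 2 / ?p / sqrt ?n" using p by (simp add: real_sqrt_mult real_sqrt_divide)
    also have "\<dots> \<le> 2 / ?p / sqrt ?n"
      using p sqrt2_less_2 by (intro divide_right_mono) auto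
    finally show ?thesis .
  qed
  finally show ?thesis by (simp add: add_divide_distrib[symmetric] del: divide_divide_eq_left)
qed

text \<open>Conditioning on the coefficients outside \<open>I\<close>: the bound for finite sums is
  uniform in the shift \<open>x\<close>, so it survives integration over the law of the independent
  remainder.\<close>

lemma small_ball_indep_sum:
  assumes p: "gap_prob \<delta> > 0" and \<delta>: "\<delta> > 0" and I: "finite I" "I \<noteq> {}" and L: "L \<ge> 0"
    and a: "\<And>k. k \<in> I \<Longrightarrow> norm (a k) * \<delta> > 4 * L"
    and g: "g \<in> borel_measurable (PiM (- I) (\<lambda>_. borel))"
  shows "(prob {\<omega>\<in>space M. norm (g (restrict (\<lambda>k. \<xi> k \<omega>) (- I)) + (\<Sum>k\<in>I. \<xi> k \<omega> * a k)) \<le> L})\<^sup>2 \<le> 4 / gap_prob \<delta> / sqrt (real (card I))"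
proof -
  define Y where "Y \<omega> = g (restrict (\<lambda>k. \<xi> k \<omega>) (- I))" for \<omega>
  define S where "S \<omega> = (\<Sum>k\<in>I. \<xi> k \<omega> * a k)" for \<omega>
  let ?b = "sqrt (4 / gap_prob \<delta> / sqrt (real (card I)))"
  have "indep_var (PiM (- I) (\<lambda>_. borel)) (\<lambda>\<omega>. restrict (\<lambda>i. \<xi> i \<omega>) (- I)) (PiM I (\<lambda>_. borel)) (\<lambda>\<omega>. restrict (\<lambda>i. \<xi> i \<omega>) I)"
    by (rule indep_var_restrict[OF indep]) auto
  from indep_var_compose[OF this g, of "\<lambda>y. \<Sum>k\<in>I. y k * a k" borel]
  have "indep_var borel (g \<circ> (\<lambda>\<omega>. restrict (\<lambda>i. \<xi> i \<omega>) (- I))) borel ((\<lambda>y. \<Sum>k\<in>I. y k * a k) \<circ> (\<lambda>\<omega>. restrict (\<lambda>i. \<xi> i \<omega>) I))"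
    by (auto intro!: borel_measurable_sum borel_measurable_times measurable_component_singleton)
  moreover have "(\<lambda>y. \<Sum>k\<in>I. y k * a k) \<circ> (\<lambda>\<omega>. restrict (\<lambda>i. \<xi> i \<omega>) I) = S"
    by (auto simp: fun_eq_iff S_def intro!: sum.cong)
  moreover have "g \<circ> (\<lambda>\<omega>. restrict (\<lambda>i. \<xi> i \<omega>) (- I)) = Y" by (auto simp: fun_eq_iff Y_def)
  ultimately have ind: "indep_var borel Y borel S" by simp
  then have [measurable]: "Y \<in> borel_measurable M" "S \<in> borel_measurable M"
    by (auto dest: indep_var_rv1 indep_var_rv2)
  interpret DY: prob_space "distr M borel Y" by (rule prob_space_distr) simp
  interpret DS: prob_space "distr M borel S" by (rule prob_space_distr) simp
  interpret PP: pair_prob_space "distr M borel Y" "distr M borel S" ..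
  let ?E = "{p. norm (fst p + snd p) \<le> L} :: (complex \<times> complex) set"
  have E[measurable]: "?E \<in> sets (borel \<Otimes>\<^sub>M borel)" 
  proof -
    have "closed ?E" by (intro closed_Collect_le continuous_intros)
    then show ?thesis unfolding borel_prod by (rule borel_closed)
  qed
  have b: "prob {\<omega>\<in>space M. norm (x + S \<omega>) \<le> L} \<le> ?b" for x
    using small_ball_finite_sum[OF p \<delta> I L a, where x = x] unfolding S_def by (intro real_le_rsqrt) auto
  have "emeasure M {\<omega>\<in>space M. norm (Y \<omega> + S \<omega>) \<le> L} = emeasure (distr M (borel \<Otimes>\<^sub>M borel) (\<lambda>\<omega>. (Y \<omega>, S \<omega>))) ?E"
    by (subst emeasure_distr) (auto intro!: arg_cong[where f = "emeasure M"])
  also have "\<dots> = emeasure (distr M borel Y \<Otimes>\<^sub>M distr M borel S) ?E"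
    using ind unfolding indep_var_distribution_eq by simp
  also have "\<dots> = (\<integral>\<^sup>+x. emeasure (distr M borel S) (Pair x -` ?E) \<partial>distr M borel Y)"
    by (rule DS.emeasure_pair_measure_alt) (simp cong: sets_pair_measure_cong)
  also have "\<dots> \<le> (\<integral>\<^sup>+x. ennreal ?b \<partial>distr M borel Y)"
  proof (rule nn_integral_mono)
    fix x :: complex
    have "closed {s. norm (x + s) \<le> L}" by (intro closed_Collect_le continuous_intros)
    then have "emeasure (distr M borel S) (Pair x -` ?E) = emeasure M {\<omega>\<in>space M. norm (x + S \<omega>) \<le> L}"
      by (subst emeasure_distr) (auto intro!: arg_cong[where f = "emeasure M"])
    then show "emeasure (distr M borel S) (Pair x -` ?E) \<le> ennreal ?b"
      using b[of x] by (simp add: emeasure_eq_measure ennreal_leI)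
  qed
  also have "\<dots> = ennreal ?b" using DY.emeasure_space_1 by simp
  finally have "prob {\<omega>\<in>space M. norm (Y \<omega> + S \<omega>) \<le> L} \<le> ?b"
    using p by (simp add: emeasure_eq_measure)
  then have "(prob {\<omega>\<in>space M. norm (Y \<omega> + S \<omega>) \<le> L})\<^sup>2 \<le> ?b\<^sup>2" by (intro power_mono) auto
  also have "?b\<^sup>2 = 4 / gap_prob \<delta> / sqrt (real (card I))" using p by simp
  finally show ?thesis by (simp add: Y_def S_def)
qed

end

section \<open>Growth of the random series\<close>

definition limit_potential :: "real \<Rightarrow> complex \<Rightarrow> real" where
  "limit_potential \<alpha> z = \<alpha> * norm z powr (1 / \<alpha>)"

definition zero_scale :: "real \<Rightarrow> real \<Rightarrow> nat \<Rightarrow> real" where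
  "zero_scale \<alpha> \<beta> n = exp \<beta> * real n powr \<alpha>"

definition weight_exponent :: "real \<Rightarrow> real \<Rightarrow> nat \<Rightarrow> real" where
  "weight_exponent \<alpha> \<beta> k = - \<alpha> * (real k * ln (real k) - real k) - \<beta> * real k"

lemma eventually_le_imp_const_le:
  fixes f g :: "nat \<Rightarrow> real"
  assumes ev: "eventually (\<lambda>k. f k \<le> g k) sequentially" and g: "\<And>k. g k > 0"
  obtains C where "C > 0" "\<And>k. f k \<le> C * g k"
proof -
  obtain K where K: "\<And>k. k \<ge> K \<Longrightarrow> f k \<le> g k" using ev by (auto simp: eventually_sequentially)
  \<comment> \<open>The sum over the finitely many exceptional indices dominates each of their
    ratios; the added 1 handles all later ones.\<close>
  define C where "C = 1 + (\<Sum>k<K. \<bar>f k\<bar> / g k)"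
  have s: "(\<Sum>k<K. \<bar>f k\<bar> / g k) \<ge> 0" using g by (intro sum_nonneg divide_nonneg_pos) auto
  show thesis
  proof (rule that)
    show "C > 0" using s by (simp add: C_def)
    fix k
    show "f k \<le> C * g k"
    proof (cases "k < K")
      case True
      have "\<bar>f k\<bar> / g k \<le> (\<Sum>k<K. \<bar>f k\<bar> / g k)"
        using True g by (intro member_le_sum) (auto intro: divide_nonneg_pos less_imp_le)
      then have "\<bar>f k\<bar> / g k \<le> C" by (simp add: C_def)
      then show ?thesis using g[of k] by (simp add: pos_divide_le_eq)
    next
      case False
      have "f k \<le> 1 * g k" using K False by simp
      also have "\<dots> \<le> C * g k" using s g[of k] by (intro mult_right_mono) (auto simp: C_def)
      finally show ?thesis .
    qed
  qed
qed

context
  fixes w :: "nat \<Rightarrow> complex" and \<alpha> \<beta> :: real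
  assumes \<alpha>: "\<alpha> > 0"
    and w: "(\<lambda>k. ln (norm (w k)) - weight_exponent \<alpha> \<beta> k) \<in> o[at_top](\<lambda>k. real k)"
begin

lemma weight_close:
  assumes "\<epsilon> > 0"
  shows "eventually (\<lambda>k. \<bar>ln (norm (w k)) - weight_exponent \<alpha> \<beta> k\<bar> \<le> \<epsilon> * real k) sequentially"
  using landau_o.smallD[OF w assms] by simp

text \<open>The convention \<open>ln 0 = 0\<close> is incompatible with the asymptotics, so zero weights are excluded.\<close>

lemma weight_nonzero: "eventually (\<lambda>k. w k \<noteq> 0) sequentially"
proof -
  have "filterlim (\<lambda>k::nat. \<alpha> * ln (real k) - \<alpha> + \<beta>) at_top sequentially"
    using \<alpha> by real_asymp
  then have "eventually (\<lambda>k. \<alpha> * ln (real k) - \<alpha> + \<beta> > 1) sequentially"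
    by (simp add: filterlim_at_top_dense)
  moreover have "eventually (\<lambda>k. \<bar>ln (norm (w k)) - weight_exponent \<alpha> \<beta> k\<bar> \<le> 1 * real k) sequentially"
    by (rule weight_close) simp
  moreover have "eventually (\<lambda>k::nat. k > 0) sequentially" by (rule eventually_gt_at_top)
  ultimately show ?thesis
  proof eventually_elim
    case (elim k)
    show ?case
    proof
      assume "w k = 0"
      then have "\<bar>weight_exponent \<alpha> \<beta> k\<bar> \<le> real k" using elim by simp
      moreover have "weight_exponent \<alpha> \<beta> k = - (real k * (\<alpha> * ln (real k) - \<alpha> + \<beta>))"
        by (simp add: weight_exponent_def algebra_simps)
      moreover have "real k * 1 < real k * (\<alpha> * ln (real k) - \<alpha> + \<beta>)"
        using elim by (intro mult_strict_left_mono) auto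
      ultimately show False by simp
    qed
  qed
qed

lemma weight_upper:
  assumes "\<epsilon> > 0"
  obtains C where "C > 0" "\<And>k. norm (w k) \<le> C * exp (weight_exponent \<alpha> \<beta> k + \<epsilon> * real k)"
proof (rule eventually_le_imp_const_le)
  show "eventually (\<lambda>k. norm (w k) \<le> exp (weight_exponent \<alpha> \<beta> k + \<epsilon> * real k)) sequentially"
    using weight_close[OF assms] weight_nonzero
  proof eventually_elim
    case (elim k)
    then have "ln (norm (w k)) \<le> weight_exponent \<alpha> \<beta> k + \<epsilon> * real k" by linarith
    then have "exp (ln (norm (w k))) \<le> exp (weight_exponent \<alpha> \<beta> k + \<epsilon> * real k)" by simp
    then show ?case using elim by simp
  qed
qed (use that in auto)

lemma weight_lower:
  assumes "\<epsilon> > 0"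
  shows "eventually (\<lambda>k. norm (w k) \<ge> exp (weight_exponent \<alpha> \<beta> k - \<epsilon> * real k)) sequentially"
    using weight_close[OF assms] weight_nonzero
  proof eventually_elim
    case (elim k)
    then have "ln (norm (w k)) \<ge> weight_exponent \<alpha> \<beta> k - \<epsilon> * real k" by linarith
    then have "exp (ln (norm (w k))) \<ge> exp (weight_exponent \<alpha> \<beta> k - \<epsilon> * real k)" by simp
    then show ?case using elim by simp
  qed

text \<open>Over real \<open>k\<close> the exponent
  \<open>k * ln x - \<alpha> * (k * ln k - k)\<close> is concave with maximum
  \<open>\<alpha> * x powr (1 / \<alpha>)\<close>. This is how the limit potential arises from the
  weights: as a Legendre transform.\<close>

lemma exp_entropy_le:
  assumes x: "x \<ge> 0"
  shows "exp (- \<alpha> * (real k * ln (real k) - real k)) * x ^ k \<le> exp (\<alpha> * x powr (1 / \<alpha>))"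
proof (cases "x = 0 \<or> k = 0")
  case True
  show ?thesis
  proof (cases "k = 0")
    case False
    then show ?thesis using True by (simp add: zero_power)
  qed (use \<alpha> in simp)
next
  case False
  then have k: "real k > 0" and x: "x > 0" using assms by auto
  \<comment> \<open>The maximising index; the inequality \<open>ln t \<le> t - 1\<close> at
    \<open>t = y / k\<close> replaces the calculus.\<close>
  define y where "y = x powr (1 / \<alpha>)"
  have y: "y > 0" using x by (simp add: y_def)
  have ly: "ln x = \<alpha> * ln y" using x \<alpha> by (simp add: y_def ln_powr)
  have "ln (y / real k) \<le> y / real k - 1" using y k by (intro ln_le_minus_one) auto
  then have "real k * ln (y / real k) \<le> real k * (y / real k - 1)" using k by (intro mult_left_mono) auto
  then have "real k * ln y - real k * ln (real k) + real k \<le> y" using k y by (simp add: ln_div algebra_simps)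
  then have "\<alpha> * (real k * ln y - real k * ln (real k) + real k) \<le> \<alpha> * y" using \<alpha> by (intro mult_left_mono) auto
  then have "- \<alpha> * (real k * ln (real k) - real k) + real k * ln x \<le> \<alpha> * y"
    by (simp add: ly algebra_simps)
  moreover have "x ^ k = exp (real k * ln x)" using x by (simp add: exp_of_nat_mult)
  ultimately show ?thesis by (simp add: y_def exp_add[symmetric])
qed

text \<open>The coefficients are bounded with slack \<open>\<epsilon> / 2\<close> while
  \<open>\<epsilon>\<close> is put into the entropy bound; the difference is a convergent geometric
  factor.\<close>

lemma power_series_growth:
  fixes c :: "nat \<Rightarrow> complex" and z :: complex
  assumes c: "\<And>\<epsilon>. \<epsilon> > 0 \<Longrightarrow> \<exists>C>0. \<forall>k. norm (c k) \<le> C * exp (weight_exponent \<alpha> \<beta> k + \<epsilon> * real k)"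
  shows "summable (\<lambda>k. norm (c k * z ^ k))"
    and "\<epsilon> > 0 \<Longrightarrow> \<exists>C>0. \<forall>z. norm (\<Sum>k. c k * z ^ k) \<le> C * exp (\<alpha> * (norm z * exp (\<epsilon> - \<beta>)) powr (1 / \<alpha>))"
proof -
  have term_le: "norm (c k * z ^ k) \<le> (C * exp (\<alpha> * (norm z * exp (\<epsilon> - \<beta>)) powr (1 / \<alpha>))) * exp (- (\<epsilon>/2)) ^ k"
    if C: "C > 0" "\<And>k. norm (c k) \<le> C * exp (weight_exponent \<alpha> \<beta> k + \<epsilon> / 2 * real k)" for C \<epsilon> k and z :: complex
  proof -
    have "norm (c k * z ^ k) \<le> C * exp (weight_exponent \<alpha> \<beta> k + \<epsilon> / 2 * real k) * norm z ^ k"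
      unfolding norm_mult norm_power using C(2) by (intro mult_right_mono) auto
    also have "exp (weight_exponent \<alpha> \<beta> k + \<epsilon> / 2 * real k) = exp (- \<alpha> * (real k * ln (real k) - real k)) * exp (\<epsilon> - \<beta>) ^ k * exp (- (\<epsilon>/2)) ^ k"
      by (simp add: weight_exponent_def exp_of_nat_mult[symmetric] exp_add[symmetric] algebra_simps)
    also have "C * (exp (- \<alpha> * (real k * ln (real k) - real k)) * exp (\<epsilon> - \<beta>) ^ k * exp (- (\<epsilon>/2)) ^ k) * norm z ^ k =
      C * (exp (- \<alpha> * (real k * ln (real k) - real k)) * (norm z * exp (\<epsilon> - \<beta>)) ^ k) * exp (- (\<epsilon>/2)) ^ k"
      by (simp add: power_mult_distrib mult_ac)
    also have "\<dots> \<le> C * exp (\<alpha> * (norm z * exp (\<epsilon> - \<beta>)) powr (1 / \<alpha>)) * exp (- (\<epsilon>/2)) ^ k"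
      using C(1) by (intro mult_right_mono mult_left_mono exp_entropy_le) auto
    finally show ?thesis .
  qed
  have geo: "summable (\<lambda>k. K * exp (- (\<epsilon>/2)) ^ k)" if "\<epsilon> > 0" for K \<epsilon> :: real
    using that by (intro summable_mult summable_geometric) auto
  have summ: "summable (\<lambda>k. norm (c k * z ^ k))" for z :: complex
  proof -
    obtain C where "C > 0" "\<And>k. norm (c k) \<le> C * exp (weight_exponent \<alpha> \<beta> k + 2 / 2 * real k)"
      using c[of 1] by auto
    from term_le[OF this] show ?thesis
      by (intro summable_comparison_test'[OF geo[of 2 "C * exp (\<alpha> * (norm z * exp (2 - \<beta>)) powr (1 / \<alpha>))"], of 0]) auto
  qed
  then show "summable (\<lambda>k. norm (c k * z ^ k))" .
  show "\<exists>C>0. \<forall>z. norm (\<Sum>k. c k * z ^ k) \<le> C * exp (\<alpha> * (norm z * exp (\<epsilon> - \<beta>)) powr (1 / \<alpha>))" if \<epsilon>: "\<epsilon> > 0"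
  proof -
    obtain C where C: "C > 0" "\<And>k. norm (c k) \<le> C * exp (weight_exponent \<alpha> \<beta> k + \<epsilon> / 2 * real k)"
      using c[of "\<epsilon> / 2"] \<epsilon> by auto
    let ?q = "exp (- (\<epsilon>/2))"
    have q: "?q < 1" using \<epsilon> by simp
    show ?thesis
    proof (intro exI conjI allI)
      show "C / (1 - ?q) > 0" using C q by simp
      fix z :: complex
      let ?E = "exp (\<alpha> * (norm z * exp (\<epsilon> - \<beta>)) powr (1 / \<alpha>))"
      have "norm (\<Sum>k. c k * z ^ k) \<le> (\<Sum>k. norm (c k * z ^ k))" by (rule summable_norm[OF summ])
      also have "\<dots> \<le> (\<Sum>k. (C * ?E) * ?q ^ k)"
        by (rule suminf_le[OF term_le[OF C] summ geo[OF \<epsilon>]])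
      also have "\<dots> = (C * ?E) * (1 / (1 - ?q))"
        using q by (subst suminf_mult) (auto simp: suminf_geometric summable_geometric)
      finally show "norm (\<Sum>k. c k * z ^ k) \<le> C / (1 - ?q) * ?E" by simp
    qed
  qed
qed

lemma limit_potential_scale:
  assumes "n > 0"
  shows "\<alpha> * (norm (of_real (zero_scale \<alpha> \<beta> n) * z) * exp (\<epsilon> - \<beta>)) powr (1 / \<alpha>) = real n * limit_potential \<alpha> z * exp (\<epsilon> / \<alpha>)"
proof -
  have "norm (of_real (zero_scale \<alpha> \<beta> n) * z) * exp (\<epsilon> - \<beta>) = real n powr \<alpha> * norm z * exp \<epsilon>"
    by (simp add: norm_mult zero_scale_def abs_mult exp_diff)
  then show ?thesis using \<alpha> assms
    by (simp add: powr_mult powr_powr limit_potential_def) (simp add: powr_def)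
qed

lemma upper_bound_scaled:
  fixes W :: "complex \<Rightarrow> complex"
  assumes W: "\<And>\<epsilon>. \<epsilon> > 0 \<Longrightarrow> \<exists>C>0. \<forall>z. norm (W z) \<le> C * exp (\<alpha> * (norm z * exp (\<epsilon> - \<beta>)) powr (1 / \<alpha>))"
    and \<delta>: "\<delta> > 0"
  shows "eventually (\<lambda>n. \<forall>z\<in>cball 0 R. ln (norm (W (of_real (zero_scale \<alpha> \<beta> n) * z))) / real n \<le> limit_potential \<alpha> z + \<delta>) sequentially"
proof -
  \<comment> \<open>Bounds the limit potential on the disk, so that a relative error in the exponent
    becomes a uniform absolute one.\<close>
  define U where "U = \<alpha> * \<bar>R\<bar> powr (1 / \<alpha>)"
  have U: "U \<ge> 0" using \<alpha> by (simp add: U_def)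
  have "((\<lambda>\<epsilon>. U * (exp (\<epsilon> / \<alpha>) - 1)) \<longlongrightarrow> U * (exp (0 / \<alpha>) - 1)) (at_right 0)"
    using \<alpha> by (intro tendsto_intros) auto
  then have "eventually (\<lambda>\<epsilon>. U * (exp (\<epsilon> / \<alpha>) - 1) < \<delta> / 2) (at_right 0)"
    using \<delta> by (intro order_tendstoD) auto
  moreover have "eventually (\<lambda>\<epsilon>::real. \<epsilon> > 0) (at_right 0)" by (rule eventually_at_right_less)
  ultimately obtain \<epsilon> where \<epsilon>: "\<epsilon> > 0" "U * (exp (\<epsilon> / \<alpha>) - 1) < \<delta> / 2"
    using eventually_happens'[OF _ eventually_conj] trivial_limit_at_right_real by (metis (no_types, lifting))
  obtain C where C: "C > 0" "\<And>z. norm (W z) \<le> C * exp (\<alpha> * (norm z * exp (\<epsilon> - \<beta>)) powr (1 / \<alpha>))"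
    using W[OF \<epsilon>(1)] by blast
  have "((\<lambda>n. ln C / real n) \<longlongrightarrow> 0) sequentially" by (rule lim_const_over_n)
  then have "eventually (\<lambda>n. ln C / real n < \<delta> / 2) sequentially" using \<delta> by (intro order_tendstoD) auto
  then show ?thesis using eventually_gt_at_top[of 0]
  proof eventually_elim
    case (elim n)
    show ?case
    proof
      fix z :: complex assume z: "z \<in> cball 0 R"
      let ?W = "norm (W (of_real (zero_scale \<alpha> \<beta> n) * z))"
      have up: "limit_potential \<alpha> z \<ge> 0" using \<alpha> by (simp add: limit_potential_def)
      show "ln ?W / real n \<le> limit_potential \<alpha> z + \<delta>"
      \<comment> \<open>At a zero of \<open>W\<close> the convention \<open>ln 0 = 0\<close> gives 0
        instead of minus infinity; the bound still holds because the potential is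
        nonnegative.\<close>
      proof (cases "?W = 0")
        case True
        then show ?thesis using up \<delta> by simp
      next
        case False
        then have "ln ?W \<le> ln (C * exp (real n * limit_potential \<alpha> z * exp (\<epsilon> / \<alpha>)))"
          using C(2)[of "of_real (zero_scale \<alpha> \<beta> n) * z"] C(1) elim
          by (subst ln_le_cancel_iff) (auto simp: limit_potential_scale)
        also have "\<dots> = ln C + real n * limit_potential \<alpha> z * exp (\<epsilon> / \<alpha>)"
          using C(1) by (simp add: ln_mult_pos)
        finally have "ln ?W / real n \<le> ln C / real n + limit_potential \<alpha> z * exp (\<epsilon> / \<alpha>)"
          using elim by (simp add: field_simps)
        also have "limit_potential \<alpha> z * exp (\<epsilon> / \<alpha>) = limit_potential \<alpha> z + limit_potential \<alpha> z * (exp (\<epsilon> / \<alpha>) - 1)"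
          by (simp add: algebra_simps)
        also have "limit_potential \<alpha> z * (exp (\<epsilon> / \<alpha>) - 1) \<le> U * (exp (\<epsilon> / \<alpha>) - 1)"
        proof (rule mult_right_mono)
          show "limit_potential \<alpha> z \<le> U" unfolding limit_potential_def U_def
            using z \<alpha> by (intro mult_left_mono powr_mono2) auto
          show "0 \<le> exp (\<epsilon> / \<alpha>) - 1" using \<epsilon> \<alpha> by simp
        qed
        finally show ?thesis using \<epsilon>(2) elim by linarith
      qed
    qed
  qed
qed

text \<open>The largest term has index close to \<open>n * t\<close> with
  \<open>t = norm a powr (1 / \<alpha>)\<close>. Just above that index the logarithm of a term,
  divided by \<open>n\<close>, loses at most \<open>\<alpha> * d\<close> plus the error in the
  weights, so a whole window of length proportional to \<open>n\<close> stays above the required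
  size.\<close>

lemma window_lower_bound:
  assumes a: "a \<noteq> 0" and \<delta>: "\<delta> > 0"
  obtains d where "d > 0"
    "eventually (\<lambda>n. \<forall>k. real n * norm a powr (1 / \<alpha>) \<le> real k \<and> real k \<le> real n * (norm a powr (1 / \<alpha>) + d) \<longrightarrow>
        exp (real n * (limit_potential \<alpha> a - \<delta>)) \<le> norm (w k * (of_real (zero_scale \<alpha> \<beta> n) * a) ^ k)) sequentially"
proof -
  define t where "t = norm a powr (1 / \<alpha>)"
  have t: "t > 0" using a by (simp add: t_def)
  have la: "ln (norm a) = \<alpha> * ln t" using a \<alpha> by (simp add: t_def ln_powr)
  \<comment> \<open>The tolerance is shared: \<open>\<alpha> * d \<le> \<delta> / 2\<close> pays for
    the width of the window, \<open>\<epsilon> * t \<le> \<delta> / 2\<close> for the weights. The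
    bounds \<open>t / 2\<close> and \<open>\<alpha> / 2\<close> keep the expression in
    \<open>coef\<close> nonnegative.\<close>
  define d where "d = min (t / 2) (\<delta> / (2 * \<alpha>))"
  define \<epsilon> where "\<epsilon> = min (\<delta> / (2 * t)) (\<alpha> / 2)"
  have d: "d > 0" "d \<le> t / 2" "\<alpha> * d \<le> \<delta> / 2"
  proof -
    show "d > 0" "d \<le> t / 2" using t \<delta> \<alpha> by (auto simp: d_def)
    have "d \<le> \<delta> / (2 * \<alpha>)" by (simp add: d_def)
    then show "\<alpha> * d \<le> \<delta> / 2" using \<alpha> by (simp add: field_simps)
  qed
  have \<epsilon>: "\<epsilon> > 0" "\<epsilon> \<le> \<alpha> / 2" "\<epsilon> * t \<le> \<delta> / 2"
  proof -
    show "\<epsilon> > 0" "\<epsilon> \<le> \<alpha> / 2" using t \<delta> \<alpha> by (auto simp: \<epsilon>_def)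
    have "\<epsilon> \<le> \<delta> / (2 * t)" by (simp add: \<epsilon>_def)
    then show "\<epsilon> * t \<le> \<delta> / 2" using t by (simp add: field_simps)
  qed
  obtain K where K: "\<And>k. k \<ge> K \<Longrightarrow> exp (weight_exponent \<alpha> \<beta> k - \<epsilon> * real k) \<le> norm (w k)"
    using weight_lower[OF \<epsilon>(1)] by (auto simp: eventually_sequentially)
  show thesis
  proof (rule that[OF d(1)], fold t_def)
    have "filterlim (\<lambda>n. real n * t) at_top sequentially"
      using t by (intro filterlim_at_top_mult_tendsto_pos[OF tendsto_const] filterlim_real_sequentially | simp add: mult.commute)+
    then have "eventually (\<lambda>n. real n * t \<ge> real K) sequentially" by (simp add: filterlim_at_top)
    then show "eventually (\<lambda>n. \<forall>k. real n * t \<le> real k \<and> real k \<le> real n * (t + d) \<longrightarrow>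
        exp (real n * (limit_potential \<alpha> a - \<delta>)) \<le> norm (w k * (of_real (zero_scale \<alpha> \<beta> n) * a) ^ k)) sequentially"
      using eventually_gt_at_top[of 0]
    proof eventually_elim
      case (elim n)
      show ?case
      proof (intro allI impI, elim conjE)
        fix k assume k: "real n * t \<le> real k" "real k \<le> real n * (t + d)"
        have n: "real n > 0" using elim by simp
        have "real K \<le> real k" using elim k by linarith
        then have kK: "k \<ge> K" by simp
        have "real n * t > 0" using n t by simp
        then have kp: "real k > 0" using k by linarith
        have "ln (real k / (real n * t)) \<le> real k / (real n * t) - 1" using kp n t by (intro ln_le_minus_one) auto
        also have "\<dots> \<le> real n * (t + d) / (real n * t) - 1" using k n t by (intro diff_right_mono divide_right_mono) auto
        also have "\<dots> = d / t" using n t by (simp add: field_simps)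
        finally have lnle: "ln (real k) - ln (real n) - ln t \<le> d / t"
          using kp n t by (simp add: ln_div ln_mult_pos)
        \<comment> \<open>Nonnegativity is what allows \<open>n * t\<close> to be replaced by the
          larger \<open>k\<close> in the chain that follows.\<close>
        have coef: "\<alpha> * (1 - d / t) - \<epsilon> \<ge> 0"
        proof -
          have "d / t \<le> 1 / 2" using d t by (simp add: field_simps)
          then have "\<alpha> * (1 / 2) \<le> \<alpha> * (1 - d / t)" using \<alpha> by (intro mult_left_mono) auto
          then show ?thesis using \<epsilon> by linarith
        qed
        have "real n * (limit_potential \<alpha> a - \<delta>) \<le> real n * (\<alpha> * t - \<alpha> * d - \<epsilon> * t)"
          using d \<epsilon> n by (intro mult_left_mono) (auto simp: limit_potential_def t_def)
        also have "\<dots> = real n * t * (\<alpha> * (1 - d / t) - \<epsilon>)" using t by (simp add: field_simps)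
        also have "\<dots> \<le> real k * (\<alpha> * (1 - d / t) - \<epsilon>)" by (rule mult_right_mono[OF k(1) coef])
        also have "\<dots> \<le> real k * (\<alpha> * (1 - (ln (real k) - ln (real n) - ln t)) - \<epsilon>)"
          using lnle \<alpha> by (intro mult_left_mono diff_right_mono) auto
        also have "\<dots> = (weight_exponent \<alpha> \<beta> k - \<epsilon> * real k) + real k * (\<beta> + \<alpha> * ln (real n) + ln (norm a))"
          by (simp add: weight_exponent_def la algebra_simps)
        finally have "exp (real n * (limit_potential \<alpha> a - \<delta>)) \<le>
            exp (weight_exponent \<alpha> \<beta> k - \<epsilon> * real k) * exp (real k * (\<beta> + \<alpha> * ln (real n) + ln (norm a)))"
          by (simp add: exp_add[symmetric])
        also have "exp (real k * (\<beta> + \<alpha> * ln (real n) + ln (norm a))) = (zero_scale \<alpha> \<beta> n * norm a) ^ k"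
          using n a by (simp add: exp_of_nat_mult exp_add zero_scale_def powr_def)
        also have "exp (weight_exponent \<alpha> \<beta> k - \<epsilon> * real k) * (zero_scale \<alpha> \<beta> n * norm a) ^ k \<le> norm (w k) * (zero_scale \<alpha> \<beta> n * norm a) ^ k"
          using K[OF kK] by (intro mult_right_mono) (auto simp: zero_scale_def)
        also have "\<dots> = norm (w k * (of_real (zero_scale \<alpha> \<beta> n) * a) ^ k)"
          by (simp add: norm_mult norm_power zero_scale_def abs_mult)
        finally show "exp (real n * (limit_potential \<alpha> a - \<delta>)) \<le> norm (w k * (of_real (zero_scale \<alpha> \<beta> n) * a) ^ k)" .
      qed
    qed
  qed
qed

end

lemma suminf_indicator_less_le:
  fixes y :: real
  assumes "y \<ge> 0"
  shows "(\<Sum>k. indicator {k. real k < y} (k::nat)) \<le> ennreal (y + 1)"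
proof -
  have "{k. real k < y} \<subseteq> {..< nat \<lceil>y\<rceil>}" by (auto simp: less_ceiling_iff zless_nat_eq_int_zless)
  then have "(\<Sum>k. indicator {k. real k < y} (k::nat) :: ennreal) \<le> (\<Sum>k. indicator {..< nat \<lceil>y\<rceil>} k)"
    by (intro suminf_le) (auto simp: indicator_def)
  also have "\<dots> = (\<Sum>k<nat \<lceil>y\<rceil>. indicator {..< nat \<lceil>y\<rceil>} k)"
    by (rule suminf_finite) auto
  also have "\<dots> = ennreal (real (nat \<lceil>y\<rceil>))" by (simp add: ennreal_of_nat_eq_real_of_nat)
  also have "\<dots> \<le> ennreal (y + 1)" using assms by (intro ennreal_leI) linarith
  finally show ?thesis .
qed

section \<open>Almost sure bounds for the random series\<close>

context iid_sequence
begin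

text \<open>The Borel-Cantelli lemma: by identical distribution the tail probabilities at
  \<open>\<epsilon> * k\<close> are those of \<open>\<xi> 0\<close>, and summed over
  \<open>k\<close> they amount to at most the expectation of
  \<open>ln (1 + norm (\<xi> 0)) / \<epsilon> + 1\<close>.\<close>

lemma AE_eventually_small:
  assumes int: "integrable M (\<lambda>\<omega>. ln (1 + norm (\<xi> 0 \<omega>)))" and \<epsilon>: "\<epsilon> > 0"
  shows "AE \<omega> in M. eventually (\<lambda>k. ln (1 + norm (\<xi> k \<omega>)) \<le> \<epsilon> * real k) sequentially"
proof -
  define A where "A k = {\<omega>\<in>space M. ln (1 + norm (\<xi> k \<omega>)) > \<epsilon> * real k}" for k
  have [measurable]: "A k \<in> sets M" for k unfolding A_def by measurable
  have eq: "emeasure M (A k) = emeasure M {\<omega>\<in>space M. ln (1 + norm (\<xi> 0 \<omega>)) > \<epsilon> * real k}" for k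
  proof -
    let ?B = "{x::complex. ln (1 + norm x) > \<epsilon> * real k}"
    have B: "?B \<in> sets borel" by measurable
    have *: "emeasure M {\<omega>\<in>space M. ln (1 + norm (\<xi> j \<omega>)) > \<epsilon> * real k} = emeasure (distr M borel (\<xi> j)) ?B" for j
      using B by (subst emeasure_distr) (auto intro!: arg_cong[where f = "emeasure M"])
    have "emeasure M (A k) = emeasure (distr M borel (\<xi> k)) ?B" unfolding A_def by (rule *)
    also have "\<dots> = emeasure (distr M borel (\<xi> 0)) ?B" by (rule arg_cong[where f = "\<lambda>D. emeasure D ?B", OF ident])
    finally show ?thesis using * by simp
  qed
  have "(\<Sum>k. emeasure M (A k)) = (\<Sum>k. \<integral>\<^sup>+\<omega>. indicator {\<omega>\<in>space M. ln (1 + norm (\<xi> 0 \<omega>)) > \<epsilon> * real k} \<omega> \<partial>M)"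
    unfolding eq by (subst nn_integral_indicator) auto
  also have "\<dots> = (\<integral>\<^sup>+\<omega>. (\<Sum>k. indicator {\<omega>\<in>space M. ln (1 + norm (\<xi> 0 \<omega>)) > \<epsilon> * real k} \<omega>) \<partial>M)"
    by (rule nn_integral_suminf[symmetric]) measurable
  also have "\<dots> \<le> (\<integral>\<^sup>+\<omega>. ennreal (ln (1 + norm (\<xi> 0 \<omega>)) / \<epsilon> + 1) \<partial>M)"
  proof (rule nn_integral_mono)
    fix \<omega> assume \<omega>: "\<omega> \<in> space M"
    have "(\<Sum>k. indicator {\<omega>\<in>space M. ln (1 + norm (\<xi> 0 \<omega>)) > \<epsilon> * real k} \<omega> :: ennreal) =
      (\<Sum>k. indicator {k. real k < ln (1 + norm (\<xi> 0 \<omega>)) / \<epsilon>} k)"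
      using \<epsilon> \<omega> by (intro suminf_cong) (auto simp: indicator_def field_simps)
    also have "\<dots> \<le> ennreal (ln (1 + norm (\<xi> 0 \<omega>)) / \<epsilon> + 1)"
      using \<epsilon> by (intro suminf_indicator_less_le) auto
    finally show "(\<Sum>k. indicator {\<omega>\<in>space M. ln (1 + norm (\<xi> 0 \<omega>)) > \<epsilon> * real k} \<omega>) \<le> ennreal (ln (1 + norm (\<xi> 0 \<omega>)) / \<epsilon> + 1)" .
  qed
  also have "\<dots> < \<infinity>"
  proof -
    have "integrable M (\<lambda>\<omega>. ln (1 + norm (\<xi> 0 \<omega>)) / \<epsilon> + 1)" using int by simp
    then show ?thesis using \<epsilon> by (subst nn_integral_eq_integral) (auto intro!: AE_I2)
  qed
  finally have fin: "(\<Sum>k. emeasure M (A k)) < \<infinity>" .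
  have "summable (\<lambda>k. measure M (A k))"
  proof (rule summable_suminf_not_top)
    show "(\<Sum>k. ennreal (measure M (A k))) \<noteq> \<top>"
      using fin by (simp add: emeasure_eq_measure less_top)
  qed simp
  then have "AE \<omega> in M. eventually (\<lambda>k. \<omega> \<in> space M - A k) sequentially"
    by (intro borel_cantelli_AE1) (auto simp: less_top[symmetric])
  then show ?thesis
    by eventually_elim (auto simp: A_def not_less elim!: eventually_mono)
qed

lemma AE_subexponential:
  assumes int: "integrable M (\<lambda>\<omega>. ln (1 + norm (\<xi> 0 \<omega>)))"
  shows "AE \<omega> in M. \<forall>\<epsilon>>0. \<exists>C>0. \<forall>k. norm (\<xi> k \<omega>) \<le> C * exp (\<epsilon> * real k)"
proof -
  \<comment> \<open>Countably many rates suffice, so one null set serves all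
    \<open>\<epsilon>\<close>.\<close>
  have "AE \<omega> in M. \<forall>m::nat. eventually (\<lambda>k. ln (1 + norm (\<xi> k \<omega>)) \<le> inverse (real (Suc m)) * real k) sequentially"
    unfolding AE_all_countable by (intro allI AE_eventually_small[OF int]) simp
  then show ?thesis
  proof eventually_elim
    case (elim \<omega>)
    show ?case
    proof (intro allI impI)
      fix \<epsilon> :: real assume "\<epsilon> > 0"
      then obtain m where m: "inverse (real (Suc m)) < \<epsilon>" using reals_Archimedean by blast
      have "eventually (\<lambda>k. norm (\<xi> k \<omega>) \<le> exp (\<epsilon> * real k)) sequentially"
        using elim[rule_format, of m]
      proof eventually_elim
        case (elim k)
        have "inverse (real (Suc m)) * real k \<le> \<epsilon> * real k" using m by (intro mult_right_mono) auto
        then have "ln (1 + norm (\<xi> k \<omega>)) \<le> \<epsilon> * real k" using elim by linarith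
        then have "exp (ln (1 + norm (\<xi> k \<omega>))) \<le> exp (\<epsilon> * real k)" by simp
        moreover have "exp (ln (1 + norm (\<xi> k \<omega>))) = 1 + norm (\<xi> k \<omega>)"
          using norm_ge_zero[of "\<xi> k \<omega>"] by (intro exp_ln) linarith
        ultimately show ?case by linarith
      qed
      then show "\<exists>C>0. \<forall>k. norm (\<xi> k \<omega>) \<le> C * exp (\<epsilon> * real k)"
        by (rule eventually_le_imp_const_le) auto
    qed
  qed
qed

context
  fixes w :: "nat \<Rightarrow> complex" and \<alpha> \<beta> :: real
  assumes \<alpha>: "\<alpha> > 0"
    and w: "(\<lambda>k. ln (norm (w k)) - weight_exponent \<alpha> \<beta> k) \<in> o[at_top](\<lambda>k. real k)"
    and nd: "\<not> (\<exists>c. AE \<omega> in M. \<xi> 0 \<omega> = c)"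
    and int: "integrable M (\<lambda>\<omega>. ln (1 + norm (\<xi> 0 \<omega>)))"
begin

lemma AE_coefficients:
  "AE \<omega> in M. \<forall>\<epsilon>>0. \<exists>C>0. \<forall>k. norm (\<xi> k \<omega> * w k) \<le> C * exp (weight_exponent \<alpha> \<beta> k + \<epsilon> * real k)"
  using AE_subexponential[OF int]
proof eventually_elim
  case (elim \<omega>)
  show ?case
  proof (intro allI impI)
    fix \<epsilon> :: real assume \<epsilon>: "\<epsilon> > 0"
    obtain C1 where C1: "C1 > 0" "\<And>k. norm (\<xi> k \<omega>) \<le> C1 * exp (\<epsilon> / 2 * real k)"
      using elim \<epsilon> by (meson half_gt_zero)
    obtain C2 where C2: "C2 > 0" "\<And>k. norm (w k) \<le> C2 * exp (weight_exponent \<alpha> \<beta> k + \<epsilon> / 2 * real k)"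
      using weight_upper[OF \<alpha> w, of "\<epsilon> / 2"] \<epsilon> by auto
    have "norm (\<xi> k \<omega> * w k) \<le> (C1 * C2) * exp (weight_exponent \<alpha> \<beta> k + \<epsilon> * real k)" for k
    proof -
      have "norm (\<xi> k \<omega> * w k) \<le> (C1 * exp (\<epsilon> / 2 * real k)) * (C2 * exp (weight_exponent \<alpha> \<beta> k + \<epsilon> / 2 * real k))"
        unfolding norm_mult using C1 C2 by (intro mult_mono) auto
      also have "\<dots> = (C1 * C2) * (exp (\<epsilon> / 2 * real k) * exp (weight_exponent \<alpha> \<beta> k + \<epsilon> / 2 * real k))"
        by (simp only: mult_ac)
      also have "exp (\<epsilon> / 2 * real k) * exp (weight_exponent \<alpha> \<beta> k + \<epsilon> / 2 * real k) =
          exp (\<epsilon> / 2 * real k + (weight_exponent \<alpha> \<beta> k + \<epsilon> / 2 * real k))"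
        by (rule exp_add[symmetric])
      also have "\<epsilon> / 2 * real k + (weight_exponent \<alpha> \<beta> k + \<epsilon> / 2 * real k) = weight_exponent \<alpha> \<beta> k + \<epsilon> * real k"
        by (simp add: field_simps)
      finally show ?thesis .
    qed
    then show "\<exists>C>0. \<forall>k. norm (\<xi> k \<omega> * w k) \<le> C * exp (weight_exponent \<alpha> \<beta> k + \<epsilon> * real k)"
      using C1(1) C2(1) by (intro exI[of _ "C1 * C2"]) auto
  qed
qed

text \<open>The terms with index in the window are split off. Given the others, a small value of the
  series is a small-ball event for a sum over at least \<open>d * n / 2\<close> indices, and its
  probability is summable along powers of two.\<close>

lemma AE_lower_bound:
  assumes a: "a \<noteq> 0" and \<delta>: "\<delta> > 0"
  shows "AE \<omega> in M. eventually (\<lambda>j. exp (2 ^ j * (limit_potential \<alpha> a - \<delta>)) <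
      norm (random_power_series \<xi> w \<omega> (of_real (zero_scale \<alpha> \<beta> (2 ^ j)) * a))) sequentially"
proof -
  obtain \<gamma> where \<gamma>: "\<gamma> > 0" "gap_prob \<gamma> > 0" using nondegenerate_gap[OF nd] by blast
  define t where "t = norm a powr (1 / \<alpha>)"
  have t: "t > 0" using a by (simp add: t_def)
  obtain d where d: "d > 0" and win:
    "eventually (\<lambda>n. \<forall>k. real n * t \<le> real k \<and> real k \<le> real n * (t + d) \<longrightarrow>
        exp (real n * (limit_potential \<alpha> a - \<delta> / 2)) \<le> norm (w k * (of_real (zero_scale \<alpha> \<beta> n) * a) ^ k)) sequentially"
    using window_lower_bound[OF \<alpha> w a, of "\<delta> / 2"] \<delta> unfolding t_def by auto
  define I where "I n = {k. real n * t \<le> real k \<and> real k \<le> real n * (t + d)}" for n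
  have Isub: "I n \<subseteq> {..nat \<lfloor>real n * (t + d)\<rfloor>}" for n by (auto simp: I_def le_nat_floor)
  have Ifin: "finite (I n)" for n using Isub finite_subset by blast
  \<comment> \<open>Rounding costs at most one index; the remaining \<open>n * d - 1\<close> are at
    least half of \<open>n * d\<close> once \<open>n * d \<ge> 2\<close>.\<close>
  have Icard: "real (card (I n)) \<ge> real n * d / 2" if "real n * d \<ge> 2" for n
  proof -
    let ?l = "nat \<lceil>real n * t\<rceil>" and ?m = "nat \<lfloor>real n * d\<rfloor>"
    have "{?l..<?l + ?m} \<subseteq> I n"
    proof
      fix k assume k: "k \<in> {?l..<?l + ?m}"
      have "real n * t \<le> real ?l" by (rule real_nat_ceiling_ge)
      moreover have "0 \<le> real n * t" using t by simp
      then have "real ?l \<le> real n * t + 1" by linarith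
      moreover have "real ?m \<le> real n * d" using d by (simp add: of_nat_nat)
      moreover have "real ?l \<le> real k" "real k + 1 \<le> real ?l + real ?m" using k by auto
      ultimately show "k \<in> I n" by (auto simp: I_def algebra_simps)
    qed
    from card_mono[OF Ifin this] have "?m \<le> card (I n)" by simp
    moreover have "real n * d - 1 \<le> real ?m" using d by linarith
    ultimately have "real n * d - 1 \<le> real (card (I n))" by linarith
    then show ?thesis using that by linarith
  qed
  define L where "L n = exp (real n * (limit_potential \<alpha> a - \<delta>))" for n
  define z where "z n = of_real (zero_scale \<alpha> \<beta> n) * a" for n
  \<comment> \<open>The rest of the series as a function of the coordinates outside the window only.
    \<open>suminf\<close> is total, so \<open>g\<close> is measurable on the whole product space;
    agreement with the series is claimed later, on the almost sure event of convergence.\<close>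
  define g where "g n y = (\<Sum>k. if k \<in> I n then 0 else y k * w k * z n ^ k)" for n and y :: "nat \<Rightarrow> complex"
  have gm: "g n \<in> borel_measurable (PiM (- I n) (\<lambda>_. borel))" for n
    unfolding g_def[abs_def]
  proof (rule borel_measurable_suminf)
    fix k
    show "(\<lambda>y. if k \<in> I n then 0 else y k * w k * z n ^ k) \<in> borel_measurable (PiM (- I n) (\<lambda>_. borel))"
      by (cases "k \<in> I n") (auto intro!: borel_measurable_times measurable_component_singleton)
  qed
  define A where "A j = {\<omega>\<in>space M. norm (g (2 ^ j) (restrict (\<lambda>k. \<xi> k \<omega>) (- I (2 ^ j))) + (\<Sum>k\<in>I (2 ^ j). \<xi> k \<omega> * (w k * z (2 ^ j) ^ k))) \<le> L (2 ^ j)}" for j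
  have Am: "A j \<in> sets M" for j
  proof -
    have "(\<lambda>\<omega>. restrict (\<lambda>k. \<xi> k \<omega>) (- I (2 ^ j))) \<in> measurable M (PiM (- I (2 ^ j)) (\<lambda>_. borel))"
      by (intro measurable_restrict rv)
    then have [measurable]: "(\<lambda>\<omega>. g (2 ^ j) (restrict (\<lambda>k. \<xi> k \<omega>) (- I (2 ^ j)))) \<in> borel_measurable M"
      by (rule measurable_compose[OF _ gm])
    show ?thesis unfolding A_def by measurable
  qed
  \<comment> \<open>The window is taken for \<open>\<delta> / 2\<close> and the threshold for
    \<open>\<delta>\<close>; the surplus \<open>exp (n * \<delta> / 2)\<close> eventually exceeds
    the constant \<open>4 / \<gamma>\<close>.\<close>
  have bound: "eventually (\<lambda>n. \<forall>k\<in>I n. norm (w k * z n ^ k) * \<gamma> > 4 * L n) sequentially"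
  proof -
    have "filterlim (\<lambda>n. exp (real n * (\<delta> / 2))) at_top sequentially"
      using \<delta> by real_asymp
    then have "eventually (\<lambda>n. exp (real n * (\<delta> / 2)) > 4 / \<gamma>) sequentially"
      by (simp add: filterlim_at_top_dense)
    with win show ?thesis
    proof eventually_elim
      case (elim n)
      show ?case
      proof
        fix k assume "k \<in> I n"
        then have k: "exp (real n * (limit_potential \<alpha> a - \<delta> / 2)) \<le> norm (w k * z n ^ k)"
          using elim(1) by (auto simp: I_def z_def)
        have "4 * L n < exp (real n * (\<delta> / 2)) * \<gamma> * L n"
          using elim(2) \<gamma> by (intro mult_strict_right_mono) (auto simp: L_def field_simps)
        also have "\<dots> = exp (real n * (limit_potential \<alpha> a - \<delta> / 2)) * \<gamma>"
          by (simp add: L_def exp_add[symmetric] algebra_simps)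
        also have "\<dots> \<le> norm (w k * z n ^ k) * \<gamma>" using k \<gamma> by (intro mult_right_mono) auto
        finally show "norm (w k * z n ^ k) * \<gamma> > 4 * L n" .
      qed
    qed
  qed
  \<comment> \<open>Comes from the square root of the squared bound at \<open>n = 2 ^ j\<close>: the
    factor \<open>n powr (- 1/4)\<close> becomes the power of
    \<open>1 / sqrt (sqrt 2)\<close>.\<close>
  define C where "C = sqrt (4 / gap_prob \<gamma> / sqrt (d / 2))"
  have evA: "eventually (\<lambda>n. \<forall>j. n = 2 ^ j \<longrightarrow> prob (A j) \<le> C * (1 / sqrt (sqrt 2)) ^ j) sequentially"
  proof -
    have "filterlim (\<lambda>n. real n * d) at_top sequentially" using d by real_asymp
    then have "eventually (\<lambda>n. real n * d \<ge> 2) sequentially" by (simp add: filterlim_at_top)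
    with bound show ?thesis
    proof eventually_elim
      case (elim n)
      show ?case
      proof (intro allI impI)
        fix j assume n: "n = 2 ^ j"
        have cI: "real (card (I n)) \<ge> real n * d / 2" by (rule Icard[OF elim(2)])
        have "I n \<noteq> {}" using cI elim(2) by auto
        then have "(prob (A j))\<^sup>2 \<le> 4 / gap_prob \<gamma> / sqrt (real (card (I n)))"
          unfolding A_def n[symmetric] using elim(1)
          by (intro small_ball_indep_sum[OF \<gamma>(2,1) Ifin _ _ _ gm]) (auto simp: L_def)
        also have "\<dots> \<le> 4 / gap_prob \<gamma> / sqrt (real n * d / 2)"
          using cI \<gamma> elim(2) by (intro divide_left_mono) auto
        also have "\<dots> = (C * (1 / sqrt (sqrt 2)) ^ j)\<^sup>2"
        proof -
          have "sqrt (real n * d / 2) = sqrt 2 ^ j * sqrt (d / 2)"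
            by (simp add: n real_sqrt_mult real_sqrt_divide real_sqrt_power)
          moreover have "((1 / sqrt (sqrt 2)) ^ j)\<^sup>2 = 1 / sqrt 2 ^ j"
            by (simp add: power_mult[symmetric] mult.commute[of j] power_one_over) (simp add: power_mult)
          moreover have "C\<^sup>2 = 4 / gap_prob \<gamma> / sqrt (d / 2)" using \<gamma> d by (simp add: C_def)
          ultimately show ?thesis by (simp add: power_mult_distrib)
        qed
        finally show "prob (A j) \<le> C * (1 / sqrt (sqrt 2)) ^ j"
          by (rule power2_le_imp_le) (use \<gamma> d in \<open>auto simp: C_def\<close>)
      qed
    qed
  qed
  have "eventually (\<lambda>j. prob (A j) \<le> C * (1 / sqrt (sqrt 2)) ^ j) sequentially"
  proof -
    have "filterlim (\<lambda>j. 2 ^ j :: nat) at_top sequentially"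
      by (rule filterlim_at_top_mono[OF filterlim_ident]) (auto intro!: always_eventually less_imp_le less_exp)
    from eventually_compose_filterlim[OF evA this] show ?thesis by simp
  qed
  then have "eventually (\<lambda>j. norm (prob (A j)) \<le> C * (1 / sqrt (sqrt 2)) ^ j) sequentially" by simp
  moreover have "summable (\<lambda>j. C * (1 / sqrt (sqrt 2)) ^ j)"
  proof -
    have "1 < sqrt (sqrt 2)" by simp
    then show ?thesis by (intro summable_mult summable_geometric) auto
  qed
  ultimately have "summable (\<lambda>j. prob (A j))" by (rule summable_comparison_test_ev)
  then have "AE \<omega> in M. eventually (\<lambda>j. \<omega> \<in> space M - A j) sequentially"
    using Am by (intro borel_cantelli_AE1) (auto simp: less_top[symmetric])
  then show ?thesis using AE_coefficients
  proof eventually_elim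
    case (elim \<omega>)
    have sm: "summable (\<lambda>k. \<xi> k \<omega> * w k * x ^ k)" for x
      using power_series_growth(1)[OF \<alpha> w, of "\<lambda>k. \<xi> k \<omega> * w k" x] elim(2) by (auto intro: summable_norm_cancel)
    have eq: "random_power_series \<xi> w \<omega> (z n) = g n (restrict (\<lambda>k. \<xi> k \<omega>) (- I n)) + (\<Sum>k\<in>I n. \<xi> k \<omega> * (w k * z n ^ k))" for n
    proof -
      let ?f = "\<lambda>k. \<xi> k \<omega> * w k * z n ^ k"
      have "(\<lambda>k. if k \<in> I n then ?f k else 0) sums (\<Sum>k\<in>I n. ?f k)"
        by (rule sums_If_finite_set[OF Ifin])
      from sums_diff[OF summable_sums[OF sm] this]
      have "(\<lambda>k. ?f k - (if k \<in> I n then ?f k else 0)) sums ((\<Sum>k. ?f k) - (\<Sum>k\<in>I n. ?f k))" .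
      moreover have "(\<lambda>k. ?f k - (if k \<in> I n then ?f k else 0)) = (\<lambda>k. if k \<in> I n then 0 else restrict (\<lambda>k. \<xi> k \<omega>) (- I n) k * w k * z n ^ k)"
        by auto
      ultimately have "g n (restrict (\<lambda>k. \<xi> k \<omega>) (- I n)) = (\<Sum>k. ?f k) - (\<Sum>k\<in>I n. ?f k)"
        unfolding g_def by (simp add: sums_iff)
      then show ?thesis by (simp add: random_power_series_def mult.assoc)
    qed
    from elim(1) show ?case
      by eventually_elim (auto simp: A_def L_def eq[unfolded z_def] z_def not_le)
  qed
qed

end

end

section \<open>The limit potential\<close>

definition limit_density :: "real \<Rightarrow> real \<Rightarrow> real" where
  "limit_density \<alpha> s = 1 / (2 * pi * \<alpha>) * s powr (1 / \<alpha> - 2)"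

lemma limit_density_nonneg: "\<alpha> > 0 \<Longrightarrow> limit_density \<alpha> s \<ge> 0"
  by (simp add: limit_density_def)

lemma borel_measurable_limit_density [measurable]: "limit_density \<alpha> \<in> borel_measurable borel"
  unfolding limit_density_def[abs_def] by measurable

text \<open>With the area factor the density becomes the derivative of
  \<open>s powr (1 / \<alpha>)\<close>, the mass of the disk of radius \<open>s\<close>.\<close>

lemma radial_limit_density: "\<alpha> > 0 \<Longrightarrow> s \<ge> 0 \<Longrightarrow> 2 * pi * s * limit_density \<alpha> s = 1 / \<alpha> * s powr (1 / \<alpha> - 1)"
  by (cases "s = 0") (simp_all add: limit_density_def powr_diff power2_eq_square)

lemma set_integrable_powr:
  fixes p R :: real
  assumes "p > -1"
  shows "set_integrable lborel {0..<R} (\<lambda>s. s powr p)"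
proof (cases "R > 0")
  case True
  have "(\<lambda>s. s powr p) absolutely_integrable_on {0..R}"
    using has_integral_powr_from_0[OF assms, of R] True by (intro nonnegative_absolutely_integrable_1) (auto simp: has_integral_iff)
  then have "set_integrable lborel {0..R} (\<lambda>s. s powr p)"
    unfolding set_integrable_def by (subst (asm) integrable_completion) auto
  then show ?thesis by (rule set_integrable_subset) auto
qed (simp add: set_integrable_def)

lemma set_integrable_mult_bounded:
  fixes f g :: "'a::euclidean_space \<Rightarrow> real"
  assumes f: "set_integrable lborel S f" and [measurable]: "g \<in> borel_measurable borel" "S \<in> sets borel"
    and mf: "f \<in> borel_measurable borel"
    and B: "\<And>s. s \<in> S \<Longrightarrow> \<bar>g s\<bar> \<le> B"
  shows "set_integrable lborel S (\<lambda>x. f x * g x)"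
proof (rule set_integrable_bound[of lborel S "\<lambda>x. B * f x"])
  show "set_integrable lborel S (\<lambda>x. B * f x)" using f by simp
  show "set_borel_measurable lborel S (\<lambda>x. f x * g x)"
    using mf unfolding set_borel_measurable_def by measurable
  show "AE x in lborel. x \<in> S \<longrightarrow> norm (f x * g x) \<le> norm (B * f x)"
  proof (rule AE_I2, rule impI)
    fix x assume "x \<in> S"
    then have "\<bar>f x\<bar> * \<bar>g x\<bar> \<le> \<bar>f x\<bar> * \<bar>B\<bar>" using B[of x] by (intro mult_left_mono) auto
    then show "norm (f x * g x) \<le> norm (B * f x)" by (simp add: abs_mult mult.commute)
  qed
qed

context
  fixes \<alpha> :: real
  assumes \<alpha>: "\<alpha> > 0"
begin

lemma set_integrable_limit_density: "set_integrable lborel (ball (0::complex) R) (\<lambda>x. limit_density \<alpha> (norm x))"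
proof (cases "R > 0")
  case True
  have "set_integrable lborel {0..<R} (\<lambda>s. 1 / \<alpha> * s powr (1 / \<alpha> - 1))"
    using \<alpha> by (intro set_integrable_mult_right set_integrable_powr) auto
  then have "set_integrable lborel {0..<R} (\<lambda>s. 2 * pi * s * limit_density \<alpha> s)"
    by (rule set_integrable_cong[THEN iffD1, rotated 3]) (auto simp: radial_limit_density[OF \<alpha>])
  then show ?thesis by (subst integral_radial(2)[OF True]) auto
next
  case False
  then show ?thesis by (simp add: ball_empty set_integrable_def)
qed

lemma radial_ln_integral:
  assumes \<rho>: "0 < \<rho>" "\<rho> < R"
  shows "(LINT s:{0..<R}|lborel. 2 * pi * s * (limit_density \<alpha> s * ln (max s \<rho>))) =
    \<alpha> * \<rho> powr (1 / \<alpha>) + (R powr (1 / \<alpha>) * ln R - \<alpha> * R powr (1 / \<alpha>))"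
proof -
  let ?g = "\<lambda>s. 1 / \<alpha> * s powr (1 / \<alpha> - 1) * ln (max s \<rho>)"
  \<comment> \<open>Found by integration by parts. Above \<open>\<rho>\<close> the logarithm is
    differentiated as well and the second term compensates for it; at \<open>\<rho>\<close> itself
    only continuity is checked, which is enough at a single point.\<close>
  let ?F = "\<lambda>s. s powr (1 / \<alpha>) * ln (max s \<rho>) - \<alpha> * max s \<rho> powr (1 / \<alpha>)"
  have eq: "(LINT s:{0..<R}|lborel. 2 * pi * s * (limit_density \<alpha> s * ln (max s \<rho>))) = (LINT s:{0..<R}|lborel. ?g s)"
    by (rule set_lebesgue_integral_cong) (auto simp: radial_limit_density[OF \<alpha>] mult.assoc[symmetric])
  have "set_integrable lborel {0..<R} (\<lambda>s. (1 / \<alpha> * s powr (1 / \<alpha> - 1)) * ln (max s \<rho>))"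
  proof (rule set_integrable_mult_bounded)
    show "set_integrable lborel {0..<R} (\<lambda>s. 1 / \<alpha> * s powr (1 / \<alpha> - 1))"
      using \<alpha> by (intro set_integrable_mult_right set_integrable_powr) auto
    fix s assume "s \<in> {0..<R}"
    then have "ln \<rho> \<le> ln (max s \<rho>)" "ln (max s \<rho>) \<le> ln R" using \<rho> by auto
    then show "\<bar>ln (max s \<rho>)\<bar> \<le> \<bar>ln \<rho>\<bar> + \<bar>ln R\<bar>" by linarith
  qed measurable
  then have "(LINT s:{0..<R}|lborel. ?g s) = integral {0..<R} ?g"
    by (rule set_borel_integral_eq_integral)
  also have "\<dots> = integral {0..R} ?g"
    by (rule integral_spike_set; rule negligible_subset[of "{R}"]) auto
  also have "\<dots> = ?F R - ?F 0"
  proof (rule integral_unique, rule fundamental_theorem_of_calculus_interior_strong[of "{\<rho>}"])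
    show "continuous_on {0..R} ?F"
    proof (intro continuous_on_diff continuous_on_mult continuous_on_const)
      show "continuous_on {0..R} (\<lambda>s. s powr (1 / \<alpha>))"
        by (rule continuous_on_powr') (use \<alpha> in \<open>auto intro: continuous_intros\<close>)
      show "continuous_on {0..R} (\<lambda>s. ln (max s \<rho>))"
        by (intro continuous_on_ln continuous_on_max continuous_on_id continuous_on_const) (use \<rho> in auto)
      show "continuous_on {0..R} (\<lambda>s. max s \<rho> powr (1 / \<alpha>))"
        by (intro continuous_on_powr continuous_on_max continuous_on_id continuous_on_const) (use \<rho> in auto)
    qed
    fix s assume s: "s \<in> {0<..<R} - {\<rho>}"
    show "(?F has_vector_derivative ?g s) (at s)"
    proof (cases "s < \<rho>")
      case True
      have "((\<lambda>s. s powr (1 / \<alpha>) * ln \<rho> - \<alpha> * \<rho> powr (1 / \<alpha>)) has_vector_derivative ?g s) (at s)"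
        using s True unfolding has_real_derivative_iff_has_vector_derivative[symmetric]
        by (auto intro!: derivative_eq_intros simp: max_def)
      moreover have "eventually (\<lambda>x. x < \<rho>) (nhds s)" using True by (rule eventually_nhds_in_open[OF open_lessThan, simplified lessThan_iff])
      then have "eventually (\<lambda>x. ?F x = x powr (1 / \<alpha>) * ln \<rho> - \<alpha> * \<rho> powr (1 / \<alpha>)) (nhds s)"
        by eventually_elim (simp add: max_def)
      ultimately show ?thesis
        using True has_vector_derivative_cong_ev by (simp add: has_real_derivative_iff_has_vector_derivative[symmetric] DERIV_cong_ev)
    next
      case False
      then have sr: "s > \<rho>" using s by auto
      have e: "s powr (1 / \<alpha> - 1) = s powr (1 / \<alpha>) / s" using sr \<rho> by (simp add: powr_diff)
      have "((\<lambda>s. s powr (1 / \<alpha>) * ln s - \<alpha> * s powr (1 / \<alpha>)) has_vector_derivative ?g s) (at s)"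
        using s sr \<rho> \<alpha> unfolding has_real_derivative_iff_has_vector_derivative[symmetric]
        by (auto intro!: derivative_eq_intros simp: max_def e)
      moreover have "eventually (\<lambda>x. \<rho> < x) (nhds s)" using sr by (rule eventually_nhds_in_open[OF open_greaterThan, simplified greaterThan_iff])
      then have "eventually (\<lambda>x. ?F x = x powr (1 / \<alpha>) * ln x - \<alpha> * x powr (1 / \<alpha>)) (nhds s)"
        by eventually_elim (simp add: max_def)
      ultimately show ?thesis
        using sr by (simp add: has_real_derivative_iff_has_vector_derivative[symmetric] DERIV_cong_ev)
    qed
  qed (use \<rho> in auto)
  also have "\<dots> = \<alpha> * \<rho> powr (1 / \<alpha>) + (R powr (1 / \<alpha>) * ln R - \<alpha> * R powr (1 / \<alpha>))"
    using \<rho> by (simp add: max_def)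
  finally show ?thesis unfolding eq .
qed

text \<open>Two possible singularities, of the density at 0 and of the logarithm at
  \<open>- y\<close>. The disk of radius \<open>norm y / 2\<close> separates them: on either side
  one factor is bounded.\<close>

lemma set_integrable_limit_density_ln:
  assumes y: "y \<noteq> 0"
  shows "set_integrable lborel (ball (0::complex) R) (\<lambda>x. limit_density \<alpha> (norm x) * ln (norm (y + x)))"
proof -
  let ?r = "norm y / 2"
  have r: "?r > 0" using y by simp
  let ?A = "ball (0::complex) R \<inter> ball 0 ?r" and ?B = "ball (0::complex) R - ball 0 ?r"
  have A: "set_integrable lborel ?A (\<lambda>x. limit_density \<alpha> (norm x) * ln (norm (y + x)))"
  proof (rule set_integrable_mult_bounded)
    show "set_integrable lborel ?A (\<lambda>x. limit_density \<alpha> (norm x))"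
      by (rule set_integrable_subset[OF set_integrable_limit_density[of R]]) auto
    fix x assume "x \<in> ?A"
    then have x: "norm x < ?r" by simp
    have "?r \<le> norm (y + x)" using norm_triangle_ineq2[of y "-x"] x by simp
    moreover have "norm (y + x) \<le> 2 * norm y" using norm_triangle_ineq[of y x] x norm_ge_zero[of y] by linarith
    ultimately have "ln ?r \<le> ln (norm (y + x))" "ln (norm (y + x)) \<le> ln (2 * norm y)" using r by (auto intro!: ln_mono)
    then show "\<bar>ln (norm (y + x))\<bar> \<le> \<bar>ln ?r\<bar> + \<bar>ln (2 * norm y)\<bar>" by linarith
  qed (measurable, auto intro!: sets.Int borel_open)
  have B: "set_integrable lborel ?B (\<lambda>x. limit_density \<alpha> (norm x) * ln (norm (y + x)))"
  proof -
    have "set_integrable lborel ?B (\<lambda>x. ln (norm (y + x)) * limit_density \<alpha> (norm x))"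
    proof (rule set_integrable_mult_bounded)
      show "set_integrable lborel ?B (\<lambda>x. ln (norm (y + x)))"
        by (rule set_integrable_subset[OF set_integrable_ln_norm[of 0 R]]) auto
      fix x assume "x \<in> ?B"
      then have x: "?r \<le> norm x" "norm x < R" by auto
      \<comment> \<open>The exponent may have either sign, so the sum of the two end values bounds
        the power in both cases.\<close>
      have "norm x powr (1 / \<alpha> - 2) \<le> ?r powr (1 / \<alpha> - 2) + R powr (1 / \<alpha> - 2)"
      proof (cases "1 / \<alpha> - 2 \<ge> 0")
        case True
        then have "norm x powr (1 / \<alpha> - 2) \<le> R powr (1 / \<alpha> - 2)" using x by (intro powr_mono2) auto
        then show ?thesis using powr_ge_zero[of ?r "1 / \<alpha> - 2"] by linarith
      next
        case False
        then have "norm x powr (1 / \<alpha> - 2) \<le> ?r powr (1 / \<alpha> - 2)" using x r by (intro powr_mono2') auto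
        then show ?thesis using powr_ge_zero[of R "1 / \<alpha> - 2"] by linarith
      qed
      then have "limit_density \<alpha> (norm x) \<le> 1 / (2 * pi * \<alpha>) * (?r powr (1 / \<alpha> - 2) + R powr (1 / \<alpha> - 2))"
        unfolding limit_density_def using \<alpha> by (intro mult_left_mono) auto
      then show "\<bar>limit_density \<alpha> (norm x)\<bar> \<le> 1 / (2 * pi * \<alpha>) * (?r powr (1 / \<alpha> - 2) + R powr (1 / \<alpha> - 2))"
        using limit_density_nonneg[OF \<alpha>, of "norm x"] by simp
    next
      show "?B \<in> sets borel" by (intro sets.Diff borel_open open_ball)
    qed measurable
    then show ?thesis by (simp add: mult.commute)
  qed
  have "ball (0::complex) R = ?A \<union> ?B" by auto
  then show ?thesis using set_integrable_Un[OF A B] by simp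
qed

text \<open>Radiality reduces the potential of the limit measure, cut off at radius
  \<open>R\<close>, to a one-dimensional integral. The constant depends only on \<open>R\<close> and
  \<open>\<alpha>\<close>, so it disappears when a value is subtracted from a mean.\<close>

lemma limit_potential_representation:
  assumes y: "y \<noteq> 0" "norm y < R"
  shows "(LINT x:ball (0::complex) R|lborel. limit_density \<alpha> (norm x) * ln (norm (y - x))) =
    limit_potential \<alpha> y + (R powr (1 / \<alpha>) * ln R - \<alpha> * R powr (1 / \<alpha>))"
proof -
  have R: "R > 0" using y norm_ge_zero[of y] by linarith
  have ind: "indicator (ball 0 R) x = (indicator {..<R} (norm x) :: real)" for x :: complex
    by (simp add: indicator_def)
  let ?q = "\<lambda>s. indicator {..<R} s * limit_density \<alpha> s"
  have i: "integrable lborel (\<lambda>x::complex. ?q (norm x) * ln (norm (- y + x)))"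
    using set_integrable_limit_density_ln[of "- y" R] y by (simp add: set_integrable_def ind mult.assoc)
  have "(LINT x:ball (0::complex) R|lborel. limit_density \<alpha> (norm x) * ln (norm (y - x))) =
      (LINT x::complex|lborel. ?q (norm x) * ln (norm (- y + x)))"
    by (simp add: set_lebesgue_integral_def ind mult.assoc norm_minus_commute)
  also have "\<dots> = (LINT x::complex|lborel. ?q (norm x) * ln (max (norm x) (norm (- y))))"
    by (rule radial_weight_ln_mean(2)[OF _ i]) measurable
  also have "\<dots> = (LINT x:ball (0::complex) R|lborel. (\<lambda>s. limit_density \<alpha> s * ln (max s (norm y))) (norm x))"
    by (simp add: set_lebesgue_integral_def ind mult.assoc)
  also have "\<dots> = (LINT s:{0..<R}|lborel. 2 * pi * s * (limit_density \<alpha> s * ln (max s (norm y))))"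
    by (rule integral_radial(1)[OF R]) measurable
  also have "\<dots> = limit_potential \<alpha> y + (R powr (1 / \<alpha>) * ln R - \<alpha> * R powr (1 / \<alpha>))"
    unfolding limit_potential_def using y by (intro radial_ln_integral) auto
  finally show ?thesis .
qed

end

context
  fixes \<alpha> :: real
  assumes \<alpha>: "\<alpha> > 0"
begin

lemma continuous_on_limit_potential: "continuous_on A (limit_potential \<alpha>)"
  unfolding limit_potential_def[abs_def]
  by (intro continuous_on_mult continuous_on_const continuous_on_powr' continuous_on_norm_id ballI conjI impI) (use \<alpha> in auto)

lemma locally_integrable_limit_potential: "locally_integrable (limit_potential \<alpha>)"
  unfolding locally_integrable_def
proof (intro conjI allI)
  show m: "limit_potential \<alpha> \<in> borel_measurable borel"
    by (rule borel_measurable_continuous_onI[OF continuous_on_limit_potential])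
  fix R
  show "set_integrable lborel (ball 0 R) (limit_potential \<alpha>)"
  proof (rule set_integrable_lborel_bounded[OF _ m bounded_ball])
    fix x :: complex assume "x \<in> ball 0 R"
    then have "norm x powr (1 / \<alpha>) \<le> R powr (1 / \<alpha>)" using \<alpha> by (intro powr_mono2) auto
    then show "\<bar>limit_potential \<alpha> x\<bar> \<le> \<alpha> * R powr (1 / \<alpha>)" using \<alpha> by (simp add: limit_potential_def)
  qed simp
qed

text \<open>Jensen's formula for a continuous distribution of zeros: take disk means in the
  preceding representation, exchange the integrals, and let the additive constant cancel.\<close>

lemma limit_potential_mean:
  assumes a: "a \<noteq> 0" and r: "r > 0" "norm a + r < R"
  shows "(LINT s:ball 0 r|lborel. limit_potential \<alpha> (a + s)) / (pi * r\<^sup>2) - limit_potential \<alpha> a =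
    (LINT x:ball (0::complex) R|lborel. limit_density \<alpha> (norm x) * jensen_kernel r (a - x))"
proof -
  define q where "q x = indicator (ball (0::complex) R) x * limit_density \<alpha> (norm x)" for x
  define I where "I s = (indicator (ball (0::complex) r) s :: real)" for s
  define c where "c = R powr (1 / \<alpha>) * ln R - \<alpha> * R powr (1 / \<alpha>)"
  have [measurable]: "q \<in> borel_measurable borel" "I \<in> borel_measurable borel"
    unfolding q_def[abs_def] I_def[abs_def] by (auto intro!: borel_measurable_times borel_measurable_indicator)
  have q0: "q x \<ge> 0" for x using limit_density_nonneg[OF \<alpha>] by (simp add: q_def)
  have iq: "integrable lborel q"
    using set_integrable_limit_density[OF \<alpha>, of R] by (simp add: set_integrable_def q_def[abs_def])
  define K where "K x s = q x * (I s * ln (norm ((a - x) + s)))" for x s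
  have mK: "(\<lambda>(x, s). K x s) \<in> borel_measurable (lborel \<Otimes>\<^sub>M lborel)"
    unfolding K_def by measurable
  have iI: "integrable lborel (\<lambda>s. I s * ln (norm (b + s)))" for b
    using set_integrable_ln_norm[of 0 r b] by (simp add: set_integrable_def I_def)
  \<comment> \<open>A disk large enough to contain every \<open>a - x + s\<close> with
    \<open>norm x < R\<close> and \<open>norm s < r\<close>, which bounds the logarithmic integral
    uniformly in \<open>x\<close>.\<close>
  let ?R = "norm a + R + r"
  have iB: "integrable lborel (\<lambda>x. indicator (ball (0::complex) ?R) x * \<bar>ln (norm x)\<bar>)"
    using integrable_abs[OF set_integrable_ln_norm_0[of ?R, unfolded set_integrable_def]]
    by (simp add: abs_mult)
  define B where "B = (LINT x|lborel. indicator (ball (0::complex) ?R) x * \<bar>ln (norm x)\<bar>)"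
  have le: "(LINT s|lborel. \<bar>K x s\<bar>) \<le> q x * B" for x
  proof (cases "norm x < R")
    case True
    have "(LINT s|lborel. \<bar>K x s\<bar>) = q x * (LINT s|lborel. I s * \<bar>ln (norm ((a - x) + s))\<bar>)"
      using q0 by (simp add: K_def abs_mult I_def)
    also have "(LINT s|lborel. I s * \<bar>ln (norm ((a - x) + s))\<bar>) \<le>
        (LINT s|lborel. indicator (ball (0::complex) ?R) ((a - x) + s) * \<bar>ln (norm ((a - x) + s))\<bar>)"
    proof (rule integral_mono)
      show "integrable lborel (\<lambda>s. I s * \<bar>ln (norm ((a - x) + s))\<bar>)"
        using integrable_abs[OF iI[of "a - x"]] by (simp add: abs_mult I_def)
      show "integrable lborel (\<lambda>s. indicator (ball (0::complex) ?R) ((a - x) + s) * \<bar>ln (norm ((a - x) + s))\<bar>)"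
        using iB by (subst integral_lborel_translate(1)[of "\<lambda>y. indicator (ball (0::complex) ?R) y * \<bar>ln (norm y)\<bar>"])
           (auto intro!: borel_measurable_times borel_measurable_indicator)
      fix s
      show "I s * \<bar>ln (norm ((a - x) + s))\<bar> \<le> indicator (ball (0::complex) ?R) ((a - x) + s) * \<bar>ln (norm ((a - x) + s))\<bar>"
      proof (cases "norm s < r")
        case sr: True
        have "norm ((a - x) + s) < ?R"
          using norm_triangle_ineq[of "a - x" s] norm_triangle_ineq4[of a x] sr True by linarith
        then show ?thesis by (simp add: I_def indicator_def)
      qed (simp add: I_def)
    qed
    also have "\<dots> = B" unfolding B_def
      by (rule integral_lborel_translate(2)[of "\<lambda>y. indicator (ball (0::complex) ?R) y * \<bar>ln (norm y)\<bar>"])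
         (auto intro!: borel_measurable_times borel_measurable_indicator)
    finally show ?thesis using q0 by (simp add: mult_left_mono)
  next
    case False
    then have "q x = 0" by (simp add: q_def)
    then show ?thesis by (simp add: K_def)
  qed
  have intK: "integrable (lborel \<Otimes>\<^sub>M lborel) (\<lambda>(x, s). K x s)"
  proof (rule lborel_pair.Fubini_integrable[OF mK])
    have "integrable lborel (\<lambda>x. LINT s|lborel. \<bar>K x s\<bar>)"
    proof (rule Bochner_Integration.integrable_bound)
      show "integrable lborel (\<lambda>x. q x * B)" using iq by simp
      show "(\<lambda>x. LINT s|lborel. \<bar>K x s\<bar>) \<in> borel_measurable lborel"
        by (rule lborel.borel_measurable_lebesgue_integral) (use mK in measurable)
      show "AE x in lborel. norm (LINT s|lborel. \<bar>K x s\<bar>) \<le> norm (q x * B)"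
        using le by (auto intro!: AE_I2 order_trans[OF le abs_ge_self])
    qed
    then show "integrable lborel (\<lambda>x. LINT s|lborel. norm (case (x, s) of (x, s) \<Rightarrow> K x s))" by simp
    show "AE x in lborel. integrable lborel (\<lambda>s. case (x, s) of (x, s) \<Rightarrow> K x s)"
      using iI by (simp add: K_def)
  qed
  have F: "(LINT s|lborel. LINT x|lborel. K x s) = (LINT x|lborel. LINT s|lborel. K x s)"
    by (rule lborel_pair.Fubini_integral[OF intK])
  have rep: "(LINT x|lborel. q x * ln (norm (y - x))) = limit_potential \<alpha> y + c" if "y \<noteq> 0" "norm y < R" for y
    using limit_potential_representation[OF \<alpha> that] by (simp add: set_lebesgue_integral_def q_def c_def mult.assoc)
  have iu: "set_integrable lborel (ball 0 r) (\<lambda>s. limit_potential \<alpha> (a + s))"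
  proof -
    have "continuous_on (cball 0 r) (\<lambda>s. limit_potential \<alpha> (a + s))"
      by (rule continuous_on_compose2[OF continuous_on_limit_potential[of UNIV]]) (auto intro!: continuous_intros)
    then have "set_integrable lborel (cball 0 r) (\<lambda>s. limit_potential \<alpha> (a + s))"
      unfolding set_integrable_def by (rule borel_integrable_compact[OF compact_cball])
    then show ?thesis by (rule set_integrable_subset) auto
  qed
  have ic: "set_integrable lborel (ball (0::complex) r) (\<lambda>s. c)"
    by (rule set_integrable_lborel_bounded[where B = "\<bar>c\<bar>"]) auto
  have "(LINT s|lborel. LINT x|lborel. K x s) = (LINT s:ball 0 r|lborel. limit_potential \<alpha> (a + s) + c)"
    unfolding set_lebesgue_integral_def
  proof (rule integral_cong_AE)
    show "(\<lambda>s. LINT x|lborel. K x s) \<in> borel_measurable lborel"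
      using lborel_pair.integrable_snd[OF intK] by simp
    show "(\<lambda>s. indicator (ball 0 r) s *\<^sub>R (limit_potential \<alpha> (a + s) + c)) \<in> borel_measurable lborel"
      using set_integral_add(1)[OF iu ic] by (simp add: set_integrable_def)
    show "AE s in lborel. (LINT x|lborel. K x s) = indicator (ball 0 r) s *\<^sub>R (limit_potential \<alpha> (a + s) + c)"
      using AE_lborel_singleton[of "- a"]
    proof eventually_elim
      case (elim s)
      have "(LINT x|lborel. K x s) = I s * (LINT x|lborel. q x * ln (norm ((a + s) - x)))"
        unfolding K_def by (subst Bochner_Integration.integral_mult_right_zero[symmetric]) (simp add: algebra_simps)
      moreover have "norm (a + s) < R" if "norm s < r" using that r norm_triangle_ineq[of a s] by linarith
      moreover have "a + s \<noteq> 0" using elim by (metis add.commute add_eq_0_iff)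
      ultimately show ?case using rep[of "a + s"] by (auto simp: I_def indicator_def)
    qed
  qed
  also have "\<dots> = (LINT s:ball 0 r|lborel. limit_potential \<alpha> (a + s)) + pi * r\<^sup>2 * c"
    using r by (subst set_integral_add(2)[OF iu ic]) (simp add: set_lebesgue_integral_def measure_ball_complex)
  finally have L: "(LINT s|lborel. LINT x|lborel. K x s) = (LINT s:ball 0 r|lborel. limit_potential \<alpha> (a + s)) + pi * r\<^sup>2 * c" .
  have "(LINT x|lborel. LINT s|lborel. K x s) = (LINT x|lborel. pi * r\<^sup>2 * (q x * jensen_kernel r (a - x) + q x * ln (norm (a - x))))"
  proof (rule Bochner_Integration.integral_cong)
    fix x
    have "(LINT s|lborel. K x s) = q x * (LINT s:ball 0 r|lborel. ln (norm ((a - x) + s)))"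
      by (simp add: K_def set_lebesgue_integral_def I_def)
    also have "(LINT s:ball 0 r|lborel. ln (norm ((a - x) + s))) = pi * r\<^sup>2 * (jensen_kernel r (a - x) + ln (norm (a - x)))"
      using r by (simp add: jensen_kernel_def)
    finally show "(LINT s|lborel. K x s) = pi * r\<^sup>2 * (q x * jensen_kernel r (a - x) + q x * ln (norm (a - x)))"
      by (simp add: algebra_simps)
  qed simp
  also have "\<dots> = pi * r\<^sup>2 * ((LINT x|lborel. q x * jensen_kernel r (a - x)) + (LINT x|lborel. q x * ln (norm (a - x))))"
  proof -
    have i1: "integrable lborel (\<lambda>x. q x * ln (norm (a - x)))"
      using set_integrable_limit_density_ln[OF \<alpha>, of "- a" R] a
      by (simp add: set_integrable_def q_def mult.assoc norm_minus_commute)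
    have "integrable lborel (\<lambda>x. LINT s|lborel. K x s)"
      using lborel_pair.integrable_fst[OF intK] by simp
    then have "integrable lborel (\<lambda>x. (LINT s|lborel. K x s) / (pi * r\<^sup>2) - q x * ln (norm (a - x)))"
      using i1 by (intro Bochner_Integration.integrable_diff integrable_divide) auto
    moreover have "(\<lambda>x. (LINT s|lborel. K x s) / (pi * r\<^sup>2) - q x * ln (norm (a - x))) = (\<lambda>x. q x * jensen_kernel r (a - x))"
      using r by (auto simp: K_def set_lebesgue_integral_def I_def jensen_kernel_def right_diff_distrib)
    ultimately have i2: "integrable lborel (\<lambda>x. q x * jensen_kernel r (a - x))" by simp
    show ?thesis using i1 i2 by simp
  qed
  also have "(LINT x|lborel. q x * ln (norm (a - x))) = limit_potential \<alpha> a + c"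
    using rep[OF a] r by simp
  finally have "(LINT s:ball 0 r|lborel. limit_potential \<alpha> (a + s)) + pi * r\<^sup>2 * c =
      pi * r\<^sup>2 * ((LINT x|lborel. q x * jensen_kernel r (a - x)) + (limit_potential \<alpha> a + c))"
    using L F by simp
  then have "(LINT s:ball 0 r|lborel. limit_potential \<alpha> (a + s)) =
      pi * r\<^sup>2 * ((LINT x|lborel. q x * jensen_kernel r (a - x)) + limit_potential \<alpha> a)"
    by (simp add: algebra_simps)
  then show ?thesis using r by (simp add: set_lebesgue_integral_def q_def mult.assoc)
qed

text \<open>The counterpart of \<open>integral_smear_entire\<close> for the limit: it converts the
  limit of the tested logarithms into an integral against the limit density.\<close>

lemma integral_smear_limit_potential:
  assumes f[measurable]: "f \<in> borel_measurable borel"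
    and C: "\<And>x. \<bar>f x\<bar> \<le> C" and \<rho>: "\<And>x. norm x \<ge> \<rho> \<Longrightarrow> f x = 0" and r: "r > 0"
  shows "(LINT y|lborel. limit_potential \<alpha> y * smear r f y) =
    (LINT x|lborel. limit_density \<alpha> (norm x) * kernel_smooth r f x)"
    and "integrable lborel (\<lambda>x. limit_density \<alpha> (norm x) * kernel_smooth r f x)"
proof -
  define R where "R = \<bar>\<rho>\<bar> + r + 1"
  define q where "q x = indicator (ball (0::complex) R) x * limit_density \<alpha> (norm x)" for x
  have [measurable]: "q \<in> borel_measurable borel"
    unfolding q_def[abs_def] by (auto intro!: borel_measurable_times borel_measurable_indicator)
  have q0: "q x \<ge> 0" for x using limit_density_nonneg[OF \<alpha>] by (simp add: q_def)
  have iq: "integrable lborel q"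
    using set_integrable_limit_density[OF \<alpha>, of R] by (simp add: set_integrable_def q_def[abs_def])
  define K where "K x a = q x * (f a * jensen_kernel r (a - x))" for x a
  have mK: "(\<lambda>(x, a). K x a) \<in> borel_measurable (lborel \<Otimes>\<^sub>M lborel)"
    unfolding K_def by measurable
  have iK: "integrable lborel (K x)" for x
    unfolding K_def[abs_def] using integrable_mult_jensen_kernel[OF r f C] by simp
  let ?B = "C * (LINT a|lborel. \<bar>jensen_kernel r a\<bar>)"
  have le: "(LINT a|lborel. \<bar>K x a\<bar>) \<le> q x * ?B" for x
  proof -
    have ia: "integrable lborel (\<lambda>a. \<bar>jensen_kernel r (a - x)\<bar>)"
      using jensen_kernel_translate(1)[OF r] by (rule integrable_abs)
    have "(LINT a|lborel. \<bar>K x a\<bar>) \<le> (LINT a|lborel. q x * (C * \<bar>jensen_kernel r (a - x)\<bar>))"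
    proof (rule integral_mono)
      show "integrable lborel (\<lambda>a. \<bar>K x a\<bar>)" using iK by (rule integrable_abs)
      show "\<bar>K x a\<bar> \<le> q x * (C * \<bar>jensen_kernel r (a - x)\<bar>)" for a
        using C q0 by (simp add: K_def abs_mult mult_left_mono mult_right_mono)
    qed (use ia in simp)
    also have "\<dots> = q x * (C * (LINT a|lborel. \<bar>jensen_kernel r (a - x)\<bar>))" by simp
    also have "(LINT a|lborel. \<bar>jensen_kernel r (a - x)\<bar>) = (LINT a|lborel. \<bar>jensen_kernel r a\<bar>)"
      using integral_lborel_translate(2)[of "\<lambda>a. \<bar>jensen_kernel r a\<bar>" "- x"] by simp
    finally show ?thesis .
  qed
  have intK: "integrable (lborel \<Otimes>\<^sub>M lborel) (\<lambda>(x, a). K x a)"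
  proof (rule lborel_pair.Fubini_integrable[OF mK])
    have "integrable lborel (\<lambda>x. LINT a|lborel. \<bar>K x a\<bar>)"
    proof (rule Bochner_Integration.integrable_bound)
      show "integrable lborel (\<lambda>x. q x * ?B)" using iq by simp
      show "(\<lambda>x. LINT a|lborel. \<bar>K x a\<bar>) \<in> borel_measurable lborel"
        by (rule lborel.borel_measurable_lebesgue_integral) (use mK in measurable)
      show "AE x in lborel. norm (LINT a|lborel. \<bar>K x a\<bar>) \<le> norm (q x * ?B)"
        using le by (auto intro!: AE_I2 order_trans[OF le abs_ge_self])
    qed
    then show "integrable lborel (\<lambda>x. LINT a|lborel. norm (case (x, a) of (x, a) \<Rightarrow> K x a))" by simp
    show "AE x in lborel. integrable lborel (\<lambda>a. case (x, a) of (x, a) \<Rightarrow> K x a)"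
      using iK by simp
  qed
  have Kx: "(LINT a|lborel. K x a) = limit_density \<alpha> (norm x) * kernel_smooth r f x" for x
  proof (cases "norm x < R")
    case False
    then have "kernel_smooth r f x = 0" by (intro kernel_smooth_eq_0[OF r \<rho>]) (auto simp: R_def)
    then show ?thesis using False by (simp add: K_def q_def)
  qed (simp add: K_def q_def kernel_smooth_def)
  have Ka: "(LINT x|lborel. K x a) = f a * (LINT x:ball (0::complex) R|lborel. limit_density \<alpha> (norm x) * jensen_kernel r (a - x))" for a
    unfolding K_def set_lebesgue_integral_def q_def
    by (subst Bochner_Integration.integral_mult_right_zero[symmetric]) (simp add: mult_ac)
  show "integrable lborel (\<lambda>x. limit_density \<alpha> (norm x) * kernel_smooth r f x)"
    using lborel_pair.integrable_fst[OF intK] by (simp add: Kx)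
  have "(LINT y|lborel. limit_potential \<alpha> y * smear r f y) =
      (LINT a|lborel. f a * ((LINT s:ball 0 r|lborel. limit_potential \<alpha> (a + s)) / (pi * r\<^sup>2) - limit_potential \<alpha> a))"
    by (rule integral_smear[OF locally_integrable_limit_potential f C \<rho> r])
  also have "\<dots> = (LINT a|lborel. LINT x|lborel. K x a)"
  proof (rule integral_cong_AE)
    have mu: "limit_potential \<alpha> \<in> borel_measurable borel"
      using locally_integrable_limit_potential by (simp add: locally_integrable_def)
    have ind: "indicator (ball 0 r) s = (indicator {..<r} (norm s) :: real)" for s :: complex
      by (simp add: indicator_def)
    have "(\<lambda>a. LINT s:ball 0 r|lborel. limit_potential \<alpha> (a + s)) \<in> borel_measurable lborel"
      unfolding set_lebesgue_integral_def ind
      by (rule lborel.borel_measurable_lebesgue_integral) (use mu in measurable)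
    then show "(\<lambda>a. f a * ((LINT s:ball 0 r|lborel. limit_potential \<alpha> (a + s)) / (pi * r\<^sup>2) - limit_potential \<alpha> a)) \<in> borel_measurable lborel"
      using mu by simp
    show "(\<lambda>a. LINT x|lborel. K x a) \<in> borel_measurable lborel"
      using lborel_pair.integrable_snd[OF intK] by simp
    show "AE a in lborel. f a * ((LINT s:ball 0 r|lborel. limit_potential \<alpha> (a + s)) / (pi * r\<^sup>2) - limit_potential \<alpha> a) = (LINT x|lborel. K x a)"
      using AE_lborel_singleton[of 0]
    proof eventually_elim
      case (elim a)
      show ?case
      proof (cases "norm a < \<rho>")
        case True
        then have "norm a + r < R" by (simp add: R_def)
        then show ?thesis unfolding Ka using limit_potential_mean[OF elim r] by simp
      qed (use \<rho> Ka in simp)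
    qed
  qed
  also have "\<dots> = (LINT x|lborel. LINT a|lborel. K x a)" by (rule lborel_pair.Fubini_integral[OF intK])
  finally show "(LINT y|lborel. limit_potential \<alpha> y * smear r f y) =
    (LINT x|lborel. limit_density \<alpha> (norm x) * kernel_smooth r f x)" by (simp add: Kx)
qed

end

section \<open>Convergence of the scaled logarithms\<close>

lemma lborel_integral_scale_complex:
  fixes F :: "complex \<Rightarrow> real" and c :: real
  assumes c: "c > 0" and F: "F \<in> borel_measurable borel"
  shows "(LINT x|lborel. F x) = c\<^sup>2 * (LINT x|lborel. F (of_real c * x))"
proof -
  have "(LINT x|lborel. F x) = (LINT x|density (distr lborel borel (\<lambda>x. 0 + c *\<^sub>R x)) (\<lambda>_. ennreal (\<bar>c\<bar> ^ DIM(complex))). F x)"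
    using lborel_affine[of c "0::complex"] c by simp
  also have "\<dots> = (LINT x|distr lborel borel (\<lambda>x. 0 + c *\<^sub>R x). c\<^sup>2 * F x)"
    using F c by (subst integral_density) auto
  also have "\<dots> = c\<^sup>2 * (LINT x|lborel. F (of_real c * x))"
    using F by (subst integral_distr) (auto simp: scaleR_conv_of_real)
  finally show ?thesis .
qed

text \<open>Vitali's covering lemma gives disjoint disks of radius \<open>\<rho>\<close> whose
  fivefold enlargements cover, and comparing areas bounds their number. This keeps the accumulated
  error over the cover under control as \<open>\<rho>\<close> shrinks. Centres avoid 0, where no
  lower bound is at hand.\<close>

lemma finite_ball_cover:
  fixes D :: "complex set"
  assumes D: "\<And>X. open X \<Longrightarrow> X \<noteq> {} \<Longrightarrow> \<exists>d\<in>D. d \<in> X" and \<rho>: "0 < \<rho>" "\<rho> \<le> 1" and R: "R \<ge> 0"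
  obtains C where "finite C" "C \<subseteq> D - {0}" "C \<subseteq> ball 0 (R + 1)" "ball 0 R \<subseteq> (\<Union>a\<in>C. ball a (5 * \<rho>))"
    "real (card C) * \<rho>\<^sup>2 \<le> (R + 2)\<^sup>2"
proof -
  let ?K = "(D - {0}) \<inter> ball 0 (R + 1)"
  have cov: "cball 0 R \<subseteq> (\<Union>a\<in>?K. ball a \<rho>)"
  proof
    fix x :: complex assume x: "x \<in> cball 0 R"
    \<comment> \<open>Two different points of the disk cannot both be 0.\<close>
    have "ball x \<rho> - {0} \<noteq> {}"
    proof -
      have "x + of_real (\<rho>/2) \<in> ball x \<rho>" "x + of_real (\<rho>/3) \<in> ball x \<rho>" using \<rho> by (auto simp: dist_norm)
      moreover have "x + of_real (\<rho>/2) \<noteq> x + of_real (\<rho>/3)" using \<rho> by simp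
      ultimately show ?thesis by (metis Diff_eq_empty_iff insertE emptyE subsetD)
    qed
    then obtain d where d: "d \<in> D" "d \<in> ball x \<rho> - {0}"
      using D[of "ball x \<rho> - {0}"] by (auto simp: open_delete)
    then have "norm d < R + 1"
      using x \<rho> norm_triangle_ineq2[of d x] by (simp add: dist_norm norm_minus_commute)
    then show "x \<in> (\<Union>a\<in>?K. ball a \<rho>)" using d by (auto simp: dist_commute)
  qed
  obtain K where K: "K \<subseteq> ?K" "finite K" "cball 0 R \<subseteq> (\<Union>a\<in>K. ball a \<rho>)"
    using compactE_image[OF compact_cball _ cov] by (metis open_ball)
  obtain C where C: "C \<subseteq> K" "pairwise (\<lambda>i j. disjnt (ball i \<rho>) (ball j \<rho>)) C" "cball 0 R \<subseteq> (\<Union>a\<in>C. ball a (5 * \<rho>))"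
    using Vitali_covering_lemma_balls[where S = "cball 0 R" and a = "\<lambda>a. a" and r = "\<lambda>_. \<rho>" and K = K and B = \<rho>] K(3) \<rho>
    by (metis (no_types, lifting) order_refl)
  have finC: "finite C" using C(1) K(2) finite_subset by blast
  have "real (card C) * (pi * \<rho>\<^sup>2) = (\<Sum>a\<in>C. measure lborel (ball a \<rho>))"
    using \<rho> by (simp add: measure_ball_complex)
  also have "\<dots> = measure lborel (\<Union>a\<in>C. ball a \<rho>)"
  proof (rule measure_finite_Union[symmetric, OF finC])
    show "disjoint_family_on (\<lambda>a. ball a \<rho>) C"
      using C(2) by (auto simp: disjoint_family_on_def pairwise_def disjnt_def)
    show "emeasure lborel (ball a \<rho>) \<noteq> \<infinity>" for a :: complex
      using emeasure_lborel_ball_finite[of a \<rho>] by simp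
  qed auto
  also have "\<dots> \<le> measure lborel (ball (0::complex) (R + 2))"
  proof (rule measure_mono_fmeasurable)
    show "(\<Union>a\<in>C. ball a \<rho>) \<subseteq> ball 0 (R + 2)"
    proof
      fix x assume "x \<in> (\<Union>a\<in>C. ball a \<rho>)"
      then obtain a where a: "a \<in> C" "norm (x - a) < \<rho>" by (auto simp: dist_norm norm_minus_commute)
      then have "norm a < R + 1" using C(1) K(1) by auto
      then show "x \<in> ball 0 (R + 2)" using a(2) \<rho> norm_triangle_ineq2[of x a] by simp
    qed
    have "open (\<Union>a\<in>C. ball a \<rho>)" by (intro open_UN ballI open_ball)
    then show "(\<Union>a\<in>C. ball a \<rho>) \<in> sets lborel" by simp
    show "ball (0::complex) (R + 2) \<in> fmeasurable lborel"
      using emeasure_lborel_ball_finite[of "0::complex" "R + 2"] by (intro fmeasurableI) auto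
  qed
  also have "\<dots> = pi * (R + 2)\<^sup>2" using R by (simp add: measure_ball_complex)
  finally have "pi * (real (card C) * \<rho>\<^sup>2) \<le> pi * (R + 2)\<^sup>2" by (simp add: mult_ac)
  then have "real (card C) * \<rho>\<^sup>2 \<le> (R + 2)\<^sup>2" by simp
  moreover have "ball 0 R \<subseteq> (\<Union>a\<in>C. ball a (5 * \<rho>))" using C(3) ball_subset_cball by blast
  moreover have "C \<subseteq> D - {0}" "C \<subseteq> ball 0 (R + 1)" using C(1) K(1) by blast+
  ultimately show thesis using that[OF finC] by blast
qed

text \<open>What is needed of a single outcome, freed from probability: the upper bound is uniform
  on disks, the lower bound pointwise, only at nonzero points of a dense set and only along powers
  of two.\<close>

locale entire_growth =
  fixes W :: "complex \<Rightarrow> complex" and \<alpha> \<beta> :: real and D :: "complex set"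
  assumes \<alpha>: "\<alpha> > 0" and W: "W holomorphic_on UNIV" and nz: "\<not> (\<forall>z. W z = 0)"
    and upper: "\<And>\<delta> R. \<delta> > 0 \<Longrightarrow> eventually (\<lambda>n. \<forall>z\<in>cball 0 R.
        ln (norm (W (of_real (zero_scale \<alpha> \<beta> n) * z))) / real n \<le> limit_potential \<alpha> z + \<delta>) sequentially"
    and lower: "\<And>a \<delta>. a \<in> D \<Longrightarrow> a \<noteq> 0 \<Longrightarrow> \<delta> > 0 \<Longrightarrow> eventually (\<lambda>j.
        exp (2 ^ j * (limit_potential \<alpha> a - \<delta>)) < norm (W (of_real (zero_scale \<alpha> \<beta> (2 ^ j)) * a))) sequentially"
    and dense: "\<And>X. open X \<Longrightarrow> X \<noteq> {} \<Longrightarrow> \<exists>d\<in>D. d \<in> X"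
begin

definition scaled_log :: "nat \<Rightarrow> complex \<Rightarrow> real" where
  "scaled_log n z = ln (norm (W (of_real (zero_scale \<alpha> \<beta> n) * z))) / real n"

lemma zero_scale_pos: "n > 0 \<Longrightarrow> zero_scale \<alpha> \<beta> n > 0"
  by (simp add: zero_scale_def)

lemma locally_integrable_scaled_log: "n > 0 \<Longrightarrow> locally_integrable (scaled_log n)"
  using locally_integrable_entire_scale[OF W nz zero_scale_pos, of n]
  unfolding locally_integrable_def scaled_log_def[abs_def] set_integrable_def
  by (auto intro: borel_measurable_divide)

lemma locally_integrable_diff:
  assumes "locally_integrable f" "locally_integrable g"
  shows "locally_integrable (\<lambda>z. \<bar>f z - g z\<bar>)"
  using assms unfolding locally_integrable_def
  by (auto intro!: set_integrable_abs set_integral_diff(1))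

text \<open>From above, \<open>scaled_log\<close> is controlled pointwise; from below only at the
  centre, but by subharmonicity this bounds its integral from below. As \<open>|v - u|\<close> is at
  most a constant minus \<open>v\<close>, the two bounds control the L1 norm.\<close>

lemma ball_estimate:
  assumes n: "n > 0" and r: "r > 0" and \<epsilon>: "\<epsilon> > 0"
    and osc: "\<And>x. x \<in> ball a r \<Longrightarrow> \<bar>limit_potential \<alpha> x - limit_potential \<alpha> a\<bar> \<le> \<epsilon>"
    and up: "\<And>x. x \<in> ball a r \<Longrightarrow> scaled_log n x \<le> limit_potential \<alpha> x + \<epsilon>"
    and low: "exp (real n * (limit_potential \<alpha> a - \<epsilon>)) < norm (W (of_real (zero_scale \<alpha> \<beta> n) * a))"
  shows "(LINT x:ball a r|lborel. \<bar>scaled_log n x - limit_potential \<alpha> x\<bar>) \<le> 6 * \<epsilon> * (pi * r\<^sup>2)"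
proof -
  let ?c = "zero_scale \<alpha> \<beta> n" and ?u = "limit_potential \<alpha>" and ?v = "scaled_log n"
  \<comment> \<open>\<open>T\<close> bounds \<open>scaled_log\<close> on the ball. With the
    allowance \<open>3 * \<epsilon>\<close> and the defect \<open>\<epsilon>\<close> at the centre
    the total is \<open>2 + 3 + 1 = 6\<close> times \<open>\<epsilon>\<close>.\<close>
  define T where "T = ?u a + 2 * \<epsilon>"
  have n0: "real n > 0" using n by simp
  have Wa: "W (of_real ?c * a) \<noteq> 0" using low by (metis exp_gt_zero less_trans norm_zero order_less_irrefl)
  have "real n * (?u a - \<epsilon>) < ln (norm (W (of_real ?c * a)))"
    using low Wa by (metis exp_less_cancel_iff exp_ln zero_less_norm_iff)
  then have va: "?u a - \<epsilon> < ?v a" using n0 by (simp add: scaled_log_def pos_less_divide_eq mult.commute)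
  have lv: "locally_integrable ?v" by (rule locally_integrable_scaled_log[OF n])
  have mv: "?v \<in> borel_measurable borel" using lv by (simp add: locally_integrable_def)
  have sub: "ball a r \<subseteq> ball 0 (norm a + r)"
  proof
    fix x assume "x \<in> ball a r"
    then show "x \<in> ball 0 (norm a + r)" using norm_triangle_ineq2[of x a] by (simp add: dist_norm norm_minus_commute)
  qed
  have iv: "set_integrable lborel (ball a r) ?v"
    by (rule set_integrable_subset[OF _ _ sub]) (use lv in \<open>auto simp: locally_integrable_def\<close>)
  have idiff: "set_integrable lborel (ball a r) (\<lambda>x. \<bar>?v x - ?u x\<bar>)"
    by (rule set_integrable_subset[OF _ _ sub])
       (use locally_integrable_diff[OF lv locally_integrable_limit_potential[OF \<alpha>]] in \<open>auto simp: locally_integrable_def\<close>)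
  have iT: "set_integrable lborel (ball a r) (\<lambda>x. b)" for b :: real
    by (rule set_integrable_lborel_bounded[where B = "\<bar>b\<bar>"]) auto
  have cint: "(LINT x:ball a r|lborel. b) = pi * r\<^sup>2 * b" for b :: real
    using r by (simp add: set_lebesgue_integral_def measure_ball_complex)
  have "pi * r\<^sup>2 * ?v a \<le> (LINT s:ball 0 r|lborel. ?v (a + s))"
  proof -
    have "pi * r\<^sup>2 * ln (norm (W (of_real ?c * a))) \<le> (LINT s:ball 0 r|lborel. ln (norm (W (of_real ?c * (a + s)))))"
      by (rule entire_scale_submean[OF W nz zero_scale_pos[OF n] r Wa])
    then have "pi * r\<^sup>2 * ln (norm (W (of_real ?c * a))) / real n \<le> (LINT s:ball 0 r|lborel. ln (norm (W (of_real ?c * (a + s))))) / real n"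
      using n0 by (intro divide_right_mono) auto
    then show ?thesis by (simp add: scaled_log_def set_lebesgue_integral_def)
  qed
  also have "(LINT s:ball 0 r|lborel. ?v (a + s)) = (LINT x:ball a r|lborel. ?v x)"
  proof -
    have "(+) a -` ball a r = ball 0 r" by (auto simp: dist_norm)
    then show ?thesis using set_integrable_translate(2)[OF mv, of "ball a r" a] by simp
  qed
  finally have sm: "pi * r\<^sup>2 * ?v a \<le> (LINT x:ball a r|lborel. ?v x)" .
  have "(LINT x:ball a r|lborel. \<bar>?v x - ?u x\<bar>) \<le> (LINT x:ball a r|lborel. (T + 3 * \<epsilon>) - ?v x)"
  proof (rule set_integral_mono[OF idiff set_integral_diff(1)[OF iT iv]])
    fix x assume x: "x \<in> ball a r"
    show "\<bar>?v x - ?u x\<bar> \<le> (T + 3 * \<epsilon>) - ?v x"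
      using osc[OF x] up[OF x] \<epsilon> unfolding T_def by linarith
  qed
  also have "\<dots> = pi * r\<^sup>2 * (T + 3 * \<epsilon>) - (LINT x:ball a r|lborel. ?v x)"
    by (simp add: set_integral_diff(2)[OF iT iv] cint)
  also have "\<dots> \<le> pi * r\<^sup>2 * (T + 3 * \<epsilon>) - pi * r\<^sup>2 * ?v a" using sm by simp
  also have "\<dots> = pi * r\<^sup>2 * (T + 3 * \<epsilon> - ?v a)" by (simp add: algebra_simps)
  also have "\<dots> \<le> pi * r\<^sup>2 * (6 * \<epsilon>)" using va by (intro mult_left_mono) (auto simp: T_def)
  finally show ?thesis by (simp add: mult_ac)
qed

lemma L1_dyadic:
  assumes R: "R \<ge> 0"
  shows "(\<lambda>j. LINT x:ball 0 R|lborel. \<bar>scaled_log (2 ^ j) x - limit_potential \<alpha> x\<bar>) \<longlonglongrightarrow> 0"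
proof (rule LIMSEQ_I)
  fix e :: real assume e: "e > 0"
  \<comment> \<open>\<open>150 = 6 * 5^2\<close>: the constant of the estimate on one ball times the
    area factor of the fivefold radius; \<open>(R + 2)^2\<close> bounds the number of balls times
    \<open>\<rho>^2\<close>.\<close>
  define \<epsilon> where "\<epsilon> = e / (2 * (150 * pi * (R + 2)\<^sup>2))"
  have RR: "150 * pi * (R + 2)\<^sup>2 > 0" using R by simp
  have \<epsilon>: "\<epsilon> > 0" using e RR by (simp add: \<epsilon>_def)
  have \<epsilon>2: "150 * \<epsilon> * pi * (R + 2)\<^sup>2 < e" using e RR by (simp add: \<epsilon>_def field_simps)
  \<comment> \<open>Centres lie within \<open>R + 1\<close> and the radii \<open>5 * \<rho>\<close>
    are at most 5, so all balls lie in \<open>cball 0 (R + 6)\<close>.\<close>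
  have "uniformly_continuous_on (cball 0 (R + 6)) (limit_potential \<alpha>)"
    by (rule compact_uniformly_continuous[OF continuous_on_limit_potential[OF \<alpha>] compact_cball])
  then obtain d where d: "d > 0" "\<And>x y. x \<in> cball 0 (R + 6) \<Longrightarrow> y \<in> cball 0 (R + 6) \<Longrightarrow> dist y x < d \<Longrightarrow>
      dist (limit_potential \<alpha> y) (limit_potential \<alpha> x) < \<epsilon>"
    unfolding uniformly_continuous_on_def using \<epsilon> by metis
  define \<rho> where "\<rho> = min 1 (d / 5)"
  have \<rho>: "0 < \<rho>" "\<rho> \<le> 1" "5 * \<rho> \<le> d" using d by (auto simp: \<rho>_def)
  obtain C where C: "finite C" "C \<subseteq> D - {0}" "C \<subseteq> ball 0 (R + 1)" "ball 0 R \<subseteq> (\<Union>a\<in>C. ball a (5 * \<rho>))"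
    "real (card C) * \<rho>\<^sup>2 \<le> (R + 2)\<^sup>2"
    using finite_ball_cover[OF dense \<rho>(1,2) R] by blast
  have inb: "x \<in> cball 0 (R + 6)" if "a \<in> C" "x \<in> ball a (5 * \<rho>)" for a x
  proof -
    have "norm a < R + 1" "norm (x - a) < 5" using that C(3) \<rho> by (auto simp: dist_norm norm_minus_commute)
    then show ?thesis using norm_triangle_ineq2[of x a] by simp
  qed
  have pw: "filterlim (\<lambda>j. 2 ^ j :: nat) at_top sequentially"
    by (rule filterlim_at_top_mono[OF filterlim_ident]) (auto intro!: always_eventually less_imp_le less_exp)
  have "eventually (\<lambda>j. \<forall>z\<in>cball 0 (R + 6). scaled_log (2 ^ j) z \<le> limit_potential \<alpha> z + \<epsilon>) sequentially"
    using eventually_compose_filterlim[OF upper[OF \<epsilon>, of "R + 6"] pw] by (simp add: scaled_log_def)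
  moreover have "eventually (\<lambda>j. \<forall>a\<in>C. exp (2 ^ j * (limit_potential \<alpha> a - \<epsilon>)) < norm (W (of_real (zero_scale \<alpha> \<beta> (2 ^ j)) * a))) sequentially"
    using C(1,2) \<epsilon> by (intro eventually_ball_finite ballI lower) auto
  ultimately have "eventually (\<lambda>j. norm ((LINT x:ball 0 R|lborel. \<bar>scaled_log (2 ^ j) x - limit_potential \<alpha> x\<bar>) - 0) < e) sequentially"
  proof eventually_elim
    case (elim j)
    let ?n = "2 ^ j :: nat"
    let ?g = "\<lambda>x. \<bar>scaled_log ?n x - limit_potential \<alpha> x\<bar>"
    have lg: "locally_integrable ?g"
      by (intro locally_integrable_diff locally_integrable_scaled_log locally_integrable_limit_potential[OF \<alpha>]) simp
    have ig: "set_integrable lborel (ball a (5 * \<rho>)) ?g" if "a \<in> C" for a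
    proof (rule set_integrable_subset[of lborel "ball 0 (R + 7)"])
      show "ball a (5 * \<rho>) \<subseteq> ball 0 (R + 7)"
      proof
        fix x assume "x \<in> ball a (5 * \<rho>)"
        from inb[OF that this] show "x \<in> ball 0 (R + 7)" by simp
      qed
    qed (use lg in \<open>auto simp: locally_integrable_def\<close>)
    have each: "(LINT x:ball a (5 * \<rho>)|lborel. ?g x) \<le> 6 * \<epsilon> * (pi * (5 * \<rho>)\<^sup>2)" if a: "a \<in> C" for a
    proof (rule ball_estimate)
      show "5 * \<rho> > 0" using \<rho> by simp
      fix x assume x: "x \<in> ball a (5 * \<rho>)"
      have "a \<in> ball a (5 * \<rho>)" using \<rho> by simp
      then have "dist (limit_potential \<alpha> x) (limit_potential \<alpha> a) < \<epsilon>"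
        using x \<rho> by (intro d(2) inb[OF a]) (auto simp: dist_commute)
      then show "\<bar>limit_potential \<alpha> x - limit_potential \<alpha> a\<bar> \<le> \<epsilon>" by (simp add: dist_real_def)
      show "scaled_log ?n x \<le> limit_potential \<alpha> x + \<epsilon>" using elim(1) inb[OF a x] by blast
    qed (use \<epsilon> elim(2) a in auto)
    have "(LINT x:ball 0 R|lborel. ?g x) \<le> (LINT x|lborel. (\<Sum>a\<in>C. indicator (ball a (5 * \<rho>)) x *\<^sub>R ?g x))"
      unfolding set_lebesgue_integral_def
    proof (rule integral_mono)
      show "integrable lborel (\<lambda>x. indicator (ball 0 R) x *\<^sub>R ?g x)"
        using lg by (simp add: locally_integrable_def set_integrable_def)
      show "integrable lborel (\<lambda>x. \<Sum>a\<in>C. indicator (ball a (5 * \<rho>)) x *\<^sub>R ?g x)"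
        using ig by (intro Bochner_Integration.integrable_sum) (simp add: set_integrable_def)
      fix x :: complex
      show "indicator (ball 0 R) x *\<^sub>R ?g x \<le> (\<Sum>a\<in>C. indicator (ball a (5 * \<rho>)) x *\<^sub>R ?g x)"
      proof (cases "x \<in> ball 0 R")
        case True
        then obtain a where a: "a \<in> C" "x \<in> ball a (5 * \<rho>)" using C(4) by blast
        have "indicator (ball a (5 * \<rho>)) x *\<^sub>R ?g x \<le> (\<Sum>a\<in>C. indicator (ball a (5 * \<rho>)) x *\<^sub>R ?g x)"
          using a(1) C(1) by (intro member_le_sum) auto
        then show ?thesis using a(2) True by simp
      next
        case False
        have "0 \<le> (\<Sum>a\<in>C. indicator (ball a (5 * \<rho>)) x *\<^sub>R ?g x)" by (intro sum_nonneg) simp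
        then show ?thesis using False by simp
      qed
    qed
    also have "\<dots> = (\<Sum>a\<in>C. LINT x:ball a (5 * \<rho>)|lborel. ?g x)"
      using ig unfolding set_lebesgue_integral_def set_integrable_def by (rule Bochner_Integration.integral_sum)
    also have "\<dots> \<le> (\<Sum>a\<in>C. 6 * \<epsilon> * (pi * (5 * \<rho>)\<^sup>2))" by (rule sum_mono[OF each])
    also have "\<dots> = 150 * \<epsilon> * pi * (real (card C) * \<rho>\<^sup>2)" by (simp add: power2_eq_square)
    also have "\<dots> \<le> 150 * \<epsilon> * pi * (R + 2)\<^sup>2" using C(5) \<epsilon> by (intro mult_left_mono) auto
    also have "\<dots> < e" by (rule \<epsilon>2)
    finally have "(LINT x:ball 0 R|lborel. ?g x) < e" .
    moreover have "(LINT x:ball 0 R|lborel. ?g x) \<ge> 0"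
      unfolding set_lebesgue_integral_def by (rule Bochner_Integration.integral_nonneg) simp
    ultimately show ?case by simp
  qed
  then show "\<exists>no. \<forall>n\<ge>no. norm ((LINT x:ball 0 R|lborel. \<bar>scaled_log (2 ^ n) x - limit_potential \<alpha> x\<bar>) - 0) < e"
    by (simp only: eventually_sequentially)
qed

text \<open>The limit potential is homogeneous of the right degree, so the scaling between \<open>n\<close> and the
  largest power of two below it costs only a bounded factor.\<close>

lemma L1_compare:
  assumes j: "2 ^ j \<le> n" "n < 2 ^ (j + 1)" and R: "R \<ge> 0"
  shows "(LINT x:ball 0 R|lborel. \<bar>scaled_log n x - limit_potential \<alpha> x\<bar>) \<le>
    (LINT x:ball 0 (2 powr \<alpha> * R)|lborel. \<bar>scaled_log (2 ^ j) x - limit_potential \<alpha> x\<bar>)"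
proof -
  \<comment> \<open>\<open>t\<close> lies between 1 and 2, and \<open>l\<close> is the ratio of the
    two scales. As \<open>l powr (1 / \<alpha>) = t\<close>, potential and scaled logarithm at
    \<open>l * x\<close> both pick up the same factor \<open>t\<close>.\<close>
  define t where "t = real n / 2 ^ j"
  define l where "l = t powr \<alpha>"
  have "(2::real) ^ j \<le> real n" using j(1) by (metis of_nat_le_iff of_nat_numeral of_nat_power)
  moreover have "real n < 2 ^ (j + 1)" using j(2) by (metis of_nat_less_iff of_nat_numeral of_nat_power)
  ultimately have t: "1 \<le> t" "t \<le> 2" by (auto simp: t_def field_simps)
  have n: "n > 0" using j(1) by (metis gr0I not_le zero_less_numeral zero_less_power)
  have l: "1 \<le> l" "l \<le> 2 powr \<alpha>" using t \<alpha> by (auto simp: l_def ge_one_powr_ge_zero powr_mono2)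
  have cs: "zero_scale \<alpha> \<beta> n = zero_scale \<alpha> \<beta> (2 ^ j) * l"
  proof -
    have "real n = 2 ^ j * t" by (simp add: t_def)
    then have "real n powr \<alpha> = (2 ^ j) powr \<alpha> * l" using t by (simp add: l_def powr_mult)
    then show ?thesis by (simp add: zero_scale_def)
  qed
  have ls: "l powr (1 / \<alpha>) = t" using \<alpha> t by (simp add: l_def powr_powr)
  have us: "limit_potential \<alpha> (of_real l * x) = t * limit_potential \<alpha> x" for x
    using l by (simp add: limit_potential_def norm_mult powr_mult ls)
  have vs: "scaled_log (2 ^ j) (of_real l * x) = t * scaled_log n x" for x
    using n by (simp add: scaled_log_def cs t_def mult.assoc)
  let ?g = "\<lambda>x. \<bar>scaled_log (2 ^ j) x - limit_potential \<alpha> x\<bar>"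
  have lg: "locally_integrable ?g" "locally_integrable (\<lambda>x. \<bar>scaled_log n x - limit_potential \<alpha> x\<bar>)"
    by (intro locally_integrable_diff locally_integrable_scaled_log locally_integrable_limit_potential[OF \<alpha>]; use n in simp)+
  have mg: "?g \<in> borel_measurable borel" using lg by (simp add: locally_integrable_def)
  let ?F = "\<lambda>x. indicator (ball 0 (l * R)) x * ?g x"
  have mF: "?F \<in> borel_measurable borel" using mg by (intro borel_measurable_times borel_measurable_indicator) auto
  \<comment> \<open>A factor \<open>l^2 * t \<ge> 1\<close> is inserted: \<open>l^2\<close> is the
    Jacobian of the substitution and \<open>t\<close> the homogeneity factor.\<close>
  have "(LINT x:ball 0 R|lborel. \<bar>scaled_log n x - limit_potential \<alpha> x\<bar>) \<le> l\<^sup>2 * (LINT x|lborel. t * (indicator (ball 0 R) x * \<bar>scaled_log n x - limit_potential \<alpha> x\<bar>))"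
  proof -
    let ?I = "LINT x|lborel. indicator (ball 0 R) x * \<bar>scaled_log n x - limit_potential \<alpha> x\<bar>"
    have "?I \<ge> 0" by (rule Bochner_Integration.integral_nonneg) simp
    moreover have "1 \<le> l\<^sup>2 * t" using l t mult_mono[of 1 "l\<^sup>2" 1 t] by (simp add: one_le_power)
    ultimately have "1 * ?I \<le> (l\<^sup>2 * t) * ?I" by (intro mult_right_mono)
    then show ?thesis by (simp add: set_lebesgue_integral_def mult.assoc)
  qed
  also have "(\<lambda>x. t * (indicator (ball 0 R) x * \<bar>scaled_log n x - limit_potential \<alpha> x\<bar>)) = (\<lambda>x. ?F (of_real l * x))"
  proof
    fix x :: complex
    have "indicator (ball 0 (l * R)) (of_real l * x) = (indicator (ball 0 R) x :: real)"
      using l by (simp add: indicator_def norm_mult)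
    moreover have "?g (of_real l * x) = t * \<bar>scaled_log n x - limit_potential \<alpha> x\<bar>"
      unfolding us vs right_diff_distrib[symmetric] abs_mult using t by simp
    ultimately show "t * (indicator (ball 0 R) x * \<bar>scaled_log n x - limit_potential \<alpha> x\<bar>) = ?F (of_real l * x)" by simp
  qed
  also have "l\<^sup>2 * (LINT x|lborel. ?F (of_real l * x)) = (LINT x|lborel. ?F x)"
    by (rule lborel_integral_scale_complex[symmetric, OF _ mF]) (use l in auto)
  also have "\<dots> \<le> (LINT x:ball 0 (2 powr \<alpha> * R)|lborel. ?g x)"
    unfolding set_lebesgue_integral_def
  proof (rule integral_mono)
    show "integrable lborel ?F" "integrable lborel (\<lambda>x. indicator (ball 0 (2 powr \<alpha> * R)) x *\<^sub>R ?g x)"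
      using lg by (simp_all add: locally_integrable_def set_integrable_def)
    fix x :: complex
    have "norm x < 2 powr \<alpha> * R" if "norm x < l * R" using that mult_right_mono[OF l(2) R] by linarith
    then show "?F x \<le> indicator (ball 0 (2 powr \<alpha> * R)) x *\<^sub>R ?g x" by (auto simp: indicator_def)
  qed
  finally show ?thesis .
qed

lemma L1_convergence:
  assumes R: "R \<ge> 0"
  shows "(\<lambda>n. LINT x:ball 0 R|lborel. \<bar>scaled_log n x - limit_potential \<alpha> x\<bar>) \<longlonglongrightarrow> 0"
proof (rule LIMSEQ_I)
  fix e :: real assume e: "e > 0"
  have "2 powr \<alpha> * R \<ge> 0" using R by simp
  from order_tendstoD(2)[OF L1_dyadic[OF this] e] obtain J where J: "\<And>j. j \<ge> J \<Longrightarrow>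
    (LINT x:ball 0 (2 powr \<alpha> * R)|lborel. \<bar>scaled_log (2 ^ j) x - limit_potential \<alpha> x\<bar>) < e"
    unfolding eventually_sequentially by blast
  have "norm ((LINT x:ball 0 R|lborel. \<bar>scaled_log n x - limit_potential \<alpha> x\<bar>) - 0) < e" if n: "n \<ge> 2 ^ J" for n
  proof -
    have "1 \<le> n" using n by (metis le_trans one_le_numeral one_le_power)
    then obtain j where j: "2 ^ j \<le> n" "n < 2 ^ (j + 1)" using ex_power_ivl1[of 2 n] by auto
    have "(2::nat) ^ J < 2 ^ (j + 1)" using n j(2) by linarith
    then have "J < j + 1" by (rule power_less_imp_less_exp[rotated]) simp
    then have "(LINT x:ball 0 R|lborel. \<bar>scaled_log n x - limit_potential \<alpha> x\<bar>) < e"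
      using L1_compare[OF j R] J[of j] by simp
    moreover have "0 \<le> (LINT x:ball 0 R|lborel. \<bar>scaled_log n x - limit_potential \<alpha> x\<bar>)"
      unfolding set_lebesgue_integral_def by (rule Bochner_Integration.integral_nonneg) simp
    ultimately show ?thesis by simp
  qed
  then show "\<exists>no. \<forall>n\<ge>no. norm ((LINT x:ball 0 R|lborel. \<bar>scaled_log n x - limit_potential \<alpha> x\<bar>) - 0) < e" by blast
qed

lemma weak_convergence_scaled_log:
  assumes m: "\<Phi> \<in> borel_measurable borel" and C: "\<And>x. \<bar>\<Phi> x\<bar> \<le> C" and \<rho>: "\<And>x. norm x \<ge> \<rho> \<Longrightarrow> \<Phi> x = 0"
  shows "(\<lambda>n. LINT x|lborel. scaled_log n x * \<Phi> x) \<longlonglongrightarrow> (LINT x|lborel. limit_potential \<alpha> x * \<Phi> x)"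
proof -
  have lim: "(\<lambda>n. C * (LINT x:ball 0 \<bar>\<rho>\<bar>|lborel. \<bar>scaled_log n x - limit_potential \<alpha> x\<bar>)) \<longlonglongrightarrow> 0"
    by (intro tendsto_mult_right_zero L1_convergence) simp
  have "(\<lambda>n. (LINT x|lborel. scaled_log n x * \<Phi> x) - (LINT x|lborel. limit_potential \<alpha> x * \<Phi> x)) \<longlonglongrightarrow> 0"
  proof (rule Lim_null_comparison[OF _ lim])
    show "eventually (\<lambda>n. norm ((LINT x|lborel. scaled_log n x * \<Phi> x) - (LINT x|lborel. limit_potential \<alpha> x * \<Phi> x)) \<le>
        C * (LINT x:ball 0 \<bar>\<rho>\<bar>|lborel. \<bar>scaled_log n x - limit_potential \<alpha> x\<bar>)) sequentially"
      using eventually_gt_at_top[of 0]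
    proof eventually_elim
      case (elim n)
      note lv = locally_integrable_scaled_log[OF elim] and lu = locally_integrable_limit_potential[OF \<alpha>]
      have i: "integrable lborel (\<lambda>x. scaled_log n x * \<Phi> x)" "integrable lborel (\<lambda>x. limit_potential \<alpha> x * \<Phi> x)"
        by (rule locally_integrable_mult_bounded[OF lv m C \<rho>], simp)
          (rule locally_integrable_mult_bounded[OF lu m C \<rho>], simp)
      have "(LINT x|lborel. scaled_log n x * \<Phi> x) - (LINT x|lborel. limit_potential \<alpha> x * \<Phi> x) =
        (LINT x|lborel. scaled_log n x * \<Phi> x - limit_potential \<alpha> x * \<Phi> x)"
        using i by simp
      also have "\<bar>\<dots>\<bar> \<le> (LINT x|lborel. C * (indicator (ball 0 \<bar>\<rho>\<bar>) x * \<bar>scaled_log n x - limit_potential \<alpha> x\<bar>))"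
      proof (rule order_trans[OF integral_abs_bound integral_mono])
        show "integrable lborel (\<lambda>x. C * (indicator (ball 0 \<bar>\<rho>\<bar>) x * \<bar>scaled_log n x - limit_potential \<alpha> x\<bar>))"
          using locally_integrable_diff[OF lv lu] by (simp add: locally_integrable_def set_integrable_def)
        fix x
        have "\<bar>scaled_log n x - limit_potential \<alpha> x\<bar> * \<bar>\<Phi> x\<bar> \<le> \<bar>scaled_log n x - limit_potential \<alpha> x\<bar> * C"
          using C by (intro mult_left_mono) auto
        then show "\<bar>scaled_log n x * \<Phi> x - limit_potential \<alpha> x * \<Phi> x\<bar> \<le>
            C * (indicator (ball 0 \<bar>\<rho>\<bar>) x * \<bar>scaled_log n x - limit_potential \<alpha> x\<bar>)"
          using \<rho>[of x] unfolding left_diff_distrib[symmetric] abs_mult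
          by (cases "norm x < \<bar>\<rho>\<bar>") (auto simp: mult.commute)
      qed (use i in simp)
      also have "\<dots> = C * (LINT x:ball 0 \<bar>\<rho>\<bar>|lborel. \<bar>scaled_log n x - limit_potential \<alpha> x\<bar>)"
        by (simp add: set_lebesgue_integral_def)
      finally show ?case by simp
    qed
  qed
  then show ?thesis by (rule LIM_zero_cancel)
qed

text \<open>The integral of \<open>g\<close> against the rescaled zeros divided by \<open>n\<close>,
  written as a finite sum. \<open>R\<close> is a cut-off that has no effect once \<open>g\<close>
  vanishes outside \<open>ball 0 R\<close>.\<close>

definition zero_sum :: "nat \<Rightarrow> real \<Rightarrow> (complex \<Rightarrow> real) \<Rightarrow> real" where
  "zero_sum n R g = (\<Sum>x\<in>{z \<in> ball 0 R. W (of_real (zero_scale \<alpha> \<beta> n) * z) = 0}.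
      real (nat (zorder W (of_real (zero_scale \<alpha> \<beta> n) * x))) * g x) / real n"

text \<open>Both sides of the limit of tested logarithms are translated by duality: before the limit
  into a sum over zeros, in the limit into an integral against the density.\<close>

lemma zero_sum_smooth_limit:
  assumes f: "f \<in> borel_measurable borel" and C: "\<And>x. \<bar>f x\<bar> \<le> C" and \<rho>: "\<And>x. norm x \<ge> \<rho> \<Longrightarrow> f x = 0"
    and r: "r > 0" and R: "\<rho> + r < R"
  shows "(\<lambda>n. zero_sum n R (kernel_smooth r f)) \<longlonglongrightarrow> (LINT x|lborel. limit_density \<alpha> (norm x) * kernel_smooth r f x)"
proof -
  note sm = smear_bounded_support[OF f C \<rho> r]
  have "(\<lambda>n. LINT x|lborel. scaled_log n x * smear r f x) \<longlonglongrightarrow> (LINT x|lborel. limit_potential \<alpha> x * smear r f x)"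
    by (rule weak_convergence_scaled_log[OF sm])
  also have "(LINT x|lborel. limit_potential \<alpha> x * smear r f x) = (LINT x|lborel. limit_density \<alpha> (norm x) * kernel_smooth r f x)"
    by (rule integral_smear_limit_potential(1)[OF \<alpha> f C \<rho> r])
  finally show ?thesis
  proof (rule Lim_transform_eventually)
    show "eventually (\<lambda>n. (LINT x|lborel. scaled_log n x * smear r f x) = zero_sum n R (kernel_smooth r f)) sequentially"
      using eventually_gt_at_top[of 0]
    proof eventually_elim
      case (elim n)
      have "(LINT x|lborel. scaled_log n x * smear r f x) = (LINT x|lborel. ln (norm (W (of_real (zero_scale \<alpha> \<beta> n) * x))) * smear r f x) / real n"
        by (simp add: scaled_log_def)
      then show ?case
        using integral_smear_entire[OF W nz zero_scale_pos[OF elim] f C \<rho> r R] by (simp add: zero_sum_def)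
    qed
  qed
qed

end

section \<open>Vague convergence of the zeros\<close>

context entire_growth
begin

lemma zero_sum_mono:
  assumes "\<And>x. x \<in> ball 0 R \<Longrightarrow> f x \<le> g x"
  shows "zero_sum n R f \<le> zero_sum n R g"
  unfolding zero_sum_def using assms by (intro divide_right_mono sum_mono mult_left_mono) auto

lemma zero_sum_mult: "zero_sum n R (\<lambda>x. c * f x) = c * zero_sum n R f"
  by (simp add: zero_sum_def sum_distrib_left mult.left_commute)

lemma zero_sum_diff: "zero_sum n R (\<lambda>x. f x - g x) = zero_sum n R f - zero_sum n R g"
  by (simp add: zero_sum_def right_diff_distrib sum_subtractf diff_divide_distrib)

lemma zero_sum_mono_radius:
  assumes "n > 0" "R \<le> R'" "\<And>x. f x \<ge> 0"
  shows "zero_sum n R f \<le> zero_sum n R' f"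
  unfolding zero_sum_def
  using assms finite_zeros_scale[OF W nz zero_scale_pos[OF assms(1)], of R']
  by (intro divide_right_mono sum_mono2) auto

text \<open>Tightness. The smoothing of a plateau function equals the kernel mass on
  \<open>ball 0 R\<close>, so the convergent sums just obtained dominate the number of zeros
  there.\<close>

lemma zero_sum_bounded:
  assumes R: "R > 0"
  obtains B where "eventually (\<lambda>n. zero_sum n R (\<lambda>_. 1) \<le> B) sequentially"
proof -
  \<comment> \<open>Equal to 1 up to radius \<open>R + 1\<close> and 0 from \<open>R + 2\<close> on:
    a kernel of radius 1 centred in \<open>ball 0 R\<close> sees only the plateau. The later
    \<open>R + 4\<close> exceeds \<open>R + 2\<close> plus the kernel radius.\<close>
  define f where "f x = max 0 (min 1 (R + 2 - norm x))" for x :: complex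
  have f: "f \<in> borel_measurable borel" unfolding f_def[abs_def] by measurable
  have C: "\<bar>f x\<bar> \<le> 1" for x by (auto simp: f_def)
  have \<rho>: "norm x \<ge> R + 2 \<Longrightarrow> f x = 0" for x by (auto simp: f_def)
  define c where "c = (LINT a|lborel. jensen_kernel 1 a)"
  have c: "c > 0" using integral_jensen_kernel_pos[of 1] by (simp add: c_def)
  let ?L = "LINT x|lborel. limit_density \<alpha> (norm x) * kernel_smooth 1 f x"
  have "(\<lambda>n. zero_sum n (R + 4) (kernel_smooth 1 f)) \<longlonglongrightarrow> ?L"
    by (rule zero_sum_smooth_limit[OF f C \<rho>]) auto
  then have "eventually (\<lambda>n. zero_sum n (R + 4) (kernel_smooth 1 f) < ?L + 1) sequentially"
    by (rule order_tendstoD) simp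
  then have "eventually (\<lambda>n. zero_sum n R (\<lambda>_. 1) \<le> (?L + 1) / c) sequentially"
    using eventually_gt_at_top[of 0]
  proof eventually_elim
    case (elim n)
    have "c * zero_sum n R (\<lambda>_. 1) = zero_sum n R (\<lambda>x. c * 1)" by (rule zero_sum_mult[symmetric])
    also have "\<dots> \<le> zero_sum n R (kernel_smooth 1 f)"
    proof (rule zero_sum_mono)
      fix x :: complex assume x: "x \<in> ball 0 R"
      have "\<bar>kernel_smooth 1 f x - f x * c\<bar> \<le> 0 * c"
        unfolding c_def
      proof (rule kernel_smooth_approx[OF _ f C])
        fix a assume "norm (a - x) < 1"
        then have "norm a < R + 1" using x norm_triangle_ineq2[of a x] by simp
        then show "\<bar>f a - f x\<bar> \<le> 0" using x by (simp add: f_def)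
      qed simp
      moreover have "f x = 1" using x by (simp add: f_def)
      ultimately show "c * 1 \<le> kernel_smooth 1 f x" by simp
    qed
    also have "\<dots> \<le> zero_sum n (R + 4) (kernel_smooth 1 f)"
      using elim by (intro zero_sum_mono_radius kernel_smooth_nonneg) (auto simp: f_def)
    also have "\<dots> \<le> ?L + 1" using elim by simp
    finally show ?case using c by (simp add: pos_le_divide_eq mult.commute)
  qed
  then show thesis using that by blast
qed

text \<open>Uniform continuity makes \<open>f\<close> uniformly close to its normalised smoothing
  \<open>g\<close>, for which the limit is known. The uniform error is multiplied only by the mass
  of zeros and the mass of the limit measure, both bounded on the disk.\<close>

lemma zero_sum_limit:
  fixes f :: "complex \<Rightarrow> real"
  assumes f: "continuous_on UNIV f" and \<rho>: "\<rho> > 0" "\<And>x. norm x \<ge> \<rho> \<Longrightarrow> f x = 0" and R: "\<rho> + 1 < R"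
  shows "(\<lambda>n. zero_sum n R f) \<longlonglongrightarrow> (LINT x|lborel. limit_density \<alpha> (norm x) * f x)"
proof -
  have mf: "f \<in> borel_measurable borel" by (rule borel_measurable_continuous_onI[OF f])
  obtain C where C: "\<And>x. \<bar>f x\<bar> \<le> C"
  proof -
    have "bounded (f ` cball 0 \<rho>)"
      by (intro compact_imp_bounded compact_continuous_image continuous_on_subset[OF f]) auto
    then obtain b where "\<forall>y\<in>f ` cball 0 \<rho>. norm y \<le> b" unfolding bounded_iff by blast
    then have b: "x \<in> cball 0 \<rho> \<Longrightarrow> \<bar>f x\<bar> \<le> b" for x by simp
    have "\<bar>f x\<bar> \<le> max b 0" for x
      using b[of x] \<rho>(2)[of x] by (cases "norm x \<le> \<rho>") auto
    then show thesis by (rule that)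
  qed
  have "R > 0" using \<rho> R by simp
  then obtain B where B: "eventually (\<lambda>n. zero_sum n R (\<lambda>_. 1) \<le> B) sequentially"
    by (rule zero_sum_bounded)
  let ?q = "\<lambda>x::complex. indicator (ball 0 R) x * limit_density \<alpha> (norm x)"
  have iq: "integrable lborel ?q"
    using set_integrable_limit_density[OF \<alpha>, of R] by (simp add: set_integrable_def)
  define Q where "Q = integral\<^sup>L lborel ?q"
  have Q0: "Q \<ge> 0" unfolding Q_def
    using limit_density_nonneg[OF \<alpha>] by (intro Bochner_Integration.integral_nonneg) auto
  \<comment> \<open>An upper bound for the eventual mass of zeros plus the limit mass in
    \<open>ball 0 R\<close>; the added 1 makes it positive for the division that defines
    \<open>\<epsilon>\<close>.\<close>
  define B' where "B' = \<bar>B\<bar> + Q + 1"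
  have B': "B' > 0" using Q0 by (simp add: B'_def)
  have iqf: "integrable lborel (\<lambda>x. limit_density \<alpha> (norm x) * f x)"
  proof -
    have "set_integrable lborel (ball 0 R) (\<lambda>x. limit_density \<alpha> (norm x) * f x)"
      by (rule set_integrable_mult_bounded[OF set_integrable_limit_density[OF \<alpha>] mf _ _ C]) auto
    moreover have "indicator (ball 0 R) x *\<^sub>R (limit_density \<alpha> (norm x) * f x) = limit_density \<alpha> (norm x) * f x" for x
      using \<rho>(2)[of x] R by (cases "norm x < R") auto
    ultimately show ?thesis by (simp only: set_integrable_def)
  qed
  show ?thesis
  proof (rule LIMSEQ_I)
    fix e :: real assume e: "e > 0"
    define \<epsilon> where "\<epsilon> = e / (2 * B')"
    have \<epsilon>: "\<epsilon> > 0" using e B' by (simp add: \<epsilon>_def)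
    have "uniformly_continuous_on (cball 0 (\<rho> + 2)) f"
      by (intro compact_uniformly_continuous continuous_on_subset[OF f]) auto
    then obtain d where d: "d > 0" "\<And>x y. x \<in> cball 0 (\<rho> + 2) \<Longrightarrow> y \<in> cball 0 (\<rho> + 2) \<Longrightarrow> dist y x < d \<Longrightarrow> dist (f y) (f x) < \<epsilon>"
      unfolding uniformly_continuous_on_def using \<epsilon> by metis
    define r where "r = min 1 d"
    have r: "r > 0" "r \<le> 1" "r \<le> d" using d by (auto simp: r_def)
    have osc: "\<bar>f a - f x\<bar> \<le> \<epsilon>" if "norm (a - x) < r" for a x
    proof (cases "norm x \<le> \<rho> + 1")
      case True
      then have "norm a \<le> \<rho> + 2" using that r norm_triangle_ineq2[of a x] by linarith
      then have "dist (f a) (f x) < \<epsilon>" using d(2)[of x a] True that r by (simp add: dist_norm)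
      then show ?thesis by (simp add: dist_real_def)
    next
      case False
      then have "norm a \<ge> \<rho>" using that r norm_triangle_ineq2[of x a] by (simp add: norm_minus_commute)
      then show ?thesis using \<rho>(2)[of a] \<rho>(2)[of x] False \<epsilon> by simp
    qed
    define c where "c = (LINT a|lborel. jensen_kernel r a)"
    have c: "c > 0" using integral_jensen_kernel_pos[OF r(1)] by (simp add: c_def)
    define g where "g x = 1 / c * kernel_smooth r f x" for x
    have fg: "\<bar>f x - g x\<bar> \<le> \<epsilon>" for x
    proof -
      have "\<bar>kernel_smooth r f x - f x * c\<bar> \<le> \<epsilon> * c"
        unfolding c_def by (rule kernel_smooth_approx[OF r(1) mf C osc])
      moreover have "kernel_smooth r f x - f x * c = (g x - f x) * c" using c by (simp add: g_def field_simps)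
      ultimately have "\<bar>g x - f x\<bar> * c \<le> \<epsilon> * c" using c by (simp add: abs_mult)
      then have "\<bar>g x - f x\<bar> \<le> \<epsilon>" using c by (rule mult_right_le_imp_le)
      then show ?thesis by (simp add: abs_minus_commute)
    qed
    have g0: "g x = 0" if "norm x \<ge> R" for x
      using kernel_smooth_eq_0[OF r(1), of \<rho> f x] \<rho>(2) that R r by (simp add: g_def)
    have ig: "integrable lborel (\<lambda>x. limit_density \<alpha> (norm x) * g x)"
      using integral_smear_limit_potential(2)[OF \<alpha> mf C \<rho>(2) r(1)] unfolding g_def by (simp add: mult.left_commute)
    have "(\<lambda>n. 1 / c * zero_sum n R (kernel_smooth r f)) \<longlonglongrightarrow> 1 / c * (LINT x|lborel. limit_density \<alpha> (norm x) * kernel_smooth r f x)"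
      using R r by (intro tendsto_intros zero_sum_smooth_limit[OF mf C \<rho>(2)]) auto
    then have "(\<lambda>n. zero_sum n R g) \<longlonglongrightarrow> (LINT x|lborel. limit_density \<alpha> (norm x) * g x)"
      unfolding zero_sum_mult[symmetric] g_def by (simp add: mult.left_commute)
    from LIMSEQ_D[OF this, of "e / 2"] e have "eventually (\<lambda>n. \<bar>zero_sum n R g - (LINT x|lborel. limit_density \<alpha> (norm x) * g x)\<bar> < e / 2) sequentially"
      by (auto simp: eventually_sequentially)
    with B have "eventually (\<lambda>n. norm (zero_sum n R f - (LINT x|lborel. limit_density \<alpha> (norm x) * f x)) < e) sequentially"
    proof eventually_elim
      case (elim n)
      have "\<bar>zero_sum n R f - zero_sum n R g\<bar> \<le> \<epsilon> * B"
      proof -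
        have "zero_sum n R f - zero_sum n R g \<le> zero_sum n R (\<lambda>x. \<epsilon> * 1)"
          unfolding zero_sum_diff[symmetric]
        proof (rule zero_sum_mono)
          show "f x - g x \<le> \<epsilon> * 1" for x using fg[of x] by linarith
        qed
        moreover have "zero_sum n R g - zero_sum n R f \<le> zero_sum n R (\<lambda>x. \<epsilon> * 1)"
          unfolding zero_sum_diff[symmetric]
        proof (rule zero_sum_mono)
          show "g x - f x \<le> \<epsilon> * 1" for x using fg[of x] by linarith
        qed
        moreover have "zero_sum n R (\<lambda>x. \<epsilon> * 1) \<le> \<epsilon> * B"
          unfolding zero_sum_mult using elim(1) \<epsilon> by (intro mult_left_mono) auto
        ultimately show ?thesis by linarith
      qed
      moreover have "\<bar>(LINT x|lborel. limit_density \<alpha> (norm x) * f x) - (LINT x|lborel. limit_density \<alpha> (norm x) * g x)\<bar> \<le> \<epsilon> * Q"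
      proof -
        have "(LINT x|lborel. limit_density \<alpha> (norm x) * f x) - (LINT x|lborel. limit_density \<alpha> (norm x) * g x) =
          (LINT x|lborel. limit_density \<alpha> (norm x) * f x - limit_density \<alpha> (norm x) * g x)"
          using iqf ig by simp
        also have "\<bar>\<dots>\<bar> \<le> (LINT x|lborel. \<epsilon> * ?q x)"
        proof (rule order_trans[OF integral_abs_bound integral_mono])
          fix x :: complex
          have "\<bar>limit_density \<alpha> (norm x) * f x - limit_density \<alpha> (norm x) * g x\<bar> = limit_density \<alpha> (norm x) * \<bar>f x - g x\<bar>"
            unfolding right_diff_distrib[symmetric] abs_mult using limit_density_nonneg[OF \<alpha>] by simp
          also have "\<dots> \<le> \<epsilon> * ?q x"
          proof (cases "norm x < R")
            case True
            have "limit_density \<alpha> (norm x) * \<bar>f x - g x\<bar> \<le> limit_density \<alpha> (norm x) * \<epsilon>"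
              using fg limit_density_nonneg[OF \<alpha>] by (intro mult_left_mono) auto
            then show ?thesis using True by (simp add: mult.commute)
          next
            case False
            then show ?thesis using g0[of x] \<rho>(2)[of x] R by simp
          qed
          finally show "\<bar>limit_density \<alpha> (norm x) * f x - limit_density \<alpha> (norm x) * g x\<bar> \<le> \<epsilon> * ?q x" .
        next
          show "integrable lborel (\<lambda>x. \<bar>limit_density \<alpha> (norm x) * f x - limit_density \<alpha> (norm x) * g x\<bar>)"
            using iqf ig by (intro integrable_abs Bochner_Integration.integrable_diff)
          show "integrable lborel (\<lambda>x. \<epsilon> * ?q x)" using iq by (rule integrable_mult_right)
        qed
        also have "\<dots> = \<epsilon> * Q" unfolding Q_def by (rule Bochner_Integration.integral_mult_right_zero)
        finally show ?thesis .
      qed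
      moreover have "\<epsilon> * B + \<epsilon> * Q \<le> e / 2"
      proof -
        have "\<epsilon> * B + \<epsilon> * Q = \<epsilon> * (B + Q)" by (simp add: algebra_simps)
        also have "\<dots> \<le> \<epsilon> * B'" using \<epsilon> by (intro mult_left_mono) (auto simp: B'_def)
        also have "\<dots> = e / 2" using B' by (simp add: \<epsilon>_def)
        finally show ?thesis .
      qed
      ultimately show ?case using elim(2) unfolding real_norm_def by linarith
    qed
    then show "\<exists>no. \<forall>n\<ge>no. norm (zero_sum n R f - (LINT x|lborel. limit_density \<alpha> (norm x) * f x)) < e"
      by (simp only: eventually_sequentially)
  qed
qed

lemma integral_zero_measure:
  fixes g :: "complex \<Rightarrow> real"
  assumes g: "g \<in> borel_measurable borel" and R: "\<And>x. norm x \<ge> R \<Longrightarrow> g x = 0"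
  shows "integral\<^sup>L (zero_measure W) g = (\<Sum>x\<in>{z \<in> ball 0 R. W z = 0}. real (nat (zorder W x)) * g x)"
proof -
  let ?Z = "{z. W z = 0}"
  have fin: "finite {z \<in> ball 0 R. W z = 0}"
    using holomorphic_factor_zeros_ball[OF W nz, of R] by blast
  have sub: "{a\<in>?Z. real (nat (zorder W a)) *\<^sub>R g a \<noteq> 0} \<subseteq> {z \<in> ball 0 R. W z = 0}"
    using R by force
  have "integral\<^sup>L (zero_measure W) g = integral\<^sup>L (point_measure ?Z (\<lambda>z. of_nat (nat (zorder W z)))) g"
    unfolding zero_measure_def using nz g by (subst if_not_P, simp, subst integral_distr) (auto simp: point_measure_def)
  also have "\<dots> = integral\<^sup>L (density (count_space ?Z) (\<lambda>z. ennreal (real (nat (zorder W z))))) g"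
    by (simp add: point_measure_def ennreal_of_nat_eq_real_of_nat)
  also have "\<dots> = integral\<^sup>L (count_space ?Z) (\<lambda>z. real (nat (zorder W z)) *\<^sub>R g z)"
    by (rule integral_density) auto
  also have "\<dots> = (\<Sum>a | a \<in> ?Z \<and> real (nat (zorder W a)) *\<^sub>R g a \<noteq> 0. real (nat (zorder W a)) *\<^sub>R g a)"
    by (rule lebesgue_integral_count_space_finite_support) (rule finite_subset[OF sub fin])
  also have "\<dots> = (\<Sum>x\<in>{z \<in> ball 0 R. W z = 0}. real (nat (zorder W x)) * g x)"
    by (rule sum.mono_neutral_cong_left[OF fin sub]) auto
  finally show ?thesis .
qed

text \<open>Division by the scale maps the zeros of \<open>W\<close> to those of
  \<open>W (c * z)\<close>, while the orders are still taken at the original zeros.\<close>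

lemma integral_scaled_zero_measure:
  fixes f :: "complex \<Rightarrow> real"
  assumes n: "n > 0" and f: "f \<in> borel_measurable borel" and R: "\<And>x. norm x \<ge> R \<Longrightarrow> f x = 0"
  shows "integral\<^sup>L (scale_measure (ennreal (1 / real n)) (rescaled_zero_measure \<alpha> \<beta> W n)) f = zero_sum n R f"
proof -
  let ?c = "zero_scale \<alpha> \<beta> n"
  have c: "?c > 0" by (rule zero_scale_pos[OF n])
  let ?N = "rescaled_zero_measure \<alpha> \<beta> W n"
  have sN: "sets ?N = sets borel" by (simp add: rescaled_zero_measure_def)
  have fN: "f \<in> borel_measurable ?N" using f by (simp add: measurable_cong_sets[OF sN refl])
  have "scale_measure (ennreal (1 / real n)) ?N = density ?N (\<lambda>_. ennreal (1 / real n))"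
    by (rule measure_eqI) (simp_all add: emeasure_density_const)
  then have "integral\<^sup>L (scale_measure (ennreal (1 / real n)) ?N) f = integral\<^sup>L ?N (\<lambda>x. (1 / real n) *\<^sub>R f x)"
    using fN by (simp add: integral_density)
  also have "\<dots> = integral\<^sup>L ?N f / real n" by simp
  also have "integral\<^sup>L ?N f = integral\<^sup>L (zero_measure W) (\<lambda>z. f (z / of_real ?c))"
    unfolding rescaled_zero_measure_def zero_scale_def[symmetric]
    by (rule integral_distr[OF _ f]) (simp add: measurable_cong_sets[OF sets_zero_measure refl])
  also have "\<dots> = (\<Sum>x\<in>{z \<in> ball 0 (?c * R). W z = 0}. real (nat (zorder W x)) * f (x / of_real ?c))"
  proof (rule integral_zero_measure)
    show "(\<lambda>z. f (z / of_real ?c)) \<in> borel_measurable borel" by (rule measurable_compose[OF _ f]) simp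
    fix x :: complex assume "norm x \<ge> ?c * R"
    then show "f (x / of_real ?c) = 0" using c by (intro R) (simp add: norm_divide field_simps)
  qed
  also have "\<dots> = (\<Sum>x\<in>{z \<in> ball 0 R. W (of_real ?c * z) = 0}. real (nat (zorder W (of_real ?c * x))) * f x)"
  proof (rule sum.reindex_bij_witness[of _ "\<lambda>x. of_real ?c * x" "\<lambda>x. x / of_real ?c"])
  qed (use c in \<open>auto simp: norm_divide norm_mult field_simps\<close>)
  finally show ?thesis by (simp add: zero_sum_def)
qed

lemma locally_finite_scaled_zero_measure:
  "locally_finite_measure (scale_measure (ennreal (1 / real n)) (rescaled_zero_measure \<alpha> \<beta> W n))"
  unfolding locally_finite_measure_def
proof (intro conjI allI impI)
  show "sets (scale_measure (ennreal (1 / real n)) (rescaled_zero_measure \<alpha> \<beta> W n)) = sets borel"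
    by (simp add: rescaled_zero_measure_def)
  fix K :: "complex set" assume K: "compact K"
  show "emeasure (scale_measure (ennreal (1 / real n)) (rescaled_zero_measure \<alpha> \<beta> W n)) K < \<infinity>"
  \<comment> \<open>At \<open>n = 0\<close> the factor is \<open>1 / 0 = 0\<close> and the measure
    vanishes, which settles an index without meaning for the limit.\<close>
  proof (cases "n = 0")
    case False
    let ?S = "(\<lambda>z. of_real (exp \<beta> * real n powr \<alpha>) * z) ` K"
    have "compact ?S" by (intro compact_continuous_image K continuous_intros)
    then obtain R where S: "?S \<subseteq> ball 0 R" using compact_imp_bounded bounded_subset_ballD by blast
    have fin: "finite {z \<in> ?S. W z = 0}"
    proof (rule finite_subset)
      show "{z \<in> ?S. W z = 0} \<subseteq> {z \<in> ball 0 R. W z = 0}" using S by blast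
      show "finite {z \<in> ball 0 R. W z = 0}"
        using holomorphic_factor_zeros_ball[OF W nz, of R] by blast
    qed
    have "emeasure (rescaled_zero_measure \<alpha> \<beta> W n) K = emeasure (zero_measure W) ?S"
      using False K by (intro emeasure_rescaled_zero_measure) (auto intro: borel_compact)
    also have "\<dots> = (\<integral>\<^sup>+z. of_nat (nat (zorder W z)) \<partial>count_space {z \<in> ?S. W z = 0})"
      using \<open>compact ?S\<close> by (intro emeasure_zero_measure nz) (auto intro: borel_compact)
    also have "\<dots> = (\<Sum>z\<in>{z \<in> ?S. W z = 0}. of_nat (nat (zorder W z)))"
      by (rule nn_integral_count_space_finite[OF fin])
    also have "\<dots> = of_nat (\<Sum>z\<in>{z \<in> ?S. W z = 0}. nat (zorder W z))" by simp
    also have "\<dots> < \<infinity>" by (simp add: ennreal_of_nat_eq_real_of_nat)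
    finally show ?thesis by (simp add: ennreal_mult_less_top)
  qed simp
qed

theorem vague_convergence:
  "converges_vaguely (\<lambda>n. scale_measure (ennreal (1 / real n)) (rescaled_zero_measure \<alpha> \<beta> W n))
    (density lborel (\<lambda>z. ennreal (limit_density \<alpha> (norm z))))"
  unfolding converges_vaguely_def
proof (intro conjI allI impI)
  show "locally_finite_measure (scale_measure (ennreal (1 / real n)) (rescaled_zero_measure \<alpha> \<beta> W n))" for n
    by (rule locally_finite_scaled_zero_measure)
  show "locally_finite_measure (density lborel (\<lambda>z. ennreal (limit_density \<alpha> (norm z))))"
    unfolding locally_finite_measure_def
  proof (intro conjI allI impI)
    fix K :: "complex set" assume K: "compact K"
    then obtain R where R: "K \<subseteq> ball 0 R" using compact_imp_bounded bounded_subset_ballD by blast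
    have "emeasure (density lborel (\<lambda>z. ennreal (limit_density \<alpha> (norm z)))) K =
        (\<integral>\<^sup>+x. ennreal (limit_density \<alpha> (norm x)) * indicator K x \<partial>lborel)"
      using K by (intro emeasure_density) (auto intro: borel_compact)
    also have "\<dots> \<le> (\<integral>\<^sup>+x. ennreal (indicator (ball (0::complex) R) x *\<^sub>R limit_density \<alpha> (norm x)) \<partial>lborel)"
      using R by (intro nn_integral_mono) (auto simp: indicator_def)
    also have "\<dots> < \<infinity>"
      using set_integrable_limit_density[OF \<alpha>, of R] limit_density_nonneg[OF \<alpha>]
      unfolding set_integrable_def by (subst nn_integral_eq_integral) auto
    finally show "emeasure (density lborel (\<lambda>z. ennreal (limit_density \<alpha> (norm z)))) K < \<infinity>" .
  qed simp
  fix f :: "complex \<Rightarrow> real"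
  assume f: "continuous_on UNIV f" and K: "compact (closure {z. f z \<noteq> 0})"
  have mf: "f \<in> borel_measurable borel" by (rule borel_measurable_continuous_onI[OF f])
  obtain \<rho>0 where \<rho>0: "closure {z. f z \<noteq> 0} \<subseteq> ball 0 \<rho>0"
    using K compact_imp_bounded bounded_subset_ballD by blast
  define \<rho> where "\<rho> = \<bar>\<rho>0\<bar> + 1"
  have \<rho>: "f x = 0" if "norm x \<ge> \<rho>" for x
  proof (rule ccontr)
    assume "f x \<noteq> 0"
    then have "x \<in> {z. f z \<noteq> 0}" by simp
    then have "x \<in> ball 0 \<rho>0" by (rule subsetD[OF order_trans[OF closure_subset \<rho>0]])
    then show False using that by (simp add: \<rho>_def)
  qed
  have "(\<lambda>n. zero_sum n (\<rho> + 2) f) \<longlonglongrightarrow> (LINT x|lborel. limit_density \<alpha> (norm x) * f x)"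
    by (rule zero_sum_limit[OF f _ \<rho>]) (auto simp: \<rho>_def)
  also have "(LINT x|lborel. limit_density \<alpha> (norm x) * f x) = integral\<^sup>L (density lborel (\<lambda>z. ennreal (limit_density \<alpha> (norm z)))) f"
    using mf limit_density_nonneg[OF \<alpha>] by (subst integral_density) auto
  finally show "(\<lambda>n. integral\<^sup>L (scale_measure (ennreal (1 / real n)) (rescaled_zero_measure \<alpha> \<beta> W n)) f) \<longlonglongrightarrow>
      integral\<^sup>L (density lborel (\<lambda>z. ennreal (limit_density \<alpha> (norm z)))) f"
  proof (rule Lim_transform_eventually)
    show "eventually (\<lambda>n. zero_sum n (\<rho> + 2) f = integral\<^sup>L (scale_measure (ennreal (1 / real n)) (rescaled_zero_measure \<alpha> \<beta> W n)) f) sequentially"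
      using eventually_gt_at_top[of 0]
    proof eventually_elim
      case (elim n)
      have "f x = 0" if "norm x \<ge> \<rho> + 2" for x using that by (intro \<rho>) simp
      then show ?case by (rule integral_scaled_zero_measure[OF elim mf, symmetric])
    qed
  qed
qed

end

lemma entire_power_series:
  fixes c :: "nat \<Rightarrow> complex"
  assumes "\<And>z. summable (\<lambda>k. c k * z ^ k)"
  shows "(\<lambda>z. \<Sum>k. c k * z ^ k) holomorphic_on UNIV"
proof (rule holomorphic_onI)
  fix z :: complex
  have "(\<lambda>z. \<Sum>k. c k * z ^ k) holomorphic_on ball 0 (norm z + 1)"
    by (rule power_series_holomorphic[where a = c]) (use assms in \<open>auto simp: summable_sums\<close>)
  then have "(\<lambda>z. \<Sum>k. c k * z ^ k) field_differentiable at z"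
    by (rule holomorphic_on_imp_differentiable_at) auto
  then show "(\<lambda>z. \<Sum>k. c k * z ^ k) field_differentiable at z within UNIV" by simp
qed

theorem theorem2p5:
  fixes M :: "'a measure"
    and \<xi> :: "nat \<Rightarrow> 'a \<Rightarrow> complex"
    and w :: "nat \<Rightarrow> complex"
    and \<alpha> \<beta> :: real
  assumes "prob_space M"
    and "prob_space.indep_vars M (\<lambda>_. borel) \<xi> UNIV"
    and "\<And>k. distr M borel (\<xi> k) = distr M borel (\<xi> 0)"
    and "\<not> (\<exists>c. AE \<omega> in M. \<xi> 0 \<omega> = c)"
    and "integrable M (\<lambda>\<omega>. ln (1 + norm (\<xi> 0 \<omega>)))"
    and "\<alpha> > 0"
    and "(\<lambda>k. ln (norm (w k)) - (- \<alpha> * (real k * ln (real k) - real k) - \<beta> * real k))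
           \<in> o[at_top](\<lambda>k. real k)"
  shows "AE \<omega> in M. converges_vaguely
           (\<lambda>n. scale_measure (ennreal (1 / real n))
                  (rescaled_zero_measure \<alpha> \<beta> (random_power_series \<xi> w \<omega>) n))
           (density lborel (\<lambda>z. ennreal (1 / (2 * pi * \<alpha>) * norm z powr (1 / \<alpha> - 2))))"
proof -
  interpret prob_space M by fact
  interpret iid_sequence M \<xi> by unfold_locales (use assms(2,3) in auto)
  note \<alpha> = \<open>\<alpha> > 0\<close>
  have w: "(\<lambda>k. ln (norm (w k)) - weight_exponent \<alpha> \<beta> k) \<in> o[at_top](\<lambda>k. real k)"
    using assms(7) by (simp add: weight_exponent_def)
  \<comment> \<open>The lower bound holds almost surely for each single centre; a countable dense
    set of centres and countably many tolerances leave one null set.\<close>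
  obtain D :: "complex set" where D: "countable D" "\<And>X. open X \<Longrightarrow> X \<noteq> {} \<Longrightarrow> \<exists>d\<in>D. d \<in> X"
    using countable_dense_setE by blast
  let ?W = "random_power_series \<xi> w"
  let ?low = "\<lambda>\<omega> a \<delta>. eventually (\<lambda>j. exp (2 ^ j * (limit_potential \<alpha> a - \<delta>)) <
      norm (?W \<omega> (of_real (zero_scale \<alpha> \<beta> (2 ^ j)) * a))) sequentially"
  have "AE \<omega> in M. \<forall>a\<in>D - {0}. \<forall>m::nat. ?low \<omega> a (inverse (real (Suc m)))"
    using D(1) by (intro AE_ball_countable[THEN iffD2] ballI AE_all_countable[THEN iffD2] allI
        AE_lower_bound[OF \<alpha> w assms(4,5)]) auto
  then show ?thesis using AE_coefficients[OF \<alpha> w assms(4,5)]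
  proof eventually_elim
    case (elim \<omega>)
    let ?c = "\<lambda>k. \<xi> k \<omega> * w k"
    have W_eq: "?W \<omega> = (\<lambda>z. \<Sum>k. ?c k * z ^ k)" by (simp add: random_power_series_def fun_eq_iff)
    have coeff: "\<exists>C>0. \<forall>k. norm (?c k) \<le> C * exp (weight_exponent \<alpha> \<beta> k + \<epsilon> * real k)" if "\<epsilon> > 0" for \<epsilon>
      using elim(2) that by blast
    have low: "?low \<omega> a \<delta>" if a: "a \<in> D" "a \<noteq> 0" and \<delta>: "\<delta> > 0" for a \<delta>
    proof -
      obtain m where m: "inverse (real (Suc m)) < \<delta>" using reals_Archimedean[OF \<delta>] by blast
      have "?low \<omega> a (inverse (real (Suc m)))" using elim(1) a by blast
      then show ?thesis
      proof eventually_elim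
        case (elim j)
        have "(2::real) ^ j * (limit_potential \<alpha> a - \<delta>) \<le> 2 ^ j * (limit_potential \<alpha> a - inverse (real (Suc m)))"
          using m by (intro mult_left_mono) auto
        then have "exp (2 ^ j * (limit_potential \<alpha> a - \<delta>)) \<le> exp (2 ^ j * (limit_potential \<alpha> a - inverse (real (Suc m))))"
          by simp
        then show ?case using elim by linarith
      qed
    qed
    interpret entire_growth "?W \<omega>" \<alpha> \<beta> D
    proof
      show "?W \<omega> holomorphic_on UNIV"
        unfolding W_eq
        by (rule entire_power_series, rule summable_norm_cancel, rule power_series_growth(1)[OF \<alpha> w coeff])
      \<comment> \<open>A vanishing series is incompatible with the lower bound at any one nonzero
        centre, since an exponential would be below 0.\<close>
      show "\<not> (\<forall>z. ?W \<omega> z = 0)"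
      proof
        assume zero: "\<forall>z. ?W \<omega> z = 0"
        obtain a where a: "a \<in> D" "a \<noteq> 0" using D(2)[of "- {0}"] by auto
        have "eventually (\<lambda>j::nat. False) sequentially"
          using low[OF a zero_less_one] by eventually_elim (simp add: zero not_less)
        then show False by simp
      qed
      show "eventually (\<lambda>n. \<forall>z\<in>cball 0 R. ln (norm (?W \<omega> (of_real (zero_scale \<alpha> \<beta> n) * z))) / real n \<le>
          limit_potential \<alpha> z + \<delta>) sequentially" if "\<delta> > 0" for \<delta> R
        by (rule upper_bound_scaled[OF \<alpha> w _ that]) (unfold W_eq, rule power_series_growth(2)[OF \<alpha> w coeff])
    qed (use \<alpha> low D(2) in auto)
    show ?case using vague_convergence by (simp add: limit_density_def)
  qed
qed

end
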